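(* Work in $\mathbf{CZF}$. Full NID implies that for every set $P$ of propositional letters and every game theory $T$ over $P$, the class of models of $T$ is set-generated (as a class of subsets of $P$). Likewise, finitary NID implies that the class of models of any finitary game theory over $P$ is set-generated, and elementary NID implies that the class of models of any elementary game theory over $P$ is set-generated.
   Context: Let $P$ be a set of propositional letters. A game formula over $P$ is built from letters in $P$ using set-indexed infinitary disjunctions $\bigvee_{i\in I}$ and conjunctions $\bigwedge_{i\in I}$ ($I$ a set), with no implications or negations. A game sequent is $\varphi\to\psi$ with $\varphi,\psi$ game formulas; a game theory is a set of game sequents. A finitary game formula is one in which all conjunctions are indexed by finite sets (images of some $\{1,\dots,n\}$); an elementary game formula is one containing no conjunctions. A finitary (elementary) game sequent is one whose hypothesis $\varphi$ is finitary (elementary); a finitary (elementary) game theory is a set of such sequents. A model is identified with a subset $M\subseteq P$ (the true letters), with the evident satisfaction relation: $M\models p$ iff $p\in M$, $\bigwedge$ holds iff all conjuncts hold, $\bigvee$ holds iff some disjunct holds, and $M\models T$ iff for each $\varphi\to\psi\in T$, $M\models\varphi$ implies $M\models\psi$. A class $\mathcal M$ of subsets of $P$ is set-generated if there is a set $G\subseteq\mathcal M$ with $\forall\alpha\in\mathcal M\,\forall x\in\alpha\,\exists\beta\in G\,x\in\beta\subseteq\alpha$. A rule on a set $X$ is a pair $(a,b)$ of subsets of $X$, elementary if $a$ is a singleton, finitary if $a$ finite; $Y\subseteq X$ is closed under it if $a\subseteq Y$ implies $b\cap Y$ inhabited. Full NID: for every set $X$ and set $\mathcal R$ of rules on $X$,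 the class of subsets of $X$ closed under all rules in $\mathcal R$ is set-generated; finitary (elementary) NID is the same restricted to finitary (elementary) rules. *)

theory Defs
  imports Main
begin

text \<open>
  HOL is classical and proves every instance of NID outright, so the object theory CZF is
  embedded deeply: a datatype of formulas of the language of set theory, intuitionistic natural
  deduction, and the axioms of CZF. \<open>CZF \<turnstile> A\<close> is derivability in that calculus.
\<close>

section \<open>Intuitionistic first-order logic with equality\<close>

text \<open>De Bruijn indices. The only terms are variables, so substitution is renaming.\<close>

datatype fm =
    Mem nat nat
  | Eq nat nat
  | Bot
  | Conj fm fm
  | Disj fm fm
  | Imp fm fm
  | Forall fm
  | Exists fm

definition up :: "(nat \<Rightarrow> nat) \<Rightarrow> nat \<Rightarrow> nat" where
  "up r = case_nat 0 (\<lambda>i. Suc (r i))"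

primrec ren :: "fm \<Rightarrow> (nat \<Rightarrow> nat) \<Rightarrow> fm" where
  "ren (Mem i j) r = Mem (r i) (r j)"
| "ren (Eq i j) r = Eq (r i) (r j)"
| "ren Bot r = Bot"
| "ren (Conj A B) r = Conj (ren A r) (ren B r)"
| "ren (Disj A B) r = Disj (ren A r) (ren B r)"
| "ren (Imp A B) r = Imp (ren A r) (ren B r)"
| "ren (Forall A) r = Forall (ren A (up r))"
| "ren (Exists A) r = Exists (ren A (up r))"

definition lift :: "fm \<Rightarrow> fm" where
  "lift A = ren A Suc"

definition inst :: "fm \<Rightarrow> nat \<Rightarrow> fm" where
  "inst A t = ren A (case_nat t (\<lambda>i. i))"

text \<open>
  \<open>T\<close> is a set of non-logical axioms, whose free variables are implicitly universally quantified:
  rule \<open>ax\<close> is available in every context, and \<open>allI\<close> and \<open>exE\<close> lift only the hypotheses \<open>\<Gamma>\<close>.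
\<close>

inductive ded :: "fm set \<Rightarrow> fm set \<Rightarrow> fm \<Rightarrow> bool" for T :: "fm set" where
  ax: "A \<in> T \<Longrightarrow> ded T \<Gamma> A"
| hyp: "A \<in> \<Gamma> \<Longrightarrow> ded T \<Gamma> A"
| botE: "ded T \<Gamma> Bot \<Longrightarrow> ded T \<Gamma> A"
| conjI: "ded T \<Gamma> A \<Longrightarrow> ded T \<Gamma> B \<Longrightarrow> ded T \<Gamma> (Conj A B)"
| conjE1: "ded T \<Gamma> (Conj A B) \<Longrightarrow> ded T \<Gamma> A"
| conjE2: "ded T \<Gamma> (Conj A B) \<Longrightarrow> ded T \<Gamma> B"
| disjI1: "ded T \<Gamma> A \<Longrightarrow> ded T \<Gamma> (Disj A B)"
| disjI2: "ded T \<Gamma> B \<Longrightarrow> ded T \<Gamma> (Disj A B)"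
| disjE: "ded T \<Gamma> (Disj A B) \<Longrightarrow> ded T (insert A \<Gamma>) C \<Longrightarrow> ded T (insert B \<Gamma>) C \<Longrightarrow> ded T \<Gamma> C"
| impI: "ded T (insert A \<Gamma>) B \<Longrightarrow> ded T \<Gamma> (Imp A B)"
| impE: "ded T \<Gamma> (Imp A B) \<Longrightarrow> ded T \<Gamma> A \<Longrightarrow> ded T \<Gamma> B"
| allI: "ded T (lift ` \<Gamma>) A \<Longrightarrow> ded T \<Gamma> (Forall A)"
| allE: "ded T \<Gamma> (Forall A) \<Longrightarrow> ded T \<Gamma> (inst A t)"
| exI: "ded T \<Gamma> (inst A t) \<Longrightarrow> ded T \<Gamma> (Exists A)"
| exE: "ded T \<Gamma> (Exists A) \<Longrightarrow> ded T (insert A (lift ` \<Gamma>)) (lift B) \<Longrightarrow> ded T \<Gamma> B"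
| eq_refl: "ded T \<Gamma> (Eq t t)"
| eq_subst: "ded T \<Gamma> (Eq s t) \<Longrightarrow> ded T \<Gamma> (inst A s) \<Longrightarrow> ded T \<Gamma> (inst A t)"


section \<open>Notation for formulas with named binders\<close>

text \<open>
  A \<open>form\<close> is a formula that still awaits the number \<open>n\<close> of quantifiers in whose scope it will stand.
  Inside definitions a variable is named by its level, i.e. the number of quantifiers enclosing
  the one that binds it; at depth \<open>n\<close> the variable of level \<open>x < n\<close> has de Bruijn index
  \<open>n - Suc x\<close>. Levels are stable under further quantification, so that a predicate on sets is
  simply a function \<open>nat \<Rightarrow> form\<close>. Evaluating at \<open>0\<close> gives the intended formula.
\<close>

type_synonym form = "nat \<Rightarrow> fm"

definition mem :: "nat \<Rightarrow> nat \<Rightarrow> form" (infix \<open>\<^bold>\<in>\<close> 50) where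
  "(x \<^bold>\<in> y) = (\<lambda>n. Mem (n - Suc x) (n - Suc y))"

definition eql :: "nat \<Rightarrow> nat \<Rightarrow> form" (infix \<open>\<^bold>=\<close> 50) where
  "(x \<^bold>= y) = (\<lambda>n. Eq (n - Suc x) (n - Suc y))"

definition bot :: form (\<open>\<^bold>\<bottom>\<close>) where
  "\<^bold>\<bottom> = (\<lambda>n. Bot)"

definition conj :: "form \<Rightarrow> form \<Rightarrow> form" (infixr \<open>\<^bold>\<and>\<close> 35) where
  "(A \<^bold>\<and> B) = (\<lambda>n. Conj (A n) (B n))"

definition disj :: "form \<Rightarrow> form \<Rightarrow> form" (infixr \<open>\<^bold>\<or>\<close> 30) where
  "(A \<^bold>\<or> B) = (\<lambda>n. Disj (A n) (B n))"

definition imp :: "form \<Rightarrow> form \<Rightarrow> form" (infixr \<open>\<^bold>\<longrightarrow>\<close> 25) where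
  "(A \<^bold>\<longrightarrow> B) = (\<lambda>n. Imp (A n) (B n))"

definition iff :: "form \<Rightarrow> form \<Rightarrow> form" (infixr \<open>\<^bold>\<longleftrightarrow>\<close> 25) where
  "(A \<^bold>\<longleftrightarrow> B) = ((A \<^bold>\<longrightarrow> B) \<^bold>\<and> (B \<^bold>\<longrightarrow> A))"

definition all :: "(nat \<Rightarrow> form) \<Rightarrow> form" (binder \<open>\<^bold>\<forall>\<close> 10) where
  "all A = (\<lambda>n. Forall (A n (Suc n)))"

definition ex :: "(nat \<Rightarrow> form) \<Rightarrow> form" (binder \<open>\<^bold>\<exists>\<close> 10) where
  "ex A = (\<lambda>n. Exists (A n (Suc n)))"

text \<open>
  For the axiom schemes: in \<open>\<Phi>[x\<^sub>0, \<dots>, x\<^sub>k]\<close> the variables \<open>0, \<dots>, k\<close> of \<open>\<Phi>\<close> are replaced by the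
  variables of level \<open>x\<^sub>0, \<dots>, x\<^sub>k\<close>, and the remaining ones are parameters, free in the whole axiom.
\<close>

definition papp :: "fm \<Rightarrow> nat list \<Rightarrow> form" where
  "papp \<Phi> xs = (\<lambda>n. ren \<Phi> (\<lambda>i. if i < length xs then n - Suc (xs ! i) else n + (i - length xs)))"


section \<open>The axioms of CZF\<close>

definition subset :: "nat \<Rightarrow> nat \<Rightarrow> form" (infix \<open>\<^bold>\<subseteq>\<close> 50) where
  "(x \<^bold>\<subseteq> y) = (\<^bold>\<forall>z. z \<^bold>\<in> x \<^bold>\<longrightarrow> z \<^bold>\<in> y)"

definition is_empty :: "nat \<Rightarrow> form" where
  "is_empty x = (\<^bold>\<forall>z. z \<^bold>\<in> x \<^bold>\<longrightarrow> \<^bold>\<bottom>)"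

definition is_succ :: "nat \<Rightarrow> nat \<Rightarrow> form" where
  "is_succ y x = (\<^bold>\<forall>z. z \<^bold>\<in> y \<^bold>\<longleftrightarrow> z \<^bold>\<in> x \<^bold>\<or> z \<^bold>= x)"

definition is_omega :: "nat \<Rightarrow> form" where
  "is_omega w = (\<^bold>\<forall>x. x \<^bold>\<in> w \<^bold>\<longleftrightarrow> is_empty x \<^bold>\<or> (\<^bold>\<exists>y. y \<^bold>\<in> w \<^bold>\<and> is_succ x y))"

inductive bounded :: "fm \<Rightarrow> bool" where
  "bounded (Mem i j)"
| "bounded (Eq i j)"
| "bounded Bot"
| "bounded A \<Longrightarrow> bounded B \<Longrightarrow> bounded (Conj A B)"
| "bounded A \<Longrightarrow> bounded B \<Longrightarrow> bounded (Disj A B)"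
| "bounded A \<Longrightarrow> bounded B \<Longrightarrow> bounded (Imp A B)"
| "bounded A \<Longrightarrow> bounded (Forall (Imp (Mem 0 (Suc i)) A))"
| "bounded A \<Longrightarrow> bounded (Exists (Conj (Mem 0 (Suc i)) A))"

definition extensionality :: form where
  "extensionality = (\<^bold>\<forall>a b. (\<^bold>\<forall>x. x \<^bold>\<in> a \<^bold>\<longleftrightarrow> x \<^bold>\<in> b) \<^bold>\<longrightarrow> a \<^bold>= b)"

definition pairing :: form where
  "pairing = (\<^bold>\<forall>a b. \<^bold>\<exists>c. \<^bold>\<forall>x. x \<^bold>\<in> c \<^bold>\<longleftrightarrow> x \<^bold>= a \<^bold>\<or> x \<^bold>= b)"

definition union :: form where
  "union = (\<^bold>\<forall>a. \<^bold>\<exists>c. \<^bold>\<forall>x. x \<^bold>\<in> c \<^bold>\<longleftrightarrow> (\<^bold>\<exists>y. y \<^bold>\<in> a \<^bold>\<and> x \<^bold>\<in> y))"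

definition infinity :: form where
  "infinity = (\<^bold>\<exists>w. is_omega w)"

definition set_induction :: "fm \<Rightarrow> form" where
  "set_induction \<Phi> =
    ((\<^bold>\<forall>a. (\<^bold>\<forall>x. x \<^bold>\<in> a \<^bold>\<longrightarrow> papp \<Phi> [x]) \<^bold>\<longrightarrow> papp \<Phi> [a]) \<^bold>\<longrightarrow> (\<^bold>\<forall>a. papp \<Phi> [a]))"

definition separation :: "fm \<Rightarrow> form" where
  "separation \<Phi> = (\<^bold>\<forall>a. \<^bold>\<exists>b. \<^bold>\<forall>x. x \<^bold>\<in> b \<^bold>\<longleftrightarrow> x \<^bold>\<in> a \<^bold>\<and> papp \<Phi> [x])"

definition strong_collection :: "fm \<Rightarrow> form" where
  "strong_collection \<Phi> =
    (\<^bold>\<forall>a. (\<^bold>\<forall>x. x \<^bold>\<in> a \<^bold>\<longrightarrow> (\<^bold>\<exists>y. papp \<Phi> [x, y])) \<^bold>\<longrightarrow>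
      (\<^bold>\<exists>b. (\<^bold>\<forall>x. x \<^bold>\<in> a \<^bold>\<longrightarrow> (\<^bold>\<exists>y. y \<^bold>\<in> b \<^bold>\<and> papp \<Phi> [x, y])) \<^bold>\<and>
           (\<^bold>\<forall>y. y \<^bold>\<in> b \<^bold>\<longrightarrow> (\<^bold>\<exists>x. x \<^bold>\<in> a \<^bold>\<and> papp \<Phi> [x, y]))))"

definition subset_collection :: "fm \<Rightarrow> form" where
  "subset_collection \<Phi> =
    (\<^bold>\<forall>a b. \<^bold>\<exists>c. \<^bold>\<forall>u. (\<^bold>\<forall>x. x \<^bold>\<in> a \<^bold>\<longrightarrow> (\<^bold>\<exists>y. y \<^bold>\<in> b \<^bold>\<and> papp \<Phi> [x, y, u])) \<^bold>\<longrightarrow>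
      (\<^bold>\<exists>d. d \<^bold>\<in> c \<^bold>\<and>
        (\<^bold>\<forall>x. x \<^bold>\<in> a \<^bold>\<longrightarrow> (\<^bold>\<exists>y. y \<^bold>\<in> d \<^bold>\<and> papp \<Phi> [x, y, u])) \<^bold>\<and>
        (\<^bold>\<forall>y. y \<^bold>\<in> d \<^bold>\<longrightarrow> (\<^bold>\<exists>x. x \<^bold>\<in> a \<^bold>\<and> papp \<Phi> [x, y, u]))))"

definition CZF :: "fm set" where
  "CZF = {extensionality 0, pairing 0, union 0, infinity 0}
    \<union> {set_induction \<Phi> 0 | \<Phi>. True}
    \<union> {separation \<Phi> 0 | \<Phi>. bounded \<Phi>}
    \<union> {strong_collection \<Phi> 0 | \<Phi>. True}
    \<union> {subset_collection \<Phi> 0 | \<Phi>. True}"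

definition proves :: "fm set \<Rightarrow> form \<Rightarrow> bool" (infix \<open>\<turnstile>\<close> 5) where
  "(T \<turnstile> A) = ded T {} (A 0)"


section \<open>Pairs, functions, finite sets\<close>

definition is_upair :: "nat \<Rightarrow> nat \<Rightarrow> nat \<Rightarrow> form" where
  "is_upair z x y = (\<^bold>\<forall>w. w \<^bold>\<in> z \<^bold>\<longleftrightarrow> w \<^bold>= x \<^bold>\<or> w \<^bold>= y)"

definition is_pair :: "nat \<Rightarrow> nat \<Rightarrow> nat \<Rightarrow> form" where
  "is_pair z x y = (\<^bold>\<forall>w. w \<^bold>\<in> z \<^bold>\<longleftrightarrow> is_upair w x x \<^bold>\<or> is_upair w x y)"

definition maps_to :: "nat \<Rightarrow> nat \<Rightarrow> nat \<Rightarrow> form" where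
  "maps_to f x y = (\<^bold>\<exists>p. p \<^bold>\<in> f \<^bold>\<and> is_pair p x y)"

definition function_on :: "nat \<Rightarrow> nat \<Rightarrow> form" where
  "function_on f a =
    ((\<^bold>\<forall>p. p \<^bold>\<in> f \<^bold>\<longrightarrow> (\<^bold>\<exists>x y. x \<^bold>\<in> a \<^bold>\<and> is_pair p x y)) \<^bold>\<and>
     (\<^bold>\<forall>x. x \<^bold>\<in> a \<^bold>\<longrightarrow> (\<^bold>\<exists>y. maps_to f x y \<^bold>\<and> (\<^bold>\<forall>z. maps_to f x z \<^bold>\<longrightarrow> z \<^bold>= y))))"

text \<open>
  The von Neumann number \<open>n\<close> has the \<open>n\<close> elements \<open>0, \<dots>, n - 1\<close>, so its images are those
  of \<open>{1, \<dots>, n}\<close>.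
\<close>

definition is_finite :: "nat \<Rightarrow> form" where
  "is_finite a = (\<^bold>\<exists>w n f. is_omega w \<^bold>\<and> n \<^bold>\<in> w \<^bold>\<and> function_on f n \<^bold>\<and>
    (\<^bold>\<forall>y. y \<^bold>\<in> a \<^bold>\<longleftrightarrow> (\<^bold>\<exists>x. x \<^bold>\<in> n \<^bold>\<and> maps_to f x y)))"

definition is_singleton :: "nat \<Rightarrow> form" where
  "is_singleton a = (\<^bold>\<exists>x. is_upair a x x)"

definition any_set :: "nat \<Rightarrow> form" where
  "any_set a = (\<^bold>\<bottom> \<^bold>\<longrightarrow> \<^bold>\<bottom>)"

definition no_set :: "nat \<Rightarrow> form" where
  "no_set a = \<^bold>\<bottom>"


section \<open>Set-generated classes and NID\<close>

text \<open>A class of subsets of a given set is a predicate \<open>\<M> :: nat \<Rightarrow> form\<close>.\<close>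

definition set_generated :: "(nat \<Rightarrow> form) \<Rightarrow> form" where
  "set_generated \<M> = (\<^bold>\<exists>G. (\<^bold>\<forall>\<beta>. \<beta> \<^bold>\<in> G \<^bold>\<longrightarrow> \<M> \<beta>) \<^bold>\<and>
    (\<^bold>\<forall>\<alpha>. \<M> \<alpha> \<^bold>\<longrightarrow> (\<^bold>\<forall>x. x \<^bold>\<in> \<alpha> \<^bold>\<longrightarrow> (\<^bold>\<exists>\<beta>. \<beta> \<^bold>\<in> G \<^bold>\<and> x \<^bold>\<in> \<beta> \<^bold>\<and> \<beta> \<^bold>\<subseteq> \<alpha>))))"

text \<open>\<open>\<C>\<close> is the condition imposed on the first component of every rule.\<close>

definition rules_on :: "(nat \<Rightarrow> form) \<Rightarrow> nat \<Rightarrow> nat \<Rightarrow> form" where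
  "rules_on \<C> X R = (\<^bold>\<forall>r. r \<^bold>\<in> R \<^bold>\<longrightarrow>
    (\<^bold>\<exists>a b. is_pair r a b \<^bold>\<and> a \<^bold>\<subseteq> X \<^bold>\<and> b \<^bold>\<subseteq> X \<^bold>\<and> \<C> a))"

definition closed_under :: "nat \<Rightarrow> nat \<Rightarrow> form" where
  "closed_under R Y = (\<^bold>\<forall>r a b. r \<^bold>\<in> R \<^bold>\<and> is_pair r a b \<^bold>\<longrightarrow>
    a \<^bold>\<subseteq> Y \<^bold>\<longrightarrow> (\<^bold>\<exists>x. x \<^bold>\<in> b \<^bold>\<and> x \<^bold>\<in> Y))"

definition NID :: "(nat \<Rightarrow> form) \<Rightarrow> form" where
  "NID \<C> = (\<^bold>\<forall>X R. rules_on \<C> X R \<^bold>\<longrightarrow> set_generated (\<lambda>Y. Y \<^bold>\<subseteq> X \<^bold>\<and> closed_under R Y))"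

definition full_NID :: form where
  "full_NID = NID any_set"

definition finitary_NID :: form where
  "finitary_NID = NID is_finite"

definition elementary_NID :: form where
  "elementary_NID = NID is_singleton"


section \<open>Game formulas and their models\<close>

text \<open>
  Game formulas are sets: a letter \<open>p\<close> is \<open>(0, p)\<close>, a disjunction \<open>(1, f)\<close> and a conjunction \<open>(2, f)\<close>,
  where the function \<open>f\<close>, whose domain is the index set, is the family of its immediate subformulas.
\<close>

definition is_letter :: "nat \<Rightarrow> nat \<Rightarrow> form" where
  "is_letter s p = (\<^bold>\<exists>t. is_empty t \<^bold>\<and> is_pair s t p)"

definition is_Or :: "nat \<Rightarrow> nat \<Rightarrow> form" where
  "is_Or s f = (\<^bold>\<exists>z t. is_empty z \<^bold>\<and> is_succ t z \<^bold>\<and> is_pair s t f)"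

definition is_And :: "nat \<Rightarrow> nat \<Rightarrow> form" where
  "is_And s f = (\<^bold>\<exists>z u t. is_empty z \<^bold>\<and> is_succ u z \<^bold>\<and> is_succ t u \<^bold>\<and> is_pair s t f)"

definition family_in :: "nat \<Rightarrow> nat \<Rightarrow> nat \<Rightarrow> form" where
  "family_in f I S = (function_on f I \<^bold>\<and> (\<^bold>\<forall>i x. maps_to f i x \<^bold>\<longrightarrow> x \<^bold>\<in> S))"

text \<open>
  \<open>\<phi>\<close> is a game formula over \<open>P\<close> all of whose conjunctions have an index set satisfying \<open>\<C>\<close>.
  The inductively defined class of game formulas is expressed by a set \<open>S\<close> that contains \<open>\<phi>\<close>
  along with all its subformulas, all of them of one of the three permitted shapes. Since the
  immediate subformulas of \<open>s\<close> lie in the transitive closure of \<open>s\<close>, set induction ensures that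
  \<open>\<phi>\<close> is well-founded.
\<close>

definition game_formula :: "(nat \<Rightarrow> form) \<Rightarrow> nat \<Rightarrow> nat \<Rightarrow> form" where
  "game_formula \<C> P \<phi> = (\<^bold>\<exists>S. \<phi> \<^bold>\<in> S \<^bold>\<and> (\<^bold>\<forall>s. s \<^bold>\<in> S \<^bold>\<longrightarrow>
      (\<^bold>\<exists>p. p \<^bold>\<in> P \<^bold>\<and> is_letter s p) \<^bold>\<or>
      (\<^bold>\<exists>f I. is_Or s f \<^bold>\<and> family_in f I S) \<^bold>\<or>
      (\<^bold>\<exists>f I. is_And s f \<^bold>\<and> family_in f I S \<^bold>\<and> \<C> I)))"

text \<open>
  The recursion clauses of satisfaction by \<open>M\<close>, for a set \<open>S\<close> of formulas that is closed under
  immediate subformulas; \<open>V\<close> is the set of those members of \<open>S\<close> that \<open>M\<close> satisfies.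
\<close>

definition truth_set :: "nat \<Rightarrow> nat \<Rightarrow> nat \<Rightarrow> form" where
  "truth_set M S V = (V \<^bold>\<subseteq> S \<^bold>\<and> (\<^bold>\<forall>s. s \<^bold>\<in> S \<^bold>\<longrightarrow>
      (\<^bold>\<forall>p. is_letter s p \<^bold>\<longrightarrow> (s \<^bold>\<in> V \<^bold>\<longleftrightarrow> p \<^bold>\<in> M)) \<^bold>\<and>
      (\<^bold>\<forall>f. is_Or s f \<^bold>\<longrightarrow> (\<^bold>\<forall>i x. maps_to f i x \<^bold>\<longrightarrow> x \<^bold>\<in> S) \<^bold>\<and>
        (s \<^bold>\<in> V \<^bold>\<longleftrightarrow> (\<^bold>\<exists>i x. maps_to f i x \<^bold>\<and> x \<^bold>\<in> V))) \<^bold>\<and>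
      (\<^bold>\<forall>f. is_And s f \<^bold>\<longrightarrow> (\<^bold>\<forall>i x. maps_to f i x \<^bold>\<longrightarrow> x \<^bold>\<in> S) \<^bold>\<and>
        (s \<^bold>\<in> V \<^bold>\<longleftrightarrow> (\<^bold>\<forall>i x. maps_to f i x \<^bold>\<longrightarrow> x \<^bold>\<in> V)))))"

definition satisfies :: "nat \<Rightarrow> nat \<Rightarrow> form" where
  "satisfies M \<phi> = (\<^bold>\<exists>S V. truth_set M S V \<^bold>\<and> \<phi> \<^bold>\<in> V)"

text \<open>A sequent \<open>\<phi> \<rightarrow> \<psi>\<close> is the pair \<open>(\<phi>, \<psi>)\<close>; \<open>\<C>\<close> restricts the hypothesis \<open>\<phi>\<close> only.\<close>

definition game_theory :: "(nat \<Rightarrow> form) \<Rightarrow> nat \<Rightarrow> nat \<Rightarrow> form" where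
  "game_theory \<C> P T = (\<^bold>\<forall>t. t \<^bold>\<in> T \<^bold>\<longrightarrow>
    (\<^bold>\<exists>\<phi> \<psi>. is_pair t \<phi> \<psi> \<^bold>\<and> game_formula \<C> P \<phi> \<^bold>\<and> game_formula any_set P \<psi>))"

definition is_model :: "nat \<Rightarrow> nat \<Rightarrow> nat \<Rightarrow> form" where
  "is_model P T M = (M \<^bold>\<subseteq> P \<^bold>\<and> (\<^bold>\<forall>t \<phi> \<psi>. t \<^bold>\<in> T \<^bold>\<and> is_pair t \<phi> \<psi> \<^bold>\<longrightarrow>
    satisfies M \<phi> \<^bold>\<longrightarrow> satisfies M \<psi>))"

definition any_game_theory :: "nat \<Rightarrow> nat \<Rightarrow> form" where
  "any_game_theory = game_theory any_set"

definition finitary_game_theory :: "nat \<Rightarrow> nat \<Rightarrow> form" where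
  "finitary_game_theory = game_theory is_finite"

definition elementary_game_theory :: "nat \<Rightarrow> nat \<Rightarrow> form" where
  "elementary_game_theory = game_theory no_set"

end

theory Submission
  imports Defs "HOL-Library.Countable"
begin

text \<open>
  Derivability in CZF is reduced to truth in Kripke models by a Henkin-style completeness theorem,
  after which the set-theoretic argument is carried out, with classical reasoning about worlds,
  in an arbitrary Kripke model of CZF.

  There, let \<open>X\<close> be a set of formulas closed under subformulas that contains those of \<open>T\<close> and the
  letters of \<open>P\<close>. The rules say of a subset \<open>Y\<close> of \<open>X\<close> that it respects disjunctions in both
  directions and conjunctions downwards, that it contains \<open>\<psi>\<close> whenever it contains \<open>\<phi>\<close>, for
  \<open>\<phi> \<rightarrow> \<psi>\<close> in \<open>T\<close>, and that it contains those conjunctions inside hypotheses all of whose conjuncts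
  it contains; only the last kind of rule has a premise that is not a singleton. If \<open>Y\<close> is closed then true
  hypotheses lie in \<open>Y\<close>, and members of \<open>Y\<close> are true, in the model given by the letters in \<open>Y\<close>, which is
  therefore a model of \<open>T\<close>. Conversely the formulas true in a model of \<open>T\<close> form a closed set. So
  the sets of letters of a generating set of closed sets generate the class of models.
\<close>

section \<open>Renaming and derivability\<close>

text \<open>Writing derivations in \<open>ded\<close> by hand is hopeless, whereas in a Kripke model
  every connective becomes a HOL statement about worlds. The price: axiom schemes apply to formulas
  with parameters only, so definability (\<open>dfn\<close>) must accompany every predicate handed
  to collection or induction. The obstacle behind most detours is the weakness of separation. As
  formalised, being a pair, and hence being a letter or a disjunction, involves unbounded
  quantifiers, so neither truth sets nor the letters of \<open>Y\<close> can be separated out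
  directly. Separation is applied to four tiny formulas only (falsity, one membership, a bounded
  existential and a bounded universal membership); all else is glued by strong collection and union
  from small pieces. Collection returns adequate witnesses without choosing one, so the pieces must
  agree where they overlap or, like rule sets, be harmless to unite. The hypotheses keep their own
  set of formulas \<open>H\<close> inside \<open>X\<close>: only there are index sets of
  conjunctions restricted, so only there may a rule have a whole set of conjuncts as its
  premise.\<close>

primrec fv :: "fm \<Rightarrow> nat set" where
  "fv (Mem i j) = {i, j}"
| "fv (Eq i j) = {i, j}"
| "fv Bot = {}"
| "fv (Conj A B) = fv A \<union> fv B"
| "fv (Disj A B) = fv A \<union> fv B"
| "fv (Imp A B) = fv A \<union> fv B"
| "fv (Forall A) = {i. Suc i \<in> fv A}"
| "fv (Exists A) = {i. Suc i \<in> fv A}"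

lemma finite_fv: "finite (fv A)"
proof (induction A)
  case (Forall A)
  then show ?case using finite_vimageI[of "fv A" Suc] by (simp add: vimage_def)
next
  case (Exists A)
  then show ?case using finite_vimageI[of "fv A" Suc] by (simp add: vimage_def)
qed auto

lemma up_simps [simp]: "up r 0 = 0" "up r (Suc i) = Suc (r i)"
  by (simp_all add: up_def)

lemma ren_cong: "(\<And>i. i \<in> fv A \<Longrightarrow> r i = s i) \<Longrightarrow> ren A r = ren A s"
proof (induction A arbitrary: r s)
  case (Forall A)
  have "up r i = up s i" if "i \<in> fv A" for i
    using that Forall.prems by (cases i) auto
  then show ?case using Forall.IH[of "up r" "up s"] by (simp only: ren.simps)
next
  case (Exists A)
  have "up r i = up s i" if "i \<in> fv A" for i
    using that Exists.prems by (cases i) auto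
  then show ?case using Exists.IH[of "up r" "up s"] by (simp only: ren.simps)
next
  case (Conj A B)
  show ?case using Conj.IH[of r s] Conj.prems by simp
next
  case (Disj A B)
  show ?case using Disj.IH[of r s] Disj.prems by simp
next
  case (Imp A B)
  show ?case using Imp.IH[of r s] Imp.prems by simp
qed simp_all

lemma up_comp: "(\<lambda>i. up s (up r i)) = up (\<lambda>i. s (r i))"
  by (auto simp: up_def split: nat.split)

lemma ren_ren: "ren (ren A r) s = ren A (\<lambda>i. s (r i))"
  by (induction A arbitrary: r s) (simp_all add: up_comp)

lemma ren_id: "(\<And>i. i \<in> fv A \<Longrightarrow> r i = i) \<Longrightarrow> ren A r = A"
proof (induction A arbitrary: r)
  case (Forall A)
  have "up r i = i" if "i \<in> fv A" for i
    using that Forall.prems by (cases i) auto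
  then show ?case using Forall.IH[of "up r"] by simp
next
  case (Exists A)
  have "up r i = i" if "i \<in> fv A" for i
    using that Exists.prems by (cases i) auto
  then show ?case using Exists.IH[of "up r"] by simp
qed auto

lemma fv_ren: "fv (ren A r) = r ` fv A"
proof (induction A arbitrary: r)
  case (Forall A)
  show ?case
  proof (intro equalityI subsetI)
    fix i assume "i \<in> fv (ren (Forall A) r)"
    then obtain j where j: "j \<in> fv A" "Suc i = up r j" using Forall by auto
    then show "i \<in> r ` fv (Forall A)" by (cases j) auto
  next
    fix i assume "i \<in> r ` fv (Forall A)"
    then show "i \<in> fv (ren (Forall A) r)" using Forall by (auto intro!: image_eqI)
  qed
next
  case (Exists A)
  show ?case
  proof (intro equalityI subsetI)
    fix i assume "i \<in> fv (ren (Exists A) r)"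
    then obtain j where j: "j \<in> fv A" "Suc i = up r j" using Exists by auto
    then show "i \<in> r ` fv (Exists A)" by (cases j) auto
  next
    fix i assume "i \<in> r ` fv (Exists A)"
    then show "i \<in> fv (ren (Exists A) r)" using Exists by (auto intro!: image_eqI)
  qed
qed auto

lemma fv_inst: "fv (inst A t) \<subseteq> insert t (fv (Forall A))"
  by (auto simp: inst_def fv_ren split: nat.split_asm)

lemma ren_inst: "ren (inst A t) r = inst (ren A (up r)) (r t)"
  unfolding inst_def ren_ren by (rule ren_cong) (simp split: nat.split)

lemma ren_lift: "ren (lift A) (up r) = lift (ren A r)"
  by (simp add: lift_def ren_ren)

section \<open>Structural properties of derivability: weakening, renaming, compactness\<close>

lemma ded_weaken: "ded T \<Gamma> A \<Longrightarrow> \<Gamma> \<subseteq> \<Delta> \<Longrightarrow> ded T \<Delta> A"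
proof (induction arbitrary: \<Delta> rule: ded.induct)
  case (disjE \<Gamma> A B C)
  then show ?case by (meson ded.disjE insert_mono)
next
  case (impI A \<Gamma> B)
  then show ?case by (meson ded.impI insert_mono)
next
  case (allI \<Gamma> A)
  then show ?case by (meson ded.allI image_mono)
next
  case (exE \<Gamma> A B)
  then show ?case by (meson ded.exE image_mono insert_mono)
next
  case (exI \<Gamma> A t)
  then show ?case by (meson ded.exI)
next
  case (eq_subst \<Gamma> s t A)
  then show ?case by (meson ded.eq_subst)
next
  case (allE \<Gamma> A t)
  then show ?case by (meson ded.allE)
qed (meson ded.ax ded.hyp ded.botE ded.conjI ded.conjE1 ded.conjE2 ded.disjI1 ded.disjI2 ded.impE ded.eq_refl subsetD)+

lemma ded_cut: "ded T (insert A \<Gamma>) B \<Longrightarrow> ded T \<Gamma> A \<Longrightarrow> ded T \<Gamma> B"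
  by (blast intro: ded.impI ded.impE)

text \<open>The free variables of axioms count as universally quantified, so axioms are not renamed
  along with the hypotheses but must be mapped to axioms again. Hence the closure assumption on
  \<open>T\<close>, which later has to be checked for CZF.\<close>

lemma ded_ren:
  assumes T: "\<And>A r. A \<in> T \<Longrightarrow> ren A r \<in> T"
  shows "ded T \<Gamma> A \<Longrightarrow> ded T ((\<lambda>B. ren B r) ` \<Gamma>) (ren A r)"
proof (induction arbitrary: r rule: ded.induct)
  case (ax A \<Gamma>)
  then show ?case using T ded.ax by blast
next
  case (disjE \<Gamma> A B C)
  then show ?case using ded.disjE[of T "(\<lambda>B. ren B r) ` \<Gamma>" "ren A r" "ren B r" "ren C r"] by simp
next
  case (impI A \<Gamma> B)
  then show ?case by (simp add: ded.impI)
next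
  case (impE \<Gamma> A B)
  then show ?case using ded.impE by fastforce
next
  case (allI \<Gamma> A)
  have "(\<lambda>B. ren B (up r)) ` lift ` \<Gamma> = lift ` (\<lambda>B. ren B r) ` \<Gamma>"
    by (simp add: image_image ren_lift)
  then show ?case using allI.IH[of "up r"] by (simp add: ded.allI)
next
  case (allE \<Gamma> A t)
  then show ?case by (simp add: ren_inst ded.allE)
next
  case (exI \<Gamma> A t)
  then show ?case using ded.exI[of T _ "ren A (up r)" "r t"] by (simp add: ren_inst)
next
  case (exE \<Gamma> A B)
  have "(\<lambda>B. ren B (up r)) ` insert A (lift ` \<Gamma>) = insert (ren A (up r)) (lift ` (\<lambda>B. ren B r) ` \<Gamma>)"
    by (simp add: image_image ren_lift)
  then have "ded T (insert (ren A (up r)) (lift ` (\<lambda>B. ren B r) ` \<Gamma>)) (lift (ren B r))"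
    using exE.IH(2)[of "up r"] by (simp add: ren_lift)
  then show ?case using exE.IH(1)[of r] by (auto intro: ded.exE)
next
  case (eq_subst \<Gamma> s t A)
  then show ?case using ded.eq_subst[of T _ "r s" "r t" "ren A (up r)"] by (simp add: ren_inst)
qed (auto intro: ded.hyp ded.botE ded.conjI ded.conjE1 ded.conjE2 ded.disjI1 ded.disjI2 ded.eq_refl)

text \<open>Derivations are finite trees. For the rules with a binder, a finite set of lifted
  hypotheses has to be pulled back to a finite set of unlifted ones.\<close>

lemma ded_finite: "ded T \<Gamma> A \<Longrightarrow> \<exists>\<Delta>. finite \<Delta> \<and> \<Delta> \<subseteq> \<Gamma> \<and> ded T \<Delta> A"
proof (induction rule: ded.induct)
  case (ax A \<Gamma>)
  then show ?case by (meson ded.ax empty_subsetI finite.emptyI)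
next
  case (hyp A \<Gamma>)
  then show ?case by (intro HOL.exI[of _ "{A}"]) (auto intro: ded.hyp)
next
  case (conjI \<Gamma> A B)
  then obtain \<Delta>1 \<Delta>2 where "finite \<Delta>1" "\<Delta>1 \<subseteq> \<Gamma>" "ded T \<Delta>1 A" "finite \<Delta>2" "\<Delta>2 \<subseteq> \<Gamma>" "ded T \<Delta>2 B" by blast
  then show ?case
    by (intro HOL.exI[of _ "\<Delta>1 \<union> \<Delta>2"]) (auto intro!: ded.conjI intro: ded_weaken)
next
  case (disjE \<Gamma> A B C)
  then obtain \<Delta>1 \<Delta>2 \<Delta>3 where *: "finite \<Delta>1" "\<Delta>1 \<subseteq> \<Gamma>" "ded T \<Delta>1 (Disj A B)"
    "finite \<Delta>2" "\<Delta>2 \<subseteq> insert A \<Gamma>" "ded T \<Delta>2 C" "finite \<Delta>3" "\<Delta>3 \<subseteq> insert B \<Gamma>" "ded T \<Delta>3 C" by blast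
  let ?\<Delta> = "\<Delta>1 \<union> (\<Delta>2 - {A}) \<union> (\<Delta>3 - {B})"
  have "ded T ?\<Delta> (Disj A B)" "ded T (insert A ?\<Delta>) C" "ded T (insert B ?\<Delta>) C"
    using * by (auto intro: ded_weaken)
  then show ?case using * by (intro HOL.exI[of _ ?\<Delta>]) (auto intro: ded.disjE)
next
  case (impI A \<Gamma> B)
  then obtain \<Delta> where *: "finite \<Delta>" "\<Delta> \<subseteq> insert A \<Gamma>" "ded T \<Delta> B" by blast
  have "ded T (insert A (\<Delta> - {A})) B" using * by (auto intro: ded_weaken)
  then show ?case using * by (intro HOL.exI[of _ "\<Delta> - {A}"]) (auto intro: ded.impI)
next
  case (impE \<Gamma> A B)
  then obtain \<Delta>1 \<Delta>2 where *: "finite \<Delta>1" "\<Delta>1 \<subseteq> \<Gamma>" "ded T \<Delta>1 (Imp A B)" "finite \<Delta>2" "\<Delta>2 \<subseteq> \<Gamma>" "ded T \<Delta>2 A"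
    by blast
  have "ded T (\<Delta>1 \<union> \<Delta>2) (Imp A B)" "ded T (\<Delta>1 \<union> \<Delta>2) A" using * by (auto intro: ded_weaken)
  then show ?case using * by (intro HOL.exI[of _ "\<Delta>1 \<union> \<Delta>2"]) (auto intro: ded.impE)
next
  case (allI \<Gamma> A)
  then obtain \<Delta> where *: "finite \<Delta>" "\<Delta> \<subseteq> lift ` \<Gamma>" "ded T \<Delta> A" by blast
  then obtain \<Delta>' where "finite \<Delta>'" "\<Delta>' \<subseteq> \<Gamma>" "\<Delta> = lift ` \<Delta>'" by (meson finite_subset_image)
  then show ?case using * by (intro HOL.exI[of _ \<Delta>']) (auto intro: ded.allI)
next
  case (exE \<Gamma> A B)
  then obtain \<Delta>1 \<Delta>2 where *: "finite \<Delta>1" "\<Delta>1 \<subseteq> \<Gamma>" "ded T \<Delta>1 (Exists A)"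
    "finite \<Delta>2" "\<Delta>2 \<subseteq> insert A (lift ` \<Gamma>)" "ded T \<Delta>2 (lift B)" by blast
  then have "finite (\<Delta>2 - {A})" "\<Delta>2 - {A} \<subseteq> lift ` \<Gamma>" by auto
  then obtain \<Delta>' where \<Delta>': "finite \<Delta>'" "\<Delta>' \<subseteq> \<Gamma>" "\<Delta>2 - {A} = lift ` \<Delta>'" by (meson finite_subset_image)
  have "ded T (\<Delta>1 \<union> \<Delta>') (Exists A)" using * by (auto intro: ded_weaken)
  moreover have "ded T (insert A (lift ` (\<Delta>1 \<union> \<Delta>'))) (lift B)"
    using *(6) by (rule ded_weaken) (use \<Delta>' in auto)
  ultimately show ?case using * \<Delta>' by (intro HOL.exI[of _ "\<Delta>1 \<union> \<Delta>'"]) (auto intro: ded.exE)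
next
  case (eq_refl \<Gamma> t)
  then show ?case by (meson ded.eq_refl empty_subsetI finite.emptyI)
next
  case (eq_subst \<Gamma> s t A)
  then obtain \<Delta>1 \<Delta>2 where *: "finite \<Delta>1" "\<Delta>1 \<subseteq> \<Gamma>" "ded T \<Delta>1 (Eq s t)"
    "finite \<Delta>2" "\<Delta>2 \<subseteq> \<Gamma>" "ded T \<Delta>2 (inst A s)"
    by blast
  have "ded T (\<Delta>1 \<union> \<Delta>2) (Eq s t)" "ded T (\<Delta>1 \<union> \<Delta>2) (inst A s)" using * by (auto intro: ded_weaken)
  then show ?case using * by (intro HOL.exI[of _ "\<Delta>1 \<union> \<Delta>2"]) (auto intro: ded.eq_subst)
next
  case (exI \<Gamma> A t)
  then show ?case by (meson ded.exI)
next
  case (allE \<Gamma> A t)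
  then show ?case by (meson ded.allE)
qed (meson ded.botE ded.conjE1 ded.conjE2 ded.disjI1 ded.disjI2)+

text \<open>Lets the union of an increasing sequence of theories inherit underivability from its
  stages.\<close>

lemma ded_chain:
  assumes "ded T (\<Union>n. G n) A" "\<And>n. G n \<subseteq> G (Suc n)"
  shows "\<exists>n::nat. ded T (G n) A"
proof -
  have mono: "G m \<subseteq> G n" if "m \<le> n" for m n
    using that assms(2) by (meson lift_Suc_mono_le)
  obtain \<Delta> where \<Delta>: "finite \<Delta>" "\<Delta> \<subseteq> (\<Union>n. G n)" "ded T \<Delta> A" using ded_finite[OF assms(1)] by blast
  have "\<exists>n. \<Delta>' \<subseteq> G n" if "finite \<Delta>'" "\<Delta>' \<subseteq> (\<Union>n. G n)" for \<Delta>'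
    using that
  proof (induction rule: finite_induct)
    case (insert x F)
    then obtain m n where "F \<subseteq> G m" "x \<in> G n" by auto
    then have "insert x F \<subseteq> G (max m n)" using mono[of m "max m n"] mono[of n "max m n"] by auto
    then show ?case by blast
  qed simp
  then show ?thesis using \<Delta> ded_weaken by meson
qed

section \<open>Free variables in the role of fresh constants\<close>

context
  fixes T :: "fm set"
  assumes T: "\<And>A r. A \<in> T \<Longrightarrow> ren A r \<in> T"
begin

text \<open>The language has no constants, so a free variable \<open>c\<close> takes their place.
  The renaming that sends \<open>c\<close> to 0 and shifts all others turns \<open>c\<close> into
  the variable that a quantifier is about to bind; on formulas without \<open>c\<close> it is plain
  lifting.\<close>

lemma fresh_ren:
  assumes "c \<notin> fv B" shows "ren B (\<lambda>i. if i = c then 0 else Suc i) = lift B"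
  unfolding lift_def by (rule ren_cong) (use assms in auto)

lemma fresh_ren_inst:
  assumes "Suc c \<notin> fv A" shows "ren (inst A c) (\<lambda>i. if i = c then 0 else Suc i) = A"
  unfolding inst_def ren_ren by (rule ren_id) (use assms in \<open>auto split: nat.split\<close>)

text \<open>The textbook rule with an eigenvariable, obtained by applying the renaming above to the
  whole derivation; likewise for the universal quantifier below.\<close>

lemma ded_fresh_exE:
  assumes "ded T (insert (inst A c) \<Gamma>) B" "ded T \<Gamma> (Exists A)"
    "\<And>C. C \<in> \<Gamma> \<Longrightarrow> c \<notin> fv C" "c \<notin> fv (Exists A)" "c \<notin> fv B"
  shows "ded T \<Gamma> B"
proof (rule ded.exE)
  let ?r = "\<lambda>i. if i = c then 0 else Suc i"
  have "(\<lambda>C. ren C ?r) ` \<Gamma> = lift ` \<Gamma>" using assms(3) fresh_ren by (meson image_cong)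
  then show "ded T (insert A (lift ` \<Gamma>)) (lift B)"
    using ded_ren[OF T assms(1), of ?r] assms(4,5) by (simp add: fresh_ren fresh_ren_inst)
qed (fact assms(2))

lemma ded_fresh_allI:
  assumes "ded T \<Gamma> (inst A c)" "\<And>C. C \<in> \<Gamma> \<Longrightarrow> c \<notin> fv C" "c \<notin> fv (Forall A)"
  shows "ded T \<Gamma> (Forall A)"
proof (rule ded.allI)
  let ?r = "\<lambda>i. if i = c then 0 else Suc i"
  have "(\<lambda>C. ren C ?r) ` \<Gamma> = lift ` \<Gamma>" using assms(2) fresh_ren by (meson image_cong)
  then show "ded T (lift ` \<Gamma>) A"
    using ded_ren[OF T assms(1), of ?r] assms(3) by (simp add: fresh_ren_inst)
qed

end

section \<open>Kripke models\<close>

text \<open>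
  The domain \<open>E w\<close> has to vary with \<open>w\<close>, since constant domains validate formulas that are not
  intuitionistically provable.
\<close>

locale kripke =
  fixes le :: "'w \<Rightarrow> 'w \<Rightarrow> bool" (infix \<open>\<sqsubseteq>\<close> 50)
    and E :: "'w \<Rightarrow> 'a \<Rightarrow> bool"
    and mm :: "'a \<Rightarrow> 'a \<Rightarrow> 'w \<Rightarrow> bool" (infix \<open>\<epsilon>\<close> 60)
    and qq :: "'a \<Rightarrow> 'a \<Rightarrow> 'w \<Rightarrow> bool" (infix \<open>\<approx>\<close> 60)
  assumes nonempty: "\<exists>x. E w x"
    and le_refl [simp, intro!]: "w \<sqsubseteq> w"
    and le_trans [trans]: "u \<sqsubseteq> v \<Longrightarrow> v \<sqsubseteq> w \<Longrightarrow> u \<sqsubseteq> w"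
    and E_up: "E w x \<Longrightarrow> w \<sqsubseteq> v \<Longrightarrow> E v x"
    and mm_up: "(x \<epsilon> y) w \<Longrightarrow> w \<sqsubseteq> v \<Longrightarrow> (x \<epsilon> y) v"
    and qq_up: "(x \<approx> y) w \<Longrightarrow> w \<sqsubseteq> v \<Longrightarrow> (x \<approx> y) v"
    and mm_E: "(x \<epsilon> y) w \<Longrightarrow> E w x \<and> E w y"
    and qq_E: "(x \<approx> y) w \<Longrightarrow> E w x \<and> E w y"
    and qq_refl: "E w x \<Longrightarrow> (x \<approx> x) w"
    and qq_sym: "(x \<approx> y) w \<Longrightarrow> (y \<approx> x) w"
    and qq_trans: "(x \<approx> y) w \<Longrightarrow> (y \<approx> z) w \<Longrightarrow> (x \<approx> z) w"
    and mm_cong: "(x \<epsilon> y) w \<Longrightarrow> (x \<approx> x') w \<Longrightarrow> (y \<approx> y') w \<Longrightarrow> (x' \<epsilon> y') w"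
begin

primrec sem :: "fm \<Rightarrow> (nat \<Rightarrow> 'a) \<Rightarrow> 'w \<Rightarrow> bool" where
  "sem (Mem i j) e w = (e i \<epsilon> e j) w"
| "sem (Eq i j) e w = (e i \<approx> e j) w"
| "sem Bot e w = False"
| "sem (Conj A B) e w = (sem A e w \<and> sem B e w)"
| "sem (Disj A B) e w = (sem A e w \<or> sem B e w)"
| "sem (Imp A B) e w = (\<forall>v. w \<sqsubseteq> v \<longrightarrow> sem A e v \<longrightarrow> sem B e v)"
| "sem (Forall A) e w = (\<forall>v. w \<sqsubseteq> v \<longrightarrow> (\<forall>x. E v x \<longrightarrow> sem A (case_nat x e) v))"
| "sem (Exists A) e w = (\<exists>x. E w x \<and> sem A (case_nat x e) w)"

end

section \<open>Completeness\<close>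

definition names :: "nat \<Rightarrow> nat set" where
  "names k = {n. fst (prod_decode n) \<le> k}"

definition sentences :: "nat \<Rightarrow> fm set" where
  "sentences k = {A. fv A \<subseteq> names k}"

text \<open>The conditions on \<open>Disj\<close> and \<open>Exists\<close> are exactly what forcing
  demands at the same world; implication and universal quantification refer to later worlds and are
  handled by extending the theory.\<close>

definition prime_theory :: "fm set \<Rightarrow> nat \<times> fm set \<Rightarrow> bool" where
  "prime_theory T w = (case w of (k, \<Theta>) \<Rightarrow> \<Theta> \<subseteq> sentences k \<and> Bot \<notin> \<Theta> \<and>
    (\<forall>A \<in> sentences k. ded T \<Theta> A \<longrightarrow> A \<in> \<Theta>) \<and>
    (\<forall>A B. Disj A B \<in> \<Theta> \<longrightarrow> A \<in> \<Theta> \<or> B \<in> \<Theta>) \<and>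
    (\<forall>A. Exists A \<in> \<Theta> \<longrightarrow> (\<exists>t \<in> names k. inst A t \<in> \<Theta>)))"

lemma names_mono: "k \<le> l \<Longrightarrow> names k \<subseteq> names l"
  by (auto simp: names_def)

lemma sentences_mono: "k \<le> l \<Longrightarrow> sentences k \<subseteq> sentences l"
  using names_mono by (force simp: sentences_def)

definition new_names :: "nat \<Rightarrow> nat set" where
  "new_names k = range (\<lambda>m. prod_encode (Suc k, m))"

lemma infinite_new_names: "infinite (new_names k)"
  proof
  assume "finite (new_names k)"
  then have "finite (UNIV :: nat set)"
    unfolding new_names_def by (rule finite_imageD) (simp add: inj_def prod_encode_eq)
  then show False by simp
qed

lemma new_names: "new_names k \<subseteq> names (Suc k)" "new_names k \<inter> names k = {}"
  by (auto simp: new_names_def names_def)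

instance fm :: countable
  by countable_datatype

section \<open>Saturation: extending a theory to a prime one that avoids a goal\<close>

context
  fixes T :: "fm set" and k :: nat and \<Gamma> :: "fm set" and C :: fm
  assumes T: "\<And>A r. A \<in> T \<Longrightarrow> ren A r \<in> T"
    and \<Gamma>: "\<Gamma> \<subseteq> sentences (Suc k)"
    and fin: "finite (new_names k \<inter> (\<Union>A \<in> \<Gamma>. fv A))"
    and nd: "\<not> ded T \<Gamma> C"
begin

definition fresh :: "fm set \<Rightarrow> nat" where
  "fresh \<Delta> = (SOME c. c \<in> new_names k \<and> c \<notin> (\<Union>A \<in> \<Delta>. fv A))"

text \<open>Measured against the goal \<open>C\<close> and not against \<open>Bot\<close>:
  intuitionistically, an underivable \<open>C\<close> need not have a consistent negation that could
  be added instead.\<close>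

definition admissible :: "fm set \<Rightarrow> fm \<Rightarrow> bool" where
  "admissible \<Delta> A = (A \<in> sentences (Suc k) \<and> \<not> ded T (insert A \<Delta>) C)"

text \<open>The witness must be fresh for the goal \<open>C\<close> as well, otherwise it could not
  be discharged by existential elimination.\<close>

definition witness :: "fm set \<Rightarrow> fm \<Rightarrow> fm set" where
  "witness \<Delta> A = (case A of Exists B \<Rightarrow> {inst B (fresh (insert C (insert A \<Delta>)))} | _ \<Rightarrow> {})"

primrec stage :: "nat \<Rightarrow> fm set" where
  "stage 0 = \<Gamma>"
| "stage (Suc n) = (if admissible (stage n) (from_nat n)
    then witness (stage n) (from_nat n) \<union> insert (from_nat n) (stage n) else stage n)"

definition saturation :: "fm set" where
  "saturation = (\<Union>n. stage n)"

lemma fresh: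
  assumes "finite (new_names k \<inter> (\<Union>A \<in> \<Delta>. fv A))"
  shows "fresh \<Delta> \<in> new_names k" "A \<in> \<Delta> \<Longrightarrow> fresh \<Delta> \<notin> fv A"
proof -
  have "infinite (new_names k - (\<Union>A \<in> \<Delta>. fv A))"
    using assms infinite_new_names[of k] finite_Un[of "new_names k - (\<Union>A \<in> \<Delta>. fv A)"]
    by (metis Un_Diff_Int)
  then obtain c where "c \<in> new_names k - (\<Union>A \<in> \<Delta>. fv A)" by (metis equals0I finite.emptyI)
  then have "\<exists>c. c \<in> new_names k \<and> c \<notin> (\<Union>A \<in> \<Delta>. fv A)" by blast
  from someI_ex[OF this] show "fresh \<Delta> \<in> new_names k" "A \<in> \<Delta> \<Longrightarrow> fresh \<Delta> \<notin> fv A"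
    unfolding fresh_def by auto
qed

lemma witness_finite: "finite (witness \<Delta> A)"
  by (auto simp: witness_def split: fm.split)

text \<open>Each stage adds at most two formulas, hence finitely many new names, which is why a
  fresh witness never runs out. Admissibility together with the eigenvariable rule keeps
  \<open>C\<close> underivable.\<close>

lemma stage_invariant:
  "stage n \<subseteq> sentences (Suc k) \<and> finite (new_names k \<inter> (\<Union>A \<in> stage n. fv A)) \<and> \<not> ded T (stage n) C"
proof (induction n)
  case 0
  then show ?case using \<Gamma> fin nd by simp
next
  case (Suc n)
  let ?A = "from_nat n :: fm"
  show ?case
  proof (cases "admissible (stage n) ?A")
    case True
    have fin': "finite (new_names k \<inter> (\<Union>B \<in> insert C (insert ?A (stage n)). fv B))"
      using Suc by (simp add: Int_Un_distrib finite_fv)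
    note fr = fresh[OF fin']
    have "witness (stage n) ?A \<subseteq> sentences (Suc k)"
    proof
      fix D assume "D \<in> witness (stage n) ?A"
      then obtain B where B: "?A = Exists B" "D = inst B (fresh (insert C (insert ?A (stage n))))"
        by (auto simp: witness_def split: fm.split_asm)
      then have "fv (Forall B) \<subseteq> names (Suc k)" using True by (auto simp: admissible_def sentences_def)
      then show "D \<in> sentences (Suc k)"
        using fv_inst[of B] fr(1) new_names(1)[of k] B(2) unfolding sentences_def by blast
    qed
    moreover have "finite (new_names k \<inter> (\<Union>B \<in> stage (Suc n). fv B))"
      using Suc True witness_finite by (simp add: Int_Un_distrib finite_fv)
    moreover have "\<not> ded T (witness (stage n) ?A \<union> insert ?A (stage n)) C"
    proof
      assume *: "ded T (witness (stage n) ?A \<union> insert ?A (stage n)) C"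
      have n: "\<not> ded T (insert ?A (stage n)) C" using True by (simp add: admissible_def)
      then obtain B where B: "?A = Exists B" using * by (auto simp: witness_def split: fm.split_asm)
      show False
        using n ded_fresh_exE[OF T, of B "fresh (insert C (insert ?A (stage n)))" "insert ?A (stage n)" C] * B
          fr(2)[of C] fr(2)[of ?A] fr(2)
        by (simp add: witness_def ded.hyp insert_commute del: fv.simps)
    qed
    ultimately show ?thesis using Suc True by (auto simp: admissible_def)
  next
    case False
    then show ?thesis using Suc by simp
  qed
qed

lemma saturation_not_ded: "\<not> ded T saturation C"
proof
  assume "ded T saturation C"
  moreover have "stage n \<subseteq> stage (Suc n)" for n by auto
  ultimately show False using ded_chain[of T stage C] stage_invariant unfolding saturation_def by blast
qed

lemma saturation_maximal: "A \<in> sentences (Suc k) \<Longrightarrow> A \<notin> saturation \<Longrightarrow> ded T (insert A saturation) C"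
proof (rule ccontr)
  assume A: "A \<in> sentences (Suc k)" "A \<notin> saturation" "\<not> ded T (insert A saturation) C"
  obtain n where n: "A = from_nat n" by (metis from_nat_to_nat)
  have "admissible (stage n) A"
    using A ded_weaken[of T "insert A (stage n)" C "insert A saturation"]
    by (auto simp: admissible_def saturation_def)
  then have "A \<in> stage (Suc n)" using n by simp
  then show False using A(2) unfolding saturation_def by blast
qed

lemma saturation_extends: "\<Gamma> \<subseteq> saturation"
  unfolding saturation_def by (metis UN_upper UNIV_I stage.simps(1))

lemma saturation_prime: "prime_theory T (Suc k, saturation)"
proof -
  have sub: "saturation \<subseteq> sentences (Suc k)" using stage_invariant by (auto simp: saturation_def)
  have closed: "A \<in> saturation" if "A \<in> sentences (Suc k)" "ded T saturation A" for A
    using that saturation_maximal saturation_not_ded ded_cut by blast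
  have "Bot \<notin> saturation" using saturation_not_ded by (meson ded.botE ded.hyp)
  moreover have "A \<in> saturation \<or> B \<in> saturation" if "Disj A B \<in> saturation" for A B
  proof (rule ccontr)
    assume *: "\<not> ?thesis"
    have "Disj A B \<in> sentences (Suc k)" using sub that by blast
    then have "A \<in> sentences (Suc k)" "B \<in> sentences (Suc k)"
      by (auto simp: sentences_def)
    then show False using * that saturation_maximal saturation_not_ded by (meson ded.disjE ded.hyp)
  qed
  moreover have "\<exists>t \<in> names (Suc k). inst A t \<in> saturation" if A: "Exists A \<in> saturation" for A
  proof -
    obtain n where n: "Exists A = from_nat n" by (metis from_nat_to_nat)
    \<comment> \<open>Membership in the union does not tell at which stage \<open>Exists A\<close>
      came in. But adding it to \<open>stage n\<close>, with \<open>n\<close> its own number, stays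
      inside the saturation, so it is admissible there and its witness enters at the next
      stage.\<close>
    have "insert (Exists A) (stage n) \<subseteq> saturation" using A by (auto simp: saturation_def)
    then have adm: "admissible (stage n) (from_nat n)"
      using A n[symmetric] sub saturation_not_ded ded_weaken[of T "insert (Exists A) (stage n)" C saturation]
      by (auto simp: admissible_def)
    let ?c = "fresh (insert C (insert (Exists A) (stage n)))"
    have "inst A ?c \<in> stage (Suc n)" using adm n[symmetric] by (simp add: witness_def)
    moreover have "?c \<in> names (Suc k)"
      using fresh(1)[of "insert C (insert (Exists A) (stage n))"] stage_invariant[of n] new_names(1)
      by (auto simp: Int_Un_distrib finite_fv simp del: fv.simps)
    ultimately show ?thesis unfolding saturation_def by blast
  qed
  ultimately show ?thesis using sub closed unfolding prime_theory_def by auto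
qed

end

lemma prime_extension:
  assumes "\<And>A r. A \<in> T \<Longrightarrow> ren A r \<in> T" "\<Gamma> \<subseteq> sentences (Suc k)"
    "finite (new_names k \<inter> (\<Union>A \<in> \<Gamma>. fv A))" "\<not> ded T \<Gamma> C"
  obtains \<Theta> where "prime_theory T (Suc k, \<Theta>)" "\<Gamma> \<subseteq> \<Theta>" "C \<notin> \<Theta>"
  using that[OF saturation_prime[OF assms] saturation_extends[OF assms]] saturation_not_ded[OF assms]
    ded.hyp by blast

section \<open>The canonical model and the truth lemma\<close>

context
  fixes T :: "fm set" and w0 :: "nat \<times> fm set"
  assumes T: "\<And>A r. A \<in> T \<Longrightarrow> ren A r \<in> T" and w0: "prime_theory T w0"
begin

text \<open>Pairs that are not prime theories are made copies of \<open>w0\<close>, so that every pair is a world.\<close>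

definition wd :: "nat \<times> fm set \<Rightarrow> nat \<times> fm set" where
  "wd w = (if prime_theory T w then w else w0)"

definition cle :: "nat \<times> fm set \<Rightarrow> nat \<times> fm set \<Rightarrow> bool" where
  "cle w v = (fst (wd w) \<le> fst (wd v) \<and> snd (wd w) \<subseteq> snd (wd v))"

definition cE :: "nat \<times> fm set \<Rightarrow> nat \<Rightarrow> bool" where
  "cE w x = (x \<in> names (fst (wd w)))"

definition cmem :: "nat \<Rightarrow> nat \<Rightarrow> nat \<times> fm set \<Rightarrow> bool" where
  "cmem x y w = (Mem x y \<in> snd (wd w))"

definition ceq :: "nat \<Rightarrow> nat \<Rightarrow> nat \<times> fm set \<Rightarrow> bool" where
  "ceq x y w = (Eq x y \<in> snd (wd w))"

lemma wd_prime: "prime_theory T (wd w)" 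
  by (simp add: wd_def w0)

lemma wd_id: "prime_theory T w \<Longrightarrow> wd w = w" 
  by (simp add: wd_def)

lemma
  shows wd_sentences: "A \<in> snd (wd w) \<Longrightarrow> A \<in> sentences (fst (wd w))"
    and wd_Bot: "Bot \<notin> snd (wd w)"
    and wd_ded: "ded T (snd (wd w)) A \<Longrightarrow> A \<in> sentences (fst (wd w)) \<Longrightarrow> A \<in> snd (wd w)"
    and wd_Disj: "Disj A B \<in> snd (wd w) \<Longrightarrow> A \<in> snd (wd w) \<or> B \<in> snd (wd w)"
    and wd_Exists: "Exists A' \<in> snd (wd w) \<Longrightarrow> \<exists>t \<in> names (fst (wd w)). inst A' t \<in> snd (wd w)"
  using wd_prime[of w] unfolding prime_theory_def by (auto split: prod.split_asm)

lemma wd_hyp: "A \<in> snd (wd w) \<Longrightarrow> ded T (snd (wd w)) A"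
  by (rule ded.hyp)

lemma wd_extension:
  assumes "\<Gamma> \<subseteq> sentences (Suc (fst (wd w)))" "snd (wd w) \<subseteq> \<Gamma>" "\<not> ded T \<Gamma> C"
    "finite (new_names (fst (wd w)) \<inter> (\<Union>A \<in> \<Gamma>. fv A))"
  obtains v where "cle w v" "\<Gamma> \<subseteq> snd (wd v)" "C \<notin> snd (wd v)" "fst (wd v) = Suc (fst (wd w))"
proof -
  obtain \<Theta> where "prime_theory T (Suc (fst (wd w)), \<Theta>)" "\<Gamma> \<subseteq> \<Theta>" "C \<notin> \<Theta>"
    using prime_extension[OF T assms(1,4,3)] by blast
  then show thesis using that[of "(Suc (fst (wd w)), \<Theta>)"] assms(2) by (auto simp: cle_def wd_id)
qed

lemma wd_new_names: "new_names (fst (wd w)) \<inter> (\<Union>A \<in> snd (wd w). fv A) = {}"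
  using new_names(2)[of "fst (wd w)"] wd_sentences by (fastforce simp: sentences_def)

text \<open>If the implication were missing, then \<open>A\<close> could be added without making
  \<open>B\<close> derivable, and a prime extension at the next height that avoids \<open>B\<close>
  would contradict the right-hand side.\<close>

lemma wd_Imp:
  assumes "Imp A B \<in> sentences (fst (wd w))"
  shows "Imp A B \<in> snd (wd w) \<longleftrightarrow> (\<forall>v. cle w v \<longrightarrow> A \<in> snd (wd v) \<longrightarrow> B \<in> snd (wd v))"
proof
  assume *: "Imp A B \<in> snd (wd w)"
  show "\<forall>v. cle w v \<longrightarrow> A \<in> snd (wd v) \<longrightarrow> B \<in> snd (wd v)"
  proof (intro HOL.allI HOL.impI)
    fix v assume v: "cle w v" "A \<in> snd (wd v)"
    then have "Imp A B \<in> snd (wd v)" using * by (auto simp: cle_def)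
    moreover from this have "B \<in> sentences (fst (wd v))" using wd_sentences by (fastforce simp: sentences_def)
    ultimately show "B \<in> snd (wd v)" using wd_ded[OF ded.impE[OF wd_hyp wd_hyp[OF v(2)]]] by blast
  qed
next
  assume *: "\<forall>v. cle w v \<longrightarrow> A \<in> snd (wd v) \<longrightarrow> B \<in> snd (wd v)"
  show "Imp A B \<in> snd (wd w)"
  proof (rule ccontr)
    assume "Imp A B \<notin> snd (wd w)"
    then have nd: "\<not> ded T (insert A (snd (wd w))) B" using assms wd_ded ded.impI by blast
    have "insert A (snd (wd w)) \<subseteq> sentences (Suc (fst (wd w)))"
      using assms wd_sentences names_mono[of "fst (wd w)" "Suc (fst (wd w))"]
      by (fastforce simp: sentences_def)
    moreover have "finite (new_names (fst (wd w)) \<inter> (\<Union>C \<in> insert A (snd (wd w)). fv C))"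
      by (simp add: Int_Un_distrib finite_fv wd_new_names)
    ultimately obtain v where "cle w v" "insert A (snd (wd w)) \<subseteq> snd (wd v)" "B \<notin> snd (wd v)"
      using wd_extension[OF _ _ nd] by blast
    then show False using * by blast
  qed
qed

lemma inst_sentence: "Forall A \<in> sentences k \<Longrightarrow> t \<in> names k \<Longrightarrow> inst A t \<in> sentences k"
  using fv_inst[of A t] by (auto simp: sentences_def)

text \<open>A counterexample needs a name that \<open>w\<close> does not own: a variable
  \<open>c\<close> of the next layer occurs nowhere in the theory, so an instance at
  \<open>c\<close> could be generalised. As \<open>c\<close> exists only at the extension, this is
  the place where domains have to grow.\<close>

lemma wd_Forall:
  assumes "Forall A \<in> sentences (fst (wd w))"
  shows "Forall A \<in> snd (wd w) \<longleftrightarrow> (\<forall>v. cle w v \<longrightarrow> (\<forall>t. cE v t \<longrightarrow> inst A t \<in> snd (wd v)))"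
proof
  assume *: "Forall A \<in> snd (wd w)"
  show "\<forall>v. cle w v \<longrightarrow> (\<forall>t. cE v t \<longrightarrow> inst A t \<in> snd (wd v))"
  proof (intro HOL.allI HOL.impI)
    fix v t assume v: "cle w v" "cE v t"
    then have "Forall A \<in> snd (wd v)" using * by (auto simp: cle_def)
    then show "inst A t \<in> snd (wd v)"
      using v wd_ded[OF ded.allE[OF wd_hyp]] wd_sentences inst_sentence by (simp add: cE_def)
  qed
next
  assume *: "\<forall>v. cle w v \<longrightarrow> (\<forall>t. cE v t \<longrightarrow> inst A t \<in> snd (wd v))"
  show "Forall A \<in> snd (wd w)"
  proof (rule ccontr)
    assume **: "Forall A \<notin> snd (wd w)"
    obtain c where c: "c \<in> new_names (fst (wd w))"
      using infinite_new_names by (metis equals0I finite.emptyI)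
    then have cn: "c \<notin> names (fst (wd w))" using new_names(2) by blast
    have nd: "\<not> ded T (snd (wd w)) (inst A c)"
    proof
      assume d: "ded T (snd (wd w)) (inst A c)"
      have "ded T (snd (wd w)) (Forall A)"
      proof (rule ded_fresh_allI[OF T d])
        show "c \<notin> fv (Forall A)" using assms cn by (auto simp: sentences_def)
        show "c \<notin> fv C" if "C \<in> snd (wd w)" for C
          using wd_sentences[OF that] cn by (auto simp: sentences_def)
      qed
      then show False using ** assms wd_ded by blast
    qed
    have "snd (wd w) \<subseteq> sentences (Suc (fst (wd w)))"
      using wd_sentences sentences_mono[of "fst (wd w)" "Suc (fst (wd w))"] by (meson le_SucI order_refl subset_iff)
    then obtain v where "cle w v" "inst A c \<notin> snd (wd v)" "fst (wd v) = Suc (fst (wd w))"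
      using wd_extension[OF _ _ nd] wd_new_names by (metis finite.emptyI order_refl)
    moreover from this have "cE v c" using c new_names(1)[of "fst (wd w)"] unfolding cE_def by auto
    ultimately show False using * by blast
  qed
qed

lemma inst_ren: "inst (ren A (up e)) t = ren A (case_nat t e)"
  unfolding inst_def ren_ren by (rule ren_cong) (simp split: nat.split)

lemma inst_Mem_simps:
  "inst (Mem 0 (Suc y)) t = Mem t y" "inst (Mem (Suc x) 0) t = Mem x t"
  "inst (Eq 0 (Suc y)) t = Eq t y" "inst (Eq (Suc x) 0) t = Eq x t"
  by (simp_all add: inst_def)

lemma wd_subst:
  assumes "Eq s t \<in> snd (wd w)" "inst A s \<in> snd (wd w)" "inst A t \<in> sentences (fst (wd w))"
  shows "inst A t \<in> snd (wd w)"
  by (rule wd_ded[OF ded.eq_subst[OF wd_hyp[OF assms(1)] wd_hyp[OF assms(2)]] assms(3)])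

lemma wd_names:
  "Mem x y \<in> snd (wd w) \<Longrightarrow> x \<in> names (fst (wd w)) \<and> y \<in> names (fst (wd w))"
  "Eq x y \<in> snd (wd w) \<Longrightarrow> x \<in> names (fst (wd w)) \<and> y \<in> names (fst (wd w))"
  using wd_sentences by (fastforce simp: sentences_def)+

lemma kripke_canonical: "kripke cle cE cmem ceq"
proof
  have refl: "Eq x x \<in> snd (wd w)" if "x \<in> names (fst (wd w))" for x w
    using wd_ded[of w "Eq x x"] that by (simp add: sentences_def ded.eq_refl)
  have sym: "Eq y x \<in> snd (wd w)" if "Eq x y \<in> snd (wd w)" for x y w
    using wd_subst[OF that, of "Eq 0 (Suc x)"] wd_names(2)[OF that] refl
    by (simp add: inst_Mem_simps sentences_def)
  fix w v u :: "nat \<times> fm set" and x y z x' y'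
  \<comment> \<open>A variable of layer 0 belongs to every height, so all domains are
    inhabited.\<close>
  have "prod_encode (0, 0) \<in> names (fst (wd w))" by (simp add: names_def)
  then show "\<exists>x. cE w x" unfolding cE_def by blast
  show "cle w w" by (simp add: cle_def)
  show "cle u v \<Longrightarrow> cle v w \<Longrightarrow> cle u w" by (auto simp: cle_def)
  show "cE w x \<Longrightarrow> cle w v \<Longrightarrow> cE v x" using names_mono by (auto simp: cE_def cle_def)
  show "cmem x y w \<Longrightarrow> cle w v \<Longrightarrow> cmem x y v" by (auto simp: cmem_def cle_def)
  show "ceq x y w \<Longrightarrow> cle w v \<Longrightarrow> ceq x y v" by (auto simp: ceq_def cle_def)
  show "cmem x y w \<Longrightarrow> cE w x \<and> cE w y" using wd_names by (simp add: cmem_def cE_def)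
  show "ceq x y w \<Longrightarrow> cE w x \<and> cE w y" using wd_names by (simp add: ceq_def cE_def)
  show "cE w x \<Longrightarrow> ceq x x w" using refl by (simp add: ceq_def cE_def)
  show "ceq x y w \<Longrightarrow> ceq y x w" using sym by (simp add: ceq_def)
  show "ceq x y w \<Longrightarrow> ceq y z w \<Longrightarrow> ceq x z w"
    using wd_subst[of y z w "Eq (Suc x) 0"] wd_names by (simp add: ceq_def inst_Mem_simps sentences_def)
  show "cmem x y w \<Longrightarrow> ceq x x' w \<Longrightarrow> ceq y y' w \<Longrightarrow> cmem x' y' w"
    using wd_subst[of x x' w "Mem 0 (Suc y)"] wd_subst[of y y' w "Mem (Suc x') 0"] wd_names
    by (simp add: cmem_def ceq_def inst_Mem_simps sentences_def)
qed

interpretation canonical: kripke cle cE cmem ceq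
  by (rule kripke_canonical)

text \<open>The individuals of the canonical model are variables, so an environment is literally a
  renaming.\<close>

lemma truth_lemma:
  "ren A e \<in> sentences (fst (wd w)) \<Longrightarrow> canonical.sem A e w \<longleftrightarrow> ren A e \<in> snd (wd w)"
proof (induction A arbitrary: e w)
  case (Mem i j)
  show ?case using canonical.sem.simps(1)[of i j e w] unfolding cmem_def[of "e i" "e j" w] by simp
next
  case (Eq i j)
  show ?case using canonical.sem.simps(2)[of i j e w] unfolding ceq_def[of "e i" "e j" w] by simp
next
  case Bot
  then show ?case using wd_Bot by simp
next
  case (Conj A B)
  then have "ren A e \<in> sentences (fst (wd w))" "ren B e \<in> sentences (fst (wd w))"
    by (auto simp: sentences_def)
  moreover have "Conj (ren A e) (ren B e) \<in> snd (wd w) \<longleftrightarrow> ren A e \<in> snd (wd w) \<and> ren B e \<in> snd (wd w)"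
    using calculation Conj.prems wd_ded[of w] ded.conjI[OF wd_hyp wd_hyp, of "ren A e" w "ren B e"]
      ded.conjE1[OF wd_hyp, of "ren A e" "ren B e" w] ded.conjE2[OF wd_hyp, of "ren A e" "ren B e" w] by auto
  ultimately show ?case using Conj.IH by simp
next
  case (Disj A B)
  then have "ren A e \<in> sentences (fst (wd w))" "ren B e \<in> sentences (fst (wd w))"
    by (auto simp: sentences_def)
  moreover have "Disj (ren A e) (ren B e) \<in> snd (wd w) \<longleftrightarrow> ren A e \<in> snd (wd w) \<or> ren B e \<in> snd (wd w)"
    using Disj.prems wd_Disj[of "ren A e" "ren B e" w] wd_ded[of w "Disj (ren A e) (ren B e)"]
      ded.disjI1[OF wd_hyp, of "ren A e" w "ren B e"] ded.disjI2[OF wd_hyp, of "ren B e" w "ren A e"] by auto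
  ultimately show ?case using Disj.IH by simp
next
  case (Imp A B)
  have "ren A e \<in> sentences (fst (wd v))" "ren B e \<in> sentences (fst (wd v))" if "cle w v" for v
    using Imp.prems that names_mono[of "fst (wd w)" "fst (wd v)"] by (auto simp: sentences_def cle_def)
  then show ?case using Imp.IH wd_Imp[of "ren A e" "ren B e" w] Imp.prems by auto
next
  case (Forall A)
  have "ren A (case_nat t e) \<in> sentences (fst (wd v))" if "cle w v" "cE v t" for v t
    using Forall.prems that inst_sentence[of "ren A (up e)" "fst (wd v)" t]
      sentences_mono[of "fst (wd w)" "fst (wd v)"]
    by (auto simp: inst_ren cE_def cle_def)
  then show ?case using Forall.IH wd_Forall[of "ren A (up e)" w] Forall.prems
    by (auto simp: inst_ren)
next
  case (Exists A)
  have IH: "canonical.sem A (case_nat t e) w \<longleftrightarrow> inst (ren A (up e)) t \<in> snd (wd w)" if "cE w t" for t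
  proof -
    have "ren A (case_nat t e) \<in> sentences (fst (wd w))"
      using Exists.prems that inst_sentence[of "ren A (up e)" "fst (wd w)" t]
      by (auto simp: inst_ren cE_def sentences_def)
    from Exists.IH[OF this] show ?thesis by (simp only: inst_ren)
  qed
  show ?case
  proof
    assume "canonical.sem (Exists A) e w"
    then obtain t where "cE w t" "canonical.sem A (case_nat t e) w" by auto
    then have "inst (ren A (up e)) t \<in> snd (wd w)" using IH by blast
    then show "ren (Exists A) e \<in> snd (wd w)"
      using Exists.prems wd_ded[OF ded.exI[OF wd_hyp]] by simp
  next
    assume "ren (Exists A) e \<in> snd (wd w)"
    then obtain t where "cE w t" "inst (ren A (up e)) t \<in> snd (wd w)"
      using wd_Exists[of "ren A (up e)" w] unfolding cE_def by auto
    then have "cE w t \<and> canonical.sem A (case_nat t e) w" using IH by blast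
    then show "canonical.sem (Exists A) e w" by auto
  qed
qed

lemma canonical_axioms:
  assumes "A \<in> T" "\<And>i. cE w (e i)"
  shows "canonical.sem A e w"
proof -
  have "ren A e \<in> sentences (fst (wd w))"
    using assms(2) by (auto simp: sentences_def fv_ren cE_def[symmetric])
  then show ?thesis
    using truth_lemma wd_ded ded.ax[OF T[OF assms(1)]] by blast
qed

lemma canonical_refutes: "A \<notin> snd w0 \<Longrightarrow> A \<in> sentences (fst w0) \<Longrightarrow> \<not> canonical.sem A (\<lambda>i. i) w0"
  using truth_lemma[of A "\<lambda>i. i" w0] by (simp add: ren_id wd_id w0)

end

text \<open>Only models over the types of the canonical model have to be considered. Closedness of
  \<open>A\<close> makes the environment immaterial, which matters because the identity environment
  contains variables that do not exist at the root.\<close>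

theorem kripke_completeness:
  assumes T: "\<And>A r. A \<in> T \<Longrightarrow> ren A r \<in> T"
    and A: "fv A = {}"
    and valid: "\<And>le (E :: nat \<times> fm set \<Rightarrow> nat \<Rightarrow> bool) mm qq w e. kripke le E mm qq \<Longrightarrow>
      (\<And>B w e. B \<in> T \<Longrightarrow> (\<And>i. E w (e i)) \<Longrightarrow> kripke.sem le E mm qq B e w) \<Longrightarrow>
      kripke.sem le E mm qq A e w"
  shows "ded T {} A"
proof (rule ccontr)
  assume "\<not> ded T {} A"
  \<comment> \<open>The root has height 1, because saturation works one height above its input, here
    the empty set at height 0.\<close>
  then obtain \<Theta> where w0: "prime_theory T (Suc 0, \<Theta>)" "A \<notin> \<Theta>"
    using prime_extension[OF T, of "{}" 0 A] by auto
  have "kripke.sem (cle T (Suc 0, \<Theta>)) (cE T (Suc 0, \<Theta>)) (cmem T (Suc 0, \<Theta>)) (ceq T (Suc 0, \<Theta>))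
    A (\<lambda>i. i) (Suc 0, \<Theta>)"
    by (rule valid[OF kripke_canonical[OF T w0(1)]]) (assumption, rule canonical_axioms[OF T w0(1)], assumption+)
  moreover have "A \<in> sentences (Suc 0)" using A by (simp add: sentences_def)
  ultimately show False
    using canonical_refutes[OF T w0(1), of A] w0(2) by simp
qed

section \<open>CZF is closed under renaming\<close>

lemma up_funpow: "(up ^^ n) r i = (if i < n then i else n + r (i - n))"
proof (induction n arbitrary: i)
  case (Suc n)
  then show ?case by (cases i) auto
qed simp

text \<open>Under \<open>n\<close> binders a renaming leaves all levels alone and affects only the
  parameters of \<open>\<Phi>\<close>, which follow its \<open>length xs\<close> arguments. So an
  instance of a scheme is renamed to another instance.\<close>

lemma ren_papp:
  assumes "\<forall>x \<in> set xs. x < n"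
  shows "ren (papp \<Phi> xs n) ((up ^^ n) r) = papp (ren \<Phi> ((up ^^ length xs) r)) xs n"
proof -
  have "n - Suc (xs ! i) < n" "n - Suc (n - Suc (xs ! i)) = xs ! i" if "i < length xs" for i
    using assms that nth_mem by fastforce+
  then show ?thesis unfolding papp_def ren_ren by (intro ren_cong) (auto simp: up_funpow)
qed

lemma bounded_ren: "bounded A \<Longrightarrow> bounded (ren A r)"
  by (induction arbitrary: r rule: bounded.induct) (auto intro: bounded.intros)

lemmas form_defs = all_def ex_def conj_def disj_def imp_def iff_def mem_def eql_def bot_def

lemma CZF_ren: "A \<in> CZF \<Longrightarrow> ren A r \<in> CZF"
proof -
  have closed: "ren (F 0) r = F 0" if "F \<in> {extensionality, pairing, union, infinity}" for F
    by (rule ren_id) (use that in \<open>auto simp: extensionality_def pairing_def union_def infinity_def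
      is_omega_def is_empty_def is_succ_def form_defs\<close>)
  \<comment> \<open>Each list holds the levels of the variables handed to \<open>\<Phi>\<close>, and
    the number after it is the depth of that occurrence. In set induction, \<open>a\<close> has
    level 0 and \<open>x\<close> level 1; the other schemes are read off in the same way.\<close>
  have ind: "ren (set_induction \<Phi> 0) r = set_induction (ren \<Phi> (up r)) 0" for \<Phi>
    using ren_papp[of "[0]" 1 \<Phi> r] ren_papp[of "[1]" 2 \<Phi> r]
    by (simp add: set_induction_def form_defs numeral_2_eq_2)
  have sep: "ren (separation \<Phi> 0) r = separation (ren \<Phi> (up r)) 0" for \<Phi>
    using ren_papp[of "[2]" 3 \<Phi> r]
    by (simp add: separation_def form_defs numeral_2_eq_2 numeral_3_eq_3)
  have coll: "ren (strong_collection \<Phi> 0) r = strong_collection (ren \<Phi> (up (up r))) 0" for \<Phi>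
    using ren_papp[of "[1, 2]" 3 \<Phi> r] ren_papp[of "[2, 3]" 4 \<Phi> r] ren_papp[of "[3, 2]" 4 \<Phi> r]
    by (simp add: strong_collection_def form_defs eval_nat_numeral)
  have sub: "ren (subset_collection \<Phi> 0) r = subset_collection (ren \<Phi> (up (up (up r)))) 0" for \<Phi>
    using ren_papp[of "[4, 5, 3]" 6 \<Phi> r] ren_papp[of "[5, 6, 3]" 7 \<Phi> r] ren_papp[of "[6, 5, 3]" 7 \<Phi> r]
    by (simp add: subset_collection_def form_defs eval_nat_numeral)
  assume "A \<in> CZF"
  then show ?thesis
    unfolding CZF_def using closed ind sep coll sub bounded_ren by (auto; blast)
qed

section \<open>Propositions of a Kripke model\<close>

context kripke
begin

definition kbot :: "'w \<Rightarrow> bool" where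
  "kbot = (\<lambda>w. False)"

definition kconj :: "('w \<Rightarrow> bool) \<Rightarrow> ('w \<Rightarrow> bool) \<Rightarrow> 'w \<Rightarrow> bool" (infixr \<open>\<and>\<^sub>k\<close> 35) where
  "(P \<and>\<^sub>k Q) = (\<lambda>w. P w \<and> Q w)"

definition kdisj :: "('w \<Rightarrow> bool) \<Rightarrow> ('w \<Rightarrow> bool) \<Rightarrow> 'w \<Rightarrow> bool" (infixr \<open>\<or>\<^sub>k\<close> 30) where
  "(P \<or>\<^sub>k Q) = (\<lambda>w. P w \<or> Q w)"

definition kimp :: "('w \<Rightarrow> bool) \<Rightarrow> ('w \<Rightarrow> bool) \<Rightarrow> 'w \<Rightarrow> bool" (infixr \<open>\<longrightarrow>\<^sub>k\<close> 25) where
  "(P \<longrightarrow>\<^sub>k Q) = (\<lambda>w. \<forall>v. w \<sqsubseteq> v \<longrightarrow> P v \<longrightarrow> Q v)"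

definition kiff :: "('w \<Rightarrow> bool) \<Rightarrow> ('w \<Rightarrow> bool) \<Rightarrow> 'w \<Rightarrow> bool" (infixr \<open>\<longleftrightarrow>\<^sub>k\<close> 25) where
  "(P \<longleftrightarrow>\<^sub>k Q) = ((P \<longrightarrow>\<^sub>k Q) \<and>\<^sub>k (Q \<longrightarrow>\<^sub>k P))"

definition kall :: "('a \<Rightarrow> 'w \<Rightarrow> bool) \<Rightarrow> 'w \<Rightarrow> bool" (binder \<open>\<forall>\<^sub>k\<close> 10) where
  "kall Q = (\<lambda>w. \<forall>v. w \<sqsubseteq> v \<longrightarrow> (\<forall>x. E v x \<longrightarrow> Q x v))"

definition kex :: "('a \<Rightarrow> 'w \<Rightarrow> bool) \<Rightarrow> 'w \<Rightarrow> bool" (binder \<open>\<exists>\<^sub>k\<close> 10) where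
  "kex Q = (\<lambda>w. \<exists>x. E w x \<and> Q x w)"

lemmas k_defs = kbot_def kconj_def kdisj_def kimp_def kiff_def kall_def kex_def

lemma k_simps [simp]:
  "kbot w \<longleftrightarrow> False"
  "(P \<and>\<^sub>k Q) w \<longleftrightarrow> P w \<and> Q w"
  "(P \<or>\<^sub>k Q) w \<longleftrightarrow> P w \<or> Q w"
  "kex R w \<longleftrightarrow> (\<exists>x. E w x \<and> R x w)"
  by (simp_all add: k_defs)

lemma kimp_iff: "(P \<longrightarrow>\<^sub>k Q) w \<longleftrightarrow> (\<forall>v. w \<sqsubseteq> v \<longrightarrow> P v \<longrightarrow> Q v)"
  by (simp add: k_defs)

lemma kiff_iff: "(P \<longleftrightarrow>\<^sub>k Q) w \<longleftrightarrow> (\<forall>v. w \<sqsubseteq> v \<longrightarrow> (P v \<longleftrightarrow> Q v))"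
  by (auto simp: k_defs)

lemma kall_iff: "kall Q w \<longleftrightarrow> (\<forall>v. w \<sqsubseteq> v \<longrightarrow> (\<forall>x. E v x \<longrightarrow> Q x v))"
  by (simp add: k_defs)

text \<open>The two moves to later worlds, one by the quantifier and one by the implication,
  collapse into one because individuals persist. The law thus holds for arbitrary predicates of
  worlds.\<close>

lemma kall_kimp: "(\<forall>\<^sub>k x. P x \<longrightarrow>\<^sub>k Q x) w \<longleftrightarrow> (\<forall>v x. w \<sqsubseteq> v \<longrightarrow> E v x \<longrightarrow> P x v \<longrightarrow> Q x v)"
  unfolding kall_iff kimp_iff by (meson E_up le_refl le_trans)

lemma kall_kiff: "(\<forall>\<^sub>k x. P x \<longleftrightarrow>\<^sub>k Q x) w \<longleftrightarrow> (\<forall>v x. w \<sqsubseteq> v \<longrightarrow> E v x \<longrightarrow> (P x v \<longleftrightarrow> Q x v))"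
  unfolding kall_iff kiff_iff by (meson E_up le_refl le_trans)

lemma kall2_kimp: "(\<forall>\<^sub>k x y. P x y \<longrightarrow>\<^sub>k Q x y) w \<longleftrightarrow>
  (\<forall>v x y. w \<sqsubseteq> v \<longrightarrow> E v x \<longrightarrow> E v y \<longrightarrow> P x y v \<longrightarrow> Q x y v)"
  unfolding kall_iff kimp_iff by (meson E_up le_refl le_trans)

lemma kall3_kimp: "(\<forall>\<^sub>k x y z. P x y z \<longrightarrow>\<^sub>k Q x y z) w \<longleftrightarrow>
  (\<forall>v x y z. w \<sqsubseteq> v \<longrightarrow> E v x \<longrightarrow> E v y \<longrightarrow> E v z \<longrightarrow> P x y z v \<longrightarrow> Q x y z v)"
  unfolding kall_iff kimp_iff by (meson E_up le_refl le_trans)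

lemma kallD: "kall Q w \<Longrightarrow> E w x \<Longrightarrow> Q x w"
  by (simp add: kall_iff)

lemma kimpD: "(P \<longrightarrow>\<^sub>k Q) w \<Longrightarrow> P w \<Longrightarrow> Q w"
  by (simp add: kimp_iff)

lemma kall_up: "kall Q w \<Longrightarrow> w \<sqsubseteq> v \<Longrightarrow> kall Q v"
  unfolding kall_iff using le_trans by blast

lemma sem_up: "sem A e w \<Longrightarrow> w \<sqsubseteq> v \<Longrightarrow> sem A e v"
proof (induction A arbitrary: e w v)
  case (Exists A)
  then show ?case using E_up by (meson sem.simps(8))
next
  case (Forall A)
  then show ?case using le_trans by (meson sem.simps(7))
next
  case (Imp A B)
  then show ?case using le_trans by (meson sem.simps(6))
qed (auto intro: mm_up qq_up)

lemma sem_cong: "sem A e w \<Longrightarrow> (\<And>i. i \<in> fv A \<Longrightarrow> e i = e' i \<or> (e i \<approx> e' i) w) \<Longrightarrow> sem A e' w"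
proof (induction A arbitrary: e e' w)
  case (Mem i j)
  then show ?case using mm_cong qq_refl mm_E by (metis fv.simps(1) insertCI sem.simps(1))
next
  case (Eq i j)
  then have "(e i \<approx> e j) w" "e i = e' i \<or> (e i \<approx> e' i) w" "e j = e' j \<or> (e j \<approx> e' j) w" by auto
  then have "(e' i \<approx> e' j) w" by (metis qq_sym qq_trans)
  then show ?case by simp
next
  case (Imp A B)
  show ?case unfolding sem.simps
  proof (intro HOL.allI HOL.impI)
    fix v assume v: "w \<sqsubseteq> v" "sem A e' v"
    have *: "e i = e' i \<or> (e i \<approx> e' i) v" if "i \<in> fv (Imp A B)" for i
      using Imp.prems(2)[OF that] qq_up v by blast
    have "sem A e v" by (rule Imp.IH(1)[OF v(2)]) (metis * UnI1 fv.simps(6) qq_sym)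
    then have "sem B e v" using Imp.prems v by simp
    then show "sem B e' v" by (rule Imp.IH(2)) (metis * UnI2 fv.simps(6))
  qed
next
  case (Forall A)
  show ?case unfolding sem.simps
  proof (intro HOL.allI HOL.impI)
    fix v x assume v: "w \<sqsubseteq> v" "E v x"
    have "sem A (case_nat x e) v" using Forall.prems v by simp
    then show "sem A (case_nat x e') v"
      by (rule Forall.IH) (use Forall.prems(2) qq_up v in \<open>fastforce split: nat.split\<close>)
  qed
next
  case (Exists A)
  then obtain x where x: "E w x" "sem A (case_nat x e) w" by auto
  have "sem A (case_nat x e') w"
    using x(2) by (rule Exists.IH) (use Exists.prems(2) in \<open>fastforce split: nat.split\<close>)
  then show ?case using x by auto
next
  case (Conj A B)
  show ?case using Conj.IH(1)[of e w e'] Conj.IH(2)[of e w e'] Conj.prems by simp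
next
  case (Disj A B)
  show ?case using Disj.IH(1)[of e w e'] Disj.IH(2)[of e w e'] Disj.prems by auto
qed simp

lemma sem_ren: "sem (ren A r) e = sem A (\<lambda>i. e (r i))"
proof (induction A arbitrary: e r)
  case (Forall A)
  have "(\<lambda>i. case_nat x e (up r i)) = case_nat x (\<lambda>i. e (r i))" for x
    by (auto split: nat.split simp: fun_eq_iff)
  then show ?case using Forall by (auto simp: fun_eq_iff)
next
  case (Exists A)
  have "(\<lambda>i. case_nat x e (up r i)) = case_nat x (\<lambda>i. e (r i))" for x
    by (auto split: nat.split simp: fun_eq_iff)
  then show ?case using Exists by (auto simp: fun_eq_iff)
qed (auto simp: fun_eq_iff)

subsection \<open>Evaluation of forms\<close>

text \<open>Levels are interpreted by \<open>\<rho>\<close>, parameters by \<open>\<sigma>\<close>.\<close>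

definition ev :: "form \<Rightarrow> nat \<Rightarrow> (nat \<Rightarrow> 'a) \<Rightarrow> (nat \<Rightarrow> 'a) \<Rightarrow> 'w \<Rightarrow> bool" where
  "ev F n \<rho> \<sigma> = sem (F n) (\<lambda>i. if i < n then \<rho> (n - Suc i) else \<sigma> (i - n))"

lemma ev_zero: "sem (F 0) \<sigma> = ev F 0 \<rho> \<sigma>"
  by (simp add: ev_def)

lemma ev_conn [simp]:
  "ev \<^bold>\<bottom> n \<rho> \<sigma> = kbot"
  "ev (A \<^bold>\<and> B) n \<rho> \<sigma> = (ev A n \<rho> \<sigma> \<and>\<^sub>k ev B n \<rho> \<sigma>)"
  "ev (A \<^bold>\<or> B) n \<rho> \<sigma> = (ev A n \<rho> \<sigma> \<or>\<^sub>k ev B n \<rho> \<sigma>)"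
  "ev (A \<^bold>\<longrightarrow> B) n \<rho> \<sigma> = (ev A n \<rho> \<sigma> \<longrightarrow>\<^sub>k ev B n \<rho> \<sigma>)"
  "ev (A \<^bold>\<longleftrightarrow> B) n \<rho> \<sigma> = (ev A n \<rho> \<sigma> \<longleftrightarrow>\<^sub>k ev B n \<rho> \<sigma>)"
  by (auto simp: ev_def bot_def conj_def disj_def imp_def iff_def k_defs fun_eq_iff)

lemma ev_atom [simp]:
  assumes "x < n" "y < n"
  shows "ev (x \<^bold>\<in> y) n \<rho> \<sigma> = (\<rho> x \<epsilon> \<rho> y)" "ev (x \<^bold>= y) n \<rho> \<sigma> = (\<rho> x \<approx> \<rho> y)"
  using assms by (auto simp: ev_def mem_def eql_def fun_eq_iff)

text \<open>An individual chosen at depth \<open>n\<close> has de Bruijn index 0 and level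
  \<open>n\<close>; all older levels keep their values.\<close>

lemma env_extend:
  "case_nat x (\<lambda>i. if i < n then \<rho> (n - Suc i) else \<sigma> (i - n)) =
   (\<lambda>i. if i < Suc n then (\<rho>(n := x)) (Suc n - Suc i) else \<sigma> (i - Suc n))"
  by (auto split: nat.split simp: fun_eq_iff)

lemma ev_quant [simp]:
  "ev (all F) n \<rho> \<sigma> = (\<forall>\<^sub>k x. ev (F n) (Suc n) (\<rho>(n := x)) \<sigma>)"
  "ev (ex F) n \<rho> \<sigma> = (\<exists>\<^sub>k x. ev (F n) (Suc n) (\<rho>(n := x)) \<sigma>)"
  unfolding ev_def all_def ex_def k_defs sem.simps env_extend by (simp_all add: fun_eq_iff)

lemma ev_papp:
  assumes "\<forall>x \<in> set xs. x < n"
  shows "ev (papp \<Phi> xs) n \<rho> \<sigma> = sem \<Phi> (\<lambda>i. if i < length xs then \<rho> (xs ! i) else \<sigma> (i - length xs))"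
proof -
  have "n - Suc (xs ! i) < n" "n - Suc (n - Suc (xs ! i)) = xs ! i" if "i < length xs" for i
    using assms that nth_mem by fastforce+
  then have "(\<lambda>i. (\<lambda>i. if i < n then \<rho> (n - Suc i) else \<sigma> (i - n))
      (if i < length xs then n - Suc (xs ! i) else n + (i - length xs))) =
    (\<lambda>i. if i < length xs then \<rho> (xs ! i) else \<sigma> (i - length xs))"
    by (auto simp: fun_eq_iff)
  then show ?thesis unfolding ev_def papp_def sem_ren by metis
qed

lemma ev_papp1: "x < n \<Longrightarrow> ev (papp \<Phi> [x]) n \<rho> \<sigma> = sem \<Phi> (case_nat (\<rho> x) \<sigma>)"
proof -
  have "(\<lambda>i. if i < length [x] then \<rho> ([x] ! i) else \<sigma> (i - length [x])) = case_nat (\<rho> x) \<sigma>"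
    by (auto simp: fun_eq_iff split: nat.split)
  then show "x < n \<Longrightarrow> ?thesis" using ev_papp[of "[x]" n \<Phi> \<rho> \<sigma>] by (simp only: list.set ball_simps simp_thms)
qed

lemma ev_papp2: "x < n \<Longrightarrow> y < n \<Longrightarrow> ev (papp \<Phi> [x, y]) n \<rho> \<sigma> = sem \<Phi> (case_nat (\<rho> x) (case_nat (\<rho> y) \<sigma>))"
proof -
  have "(\<lambda>i. if i < length [x, y] then \<rho> ([x, y] ! i) else \<sigma> (i - length [x, y])) =
    case_nat (\<rho> x) (case_nat (\<rho> y) \<sigma>)"
    by (auto simp: fun_eq_iff less_Suc_eq split: nat.split)
  then show "x < n \<Longrightarrow> y < n \<Longrightarrow> ?thesis"
    using ev_papp[of "[x, y]" n \<Phi> \<rho> \<sigma>] by (simp only: list.set ball_simps simp_thms)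
qed

subsection \<open>Definability\<close>

text \<open>
  The axiom schemes apply to families of propositions, indexed by environments, that are expressed
  by a formula whose parameters exist at \<open>w\<close>.
\<close>

definition dterm :: "'w \<Rightarrow> ((nat \<Rightarrow> 'a) \<Rightarrow> 'a) \<Rightarrow> bool" where
  "dterm w t = ((\<exists>j. t = (\<lambda>e. e j)) \<or> (\<exists>c. E w c \<and> t = (\<lambda>e. c)))"

definition dfn :: "'w \<Rightarrow> ((nat \<Rightarrow> 'a) \<Rightarrow> 'w \<Rightarrow> bool) \<Rightarrow> bool" where
  "dfn w Q = (\<exists>\<Phi> t. (\<forall>i. dterm w (t i)) \<and> Q = (\<lambda>e. sem \<Phi> (\<lambda>i. t i e)))"

lemma dterm_var: "dterm w (\<lambda>e. e j)"
  and dterm_const: "E w c \<Longrightarrow> dterm w (\<lambda>e. c)"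
  by (auto simp: dterm_def)

lemma dterm_shift: "dterm w t \<Longrightarrow> dterm w (\<lambda>e. t (\<lambda>i. e (Suc i)))"
  by (auto simp: dterm_def)

lemma dfn_sem: "(\<And>i. dterm w (t i)) \<Longrightarrow> dfn w (\<lambda>e. sem \<Phi> (\<lambda>i. t i e))"
  by (auto simp: dfn_def)

lemma dfn_mem: "dterm w t \<Longrightarrow> dterm w u \<Longrightarrow> dfn w (\<lambda>e. t e \<epsilon> u e)"
  and dfn_eq: "dterm w t \<Longrightarrow> dterm w u \<Longrightarrow> dfn w (\<lambda>e. t e \<approx> u e)"
proof -
  assume *: "dterm w t" "dterm w u"
  have d: "dfn w (\<lambda>e. sem A (\<lambda>i. (if i = 0 then t else u) e))" for A
    using * by (intro dfn_sem) simp
  have eq: "(\<lambda>e. t e \<epsilon> u e) = (\<lambda>e. sem (Mem 0 1) (\<lambda>i. (if i = 0 then t else u) e))"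
    "(\<lambda>e. t e \<approx> u e) = (\<lambda>e. sem (Eq 0 1) (\<lambda>i. (if i = 0 then t else u) e))"
    by (simp_all add: fun_eq_iff)
  show "dfn w (\<lambda>e. t e \<epsilon> u e)" "dfn w (\<lambda>e. t e \<approx> u e)"
    unfolding eq by (rule d)+
qed

lemma dfn_bot: "dfn w (\<lambda>e. kbot)"
proof -
  obtain c where "E w c" using nonempty by blast
  then have d: "dfn w (\<lambda>e. sem Bot (\<lambda>i. c))" by (intro dfn_sem dterm_const)
  have eq: "(\<lambda>e. kbot) = (\<lambda>e. sem Bot (\<lambda>i. c))" by (simp add: fun_eq_iff)
  show ?thesis unfolding eq by (rule d)
qed

text \<open>Two definitions arrive with unrelated parameter assignments. Interleaving them, even
  indices for the first and odd ones for the second, gives a single assignment for both.\<close>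

lemma dfn_common:
  assumes "dfn w P" "dfn w Q"
  obtains \<Phi> \<Psi> t where "\<And>i. dterm w (t i)"
    "P = (\<lambda>e. sem \<Phi> (\<lambda>i. t i e))" "Q = (\<lambda>e. sem \<Psi> (\<lambda>i. t i e))"
proof -
  obtain \<Phi> t \<Psi> u where *: "\<And>i. dterm w (t i)" "P = (\<lambda>e. sem \<Phi> (\<lambda>i. t i e))"
    "\<And>i. dterm w (u i)" "Q = (\<lambda>e. sem \<Psi> (\<lambda>i. u i e))"
    using assms unfolding dfn_def by blast
  show thesis
    by (rule that[of "\<lambda>i. if even i then t (i div 2) else u (i div 2)" "ren \<Phi> (\<lambda>i. 2 * i)" "ren \<Psi> (\<lambda>i. Suc (2 * i))"])
      (use * in \<open>simp_all add: sem_ren\<close>)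
qed

lemma dfn_conj: "dfn w P \<Longrightarrow> dfn w Q \<Longrightarrow> dfn w (\<lambda>e. P e \<and>\<^sub>k Q e)"
  and dfn_disj: "dfn w P \<Longrightarrow> dfn w Q \<Longrightarrow> dfn w (\<lambda>e. P e \<or>\<^sub>k Q e)"
  and dfn_imp: "dfn w P \<Longrightarrow> dfn w Q \<Longrightarrow> dfn w (\<lambda>e. P e \<longrightarrow>\<^sub>k Q e)"
proof -
  assume "dfn w P" "dfn w Q"
  then obtain \<Phi> \<Psi> t where *: "\<And>i. dterm w (t i)"
    "P = (\<lambda>e. sem \<Phi> (\<lambda>i. t i e))" "Q = (\<lambda>e. sem \<Psi> (\<lambda>i. t i e))"
    by (rule dfn_common) blast
  have eq: "(\<lambda>e. P e \<and>\<^sub>k Q e) = (\<lambda>e. sem (Conj \<Phi> \<Psi>) (\<lambda>i. t i e))"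
    "(\<lambda>e. P e \<or>\<^sub>k Q e) = (\<lambda>e. sem (Disj \<Phi> \<Psi>) (\<lambda>i. t i e))"
    "(\<lambda>e. P e \<longrightarrow>\<^sub>k Q e) = (\<lambda>e. sem (Imp \<Phi> \<Psi>) (\<lambda>i. t i e))"
    by (simp_all add: * fun_eq_iff kimp_iff)
  show "dfn w (\<lambda>e. P e \<and>\<^sub>k Q e)" "dfn w (\<lambda>e. P e \<or>\<^sub>k Q e)" "dfn w (\<lambda>e. P e \<longrightarrow>\<^sub>k Q e)"
    unfolding eq by (rule dfn_sem[OF *(1)])+
qed

lemma dfn_iff: "dfn w P \<Longrightarrow> dfn w Q \<Longrightarrow> dfn w (\<lambda>e. P e \<longleftrightarrow>\<^sub>k Q e)"
  unfolding kiff_def by (intro dfn_conj dfn_imp)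

lemma dfn_all: "dfn w (\<lambda>e. Q (\<lambda>i. e (Suc i)) (e 0)) \<Longrightarrow> dfn w (\<lambda>e. \<forall>\<^sub>k x. Q e x)"
  and dfn_ex: "dfn w (\<lambda>e. Q (\<lambda>i. e (Suc i)) (e 0)) \<Longrightarrow> dfn w (\<lambda>e. \<exists>\<^sub>k x. Q e x)"
proof -
  assume "dfn w (\<lambda>e. Q (\<lambda>i. e (Suc i)) (e 0))"
  then obtain \<Phi> t where t: "\<And>i. dterm w (t i)"
    and Q: "(\<lambda>e. Q (\<lambda>i. e (Suc i)) (e 0)) = (\<lambda>e. sem \<Phi> (\<lambda>i. t i e))"
    unfolding dfn_def by blast
  obtain c where c: "E w c" using nonempty by blast
  \<comment> \<open>All indices that \<open>t\<close> maps to the bound variable are sent to 0,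
    which the quantifier binds. In the remaining terms the slot of that variable is filled by the
    dummy \<open>c\<close>, whose value is never looked up.\<close>
  let ?r = "\<lambda>i. if t i = (\<lambda>e. e 0) then 0 else Suc i"
  let ?u = "\<lambda>i e. t i (case_nat c e)"
  have u: "dterm w (?u i)" for i
    using t[of i] unfolding dterm_def
  proof (elim HOL.disjE HOL.exE)
    fix j assume "t i = (\<lambda>e. e j)"
    then show "(\<exists>j. ?u i = (\<lambda>e. e j)) \<or> (\<exists>c. E w c \<and> ?u i = (\<lambda>e. c))"
      using c by (cases j) auto
  qed auto
  have env: "t i (case_nat x e) = case_nat x (\<lambda>i. ?u i e) (?r i)" for i x e
    using t[of i] by (auto simp: dterm_def split: nat.split)
  have "sem (ren \<Phi> ?r) (case_nat x (\<lambda>i. ?u i e)) = sem \<Phi> (\<lambda>i. t i (case_nat x e))" for e x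
    unfolding sem_ren by (intro arg_cong[of _ _ "sem \<Phi>"] ext) (rule env[symmetric])
  then have "Q e x = sem (ren \<Phi> ?r) (case_nat x (\<lambda>i. ?u i e))" for e x
    using fun_cong[OF Q, of "case_nat x e"] by simp
  then have eq: "(\<lambda>e. \<forall>\<^sub>k x. Q e x) = (\<lambda>e. sem (Forall (ren \<Phi> ?r)) (\<lambda>i. ?u i e))"
    "(\<lambda>e. \<exists>\<^sub>k x. Q e x) = (\<lambda>e. sem (Exists (ren \<Phi> ?r)) (\<lambda>i. ?u i e))"
    by (simp_all add: fun_eq_iff kall_iff)
  show "dfn w (\<lambda>e. \<forall>\<^sub>k x. Q e x)" "dfn w (\<lambda>e. \<exists>\<^sub>k x. Q e x)"
    unfolding eq by (rule dfn_sem[OF u])+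
qed

lemmas dfn_intros = dfn_mem dfn_eq dfn_bot dfn_conj dfn_disj dfn_imp dfn_iff dfn_all dfn_ex
  dterm_var dterm_const

text \<open>Persistence and, in the next lemma, invariance under \<open>\<approx>\<close> hold for
  whatever a formula defines, so set-theoretic notions inherit both from their definability.\<close>

lemma dfn_up: "dfn w Q \<Longrightarrow> Q e u \<Longrightarrow> u \<sqsubseteq> v \<Longrightarrow> Q e v"
  unfolding dfn_def using sem_up by blast

lemma dfn_cong:
  assumes "dfn w Q" "Q e u" "w \<sqsubseteq> u" "\<And>i. e i = e' i \<or> (e i \<approx> e' i) u"
  shows "Q e' u"
proof -
  obtain \<Phi> t where t: "\<And>i. dterm w (t i)" "Q = (\<lambda>e. sem \<Phi> (\<lambda>i. t i e))"
    using assms(1) unfolding dfn_def by blast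
  have "t i e = t i e' \<or> (t i e \<approx> t i e') u" for i
    using t(1)[of i] assms(4) unfolding dterm_def by (elim HOL.disjE HOL.exE) simp_all
  then show ?thesis
    using sem_cong[of \<Phi> "\<lambda>i. t i e" u "\<lambda>i. t i e'"] assms(2) unfolding t(2) by simp
qed

text \<open>Recovers an honest formula and an assignment of existing parameters, the form in which
  an axiom scheme can be instantiated. As before, indices denoting the argument are merged into
  index 0 and a dummy fills the gaps.\<close>

lemma dfn_env1:
  assumes "dfn w (\<lambda>e. Q (e 0))"
  obtains \<Phi> \<sigma> where "\<And>i. E w (\<sigma> i)" "\<And>x. Q x = sem \<Phi> (case_nat x \<sigma>)"
proof -
  obtain \<Phi> t where t: "\<And>i. dterm w (t i)" and Q: "(\<lambda>e. Q (e 0)) = (\<lambda>e. sem \<Phi> (\<lambda>i. t i e))"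
    using assms unfolding dfn_def by blast
  obtain c where c: "E w c" using nonempty by blast
  let ?r = "\<lambda>i. if t i = (\<lambda>e. e 0) then 0 else Suc i"
  let ?s = "\<lambda>i. t i (\<lambda>_. c)"
  have s: "E w (?s i)" for i using t[of i] c by (auto simp: dterm_def)
  have env: "t i (case_nat x (\<lambda>_. c)) = case_nat x ?s (?r i)" for i x
    using t[of i] by (auto simp: dterm_def split: nat.split)
  have "sem (ren \<Phi> ?r) (case_nat x ?s) = sem \<Phi> (\<lambda>i. t i (case_nat x (\<lambda>_. c)))" for x
    unfolding sem_ren by (intro arg_cong[of _ _ "sem \<Phi>"] ext) (rule env[symmetric])
  then have "Q x = sem (ren \<Phi> ?r) (case_nat x ?s)" for x
    using fun_cong[OF Q, of "case_nat x (\<lambda>_. c)"] by simp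
  then show thesis by (rule that[OF s])
qed

lemma dfn_env2:
  assumes "dfn w (\<lambda>e. Q (e 0) (e (Suc 0)))"
  obtains \<Phi> \<sigma> where "\<And>i. E w (\<sigma> i)" "\<And>x y. Q x y = sem \<Phi> (case_nat x (case_nat y \<sigma>))"
proof -
  obtain \<Phi> t where t: "\<And>i. dterm w (t i)" and Q: "(\<lambda>e. Q (e 0) (e (Suc 0))) = (\<lambda>e. sem \<Phi> (\<lambda>i. t i e))"
    using assms unfolding dfn_def by blast
  obtain c where c: "E w c" using nonempty by blast
  let ?r = "\<lambda>i. if t i = (\<lambda>e. e 0) then 0 else if t i = (\<lambda>e. e (Suc 0)) then Suc 0 else Suc (Suc i)"
  let ?s = "\<lambda>i. t i (\<lambda>_. c)"
  have s: "E w (?s i)" for i using t[of i] c by (auto simp: dterm_def)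
  have env: "t i (case_nat x (case_nat y (\<lambda>_. c))) = case_nat x (case_nat y ?s) (?r i)" for i x y
    using t[of i] by (auto simp: dterm_def split: nat.split)
  have "sem (ren \<Phi> ?r) (case_nat x (case_nat y ?s)) = sem \<Phi> (\<lambda>i. t i (case_nat x (case_nat y (\<lambda>_. c))))" for x y
    unfolding sem_ren by (intro arg_cong[of _ _ "sem \<Phi>"] ext) (rule env[symmetric])
  then have "Q x y = sem (ren \<Phi> ?r) (case_nat x (case_nat y ?s))" for x y
    using fun_cong[OF Q, of "case_nat x (case_nat y (\<lambda>_. c))"] by simp
  then show thesis by (rule that[OF s])
qed

subsection \<open>Set-theoretic vocabulary\<close>

definition Sub :: "'a \<Rightarrow> 'a \<Rightarrow> 'w \<Rightarrow> bool" where
  "Sub x y = (\<forall>\<^sub>k z. z \<epsilon> x \<longrightarrow>\<^sub>k z \<epsilon> y)"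

definition Emp :: "'a \<Rightarrow> 'w \<Rightarrow> bool" where
  "Emp x = (\<forall>\<^sub>k z. z \<epsilon> x \<longrightarrow>\<^sub>k kbot)"

definition IsSuc :: "'a \<Rightarrow> 'a \<Rightarrow> 'w \<Rightarrow> bool" where
  "IsSuc y x = (\<forall>\<^sub>k z. z \<epsilon> y \<longleftrightarrow>\<^sub>k z \<epsilon> x \<or>\<^sub>k z \<approx> x)"

definition Omega :: "'a \<Rightarrow> 'w \<Rightarrow> bool" where
  "Omega n = (\<forall>\<^sub>k x. x \<epsilon> n \<longleftrightarrow>\<^sub>k Emp x \<or>\<^sub>k (\<exists>\<^sub>k y. y \<epsilon> n \<and>\<^sub>k IsSuc x y))"

definition Upair :: "'a \<Rightarrow> 'a \<Rightarrow> 'a \<Rightarrow> 'w \<Rightarrow> bool" where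
  "Upair z x y = (\<forall>\<^sub>k u. u \<epsilon> z \<longleftrightarrow>\<^sub>k u \<approx> x \<or>\<^sub>k u \<approx> y)"

definition Pair :: "'a \<Rightarrow> 'a \<Rightarrow> 'a \<Rightarrow> 'w \<Rightarrow> bool" where
  "Pair z x y = (\<forall>\<^sub>k u. u \<epsilon> z \<longleftrightarrow>\<^sub>k Upair u x x \<or>\<^sub>k Upair u x y)"

definition Maps :: "'a \<Rightarrow> 'a \<Rightarrow> 'a \<Rightarrow> 'w \<Rightarrow> bool" where
  "Maps f x y = (\<exists>\<^sub>k p. p \<epsilon> f \<and>\<^sub>k Pair p x y)"

definition Fun :: "'a \<Rightarrow> 'a \<Rightarrow> 'w \<Rightarrow> bool" where
  "Fun f a = ((\<forall>\<^sub>k p. p \<epsilon> f \<longrightarrow>\<^sub>k (\<exists>\<^sub>k x y. x \<epsilon> a \<and>\<^sub>k Pair p x y)) \<and>\<^sub>k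
    (\<forall>\<^sub>k x. x \<epsilon> a \<longrightarrow>\<^sub>k (\<exists>\<^sub>k y. Maps f x y \<and>\<^sub>k (\<forall>\<^sub>k z. Maps f x z \<longrightarrow>\<^sub>k z \<approx> y))))"

definition Fin :: "'a \<Rightarrow> 'w \<Rightarrow> bool" where
  "Fin a = (\<exists>\<^sub>k w n f. Omega w \<and>\<^sub>k n \<epsilon> w \<and>\<^sub>k Fun f n \<and>\<^sub>k
    (\<forall>\<^sub>k y. y \<epsilon> a \<longleftrightarrow>\<^sub>k (\<exists>\<^sub>k x. x \<epsilon> n \<and>\<^sub>k Maps f x y)))"

definition Sing :: "'a \<Rightarrow> 'w \<Rightarrow> bool" where
  "Sing a = (\<exists>\<^sub>k x. Upair a x x)"

definition AnySet :: "'a \<Rightarrow> 'w \<Rightarrow> bool" where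
  "AnySet a = (kbot \<longrightarrow>\<^sub>k kbot)"

definition NoSet :: "'a \<Rightarrow> 'w \<Rightarrow> bool" where
  "NoSet a = kbot"

definition SetGen :: "('a \<Rightarrow> 'w \<Rightarrow> bool) \<Rightarrow> 'w \<Rightarrow> bool" where
  "SetGen M = (\<exists>\<^sub>k G. (\<forall>\<^sub>k b. b \<epsilon> G \<longrightarrow>\<^sub>k M b) \<and>\<^sub>k
    (\<forall>\<^sub>k a. M a \<longrightarrow>\<^sub>k (\<forall>\<^sub>k x. x \<epsilon> a \<longrightarrow>\<^sub>k (\<exists>\<^sub>k b. b \<epsilon> G \<and>\<^sub>k x \<epsilon> b \<and>\<^sub>k Sub b a))))"

definition Rules :: "('a \<Rightarrow> 'w \<Rightarrow> bool) \<Rightarrow> 'a \<Rightarrow> 'a \<Rightarrow> 'w \<Rightarrow> bool" where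
  "Rules C X R = (\<forall>\<^sub>k r. r \<epsilon> R \<longrightarrow>\<^sub>k
    (\<exists>\<^sub>k a b. Pair r a b \<and>\<^sub>k Sub a X \<and>\<^sub>k Sub b X \<and>\<^sub>k C a))"

definition Closed :: "'a \<Rightarrow> 'a \<Rightarrow> 'w \<Rightarrow> bool" where
  "Closed R Y = (\<forall>\<^sub>k r a b. r \<epsilon> R \<and>\<^sub>k Pair r a b \<longrightarrow>\<^sub>k
    Sub a Y \<longrightarrow>\<^sub>k (\<exists>\<^sub>k x. x \<epsilon> b \<and>\<^sub>k x \<epsilon> Y))"

definition KNID :: "('a \<Rightarrow> 'w \<Rightarrow> bool) \<Rightarrow> 'w \<Rightarrow> bool" where
  "KNID C = (\<forall>\<^sub>k X R. Rules C X R \<longrightarrow>\<^sub>k SetGen (\<lambda>Y. Sub Y X \<and>\<^sub>k Closed R Y))"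

definition Letter :: "'a \<Rightarrow> 'a \<Rightarrow> 'w \<Rightarrow> bool" where
  "Letter s p = (\<exists>\<^sub>k t. Emp t \<and>\<^sub>k Pair s t p)"

definition IsOr :: "'a \<Rightarrow> 'a \<Rightarrow> 'w \<Rightarrow> bool" where
  "IsOr s f = (\<exists>\<^sub>k z t. Emp z \<and>\<^sub>k IsSuc t z \<and>\<^sub>k Pair s t f)"

definition IsAnd :: "'a \<Rightarrow> 'a \<Rightarrow> 'w \<Rightarrow> bool" where
  "IsAnd s f = (\<exists>\<^sub>k z u t. Emp z \<and>\<^sub>k IsSuc u z \<and>\<^sub>k IsSuc t u \<and>\<^sub>k Pair s t f)"

definition Family :: "'a \<Rightarrow> 'a \<Rightarrow> 'a \<Rightarrow> 'w \<Rightarrow> bool" where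
  "Family f I S = (Fun f I \<and>\<^sub>k (\<forall>\<^sub>k i x. Maps f i x \<longrightarrow>\<^sub>k x \<epsilon> S))"

definition Shape :: "('a \<Rightarrow> 'w \<Rightarrow> bool) \<Rightarrow> 'a \<Rightarrow> 'a \<Rightarrow> 'a \<Rightarrow> 'w \<Rightarrow> bool" where
  "Shape C P S s = ((\<exists>\<^sub>k p. p \<epsilon> P \<and>\<^sub>k Letter s p) \<or>\<^sub>k
    (\<exists>\<^sub>k f I. IsOr s f \<and>\<^sub>k Family f I S) \<or>\<^sub>k
    (\<exists>\<^sub>k f I. IsAnd s f \<and>\<^sub>k Family f I S \<and>\<^sub>k C I))"

definition Formulas :: "('a \<Rightarrow> 'w \<Rightarrow> bool) \<Rightarrow> 'a \<Rightarrow> 'a \<Rightarrow> 'w \<Rightarrow> bool" where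
  "Formulas C P S = (\<forall>\<^sub>k s. s \<epsilon> S \<longrightarrow>\<^sub>k Shape C P S s)"

definition GameFm :: "('a \<Rightarrow> 'w \<Rightarrow> bool) \<Rightarrow> 'a \<Rightarrow> 'a \<Rightarrow> 'w \<Rightarrow> bool" where
  "GameFm C P s = (\<exists>\<^sub>k S. s \<epsilon> S \<and>\<^sub>k Formulas C P S)"

definition TruthClause :: "'a \<Rightarrow> 'a \<Rightarrow> 'a \<Rightarrow> 'a \<Rightarrow> 'w \<Rightarrow> bool" where
  "TruthClause M S V s =
    ((\<forall>\<^sub>k p. Letter s p \<longrightarrow>\<^sub>k (s \<epsilon> V \<longleftrightarrow>\<^sub>k p \<epsilon> M)) \<and>\<^sub>k
     (\<forall>\<^sub>k f. IsOr s f \<longrightarrow>\<^sub>k (\<forall>\<^sub>k i x. Maps f i x \<longrightarrow>\<^sub>k x \<epsilon> S) \<and>\<^sub>k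
       (s \<epsilon> V \<longleftrightarrow>\<^sub>k (\<exists>\<^sub>k i x. Maps f i x \<and>\<^sub>k x \<epsilon> V))) \<and>\<^sub>k
     (\<forall>\<^sub>k f. IsAnd s f \<longrightarrow>\<^sub>k (\<forall>\<^sub>k i x. Maps f i x \<longrightarrow>\<^sub>k x \<epsilon> S) \<and>\<^sub>k
       (s \<epsilon> V \<longleftrightarrow>\<^sub>k (\<forall>\<^sub>k i x. Maps f i x \<longrightarrow>\<^sub>k x \<epsilon> V))))"

definition Truth :: "'a \<Rightarrow> 'a \<Rightarrow> 'a \<Rightarrow> 'w \<Rightarrow> bool" where
  "Truth M S V = (Sub V S \<and>\<^sub>k (\<forall>\<^sub>k s. s \<epsilon> S \<longrightarrow>\<^sub>k TruthClause M S V s))"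

definition Satis :: "'a \<Rightarrow> 'a \<Rightarrow> 'w \<Rightarrow> bool" where
  "Satis M s = (\<exists>\<^sub>k S V. Truth M S V \<and>\<^sub>k s \<epsilon> V)"

definition GameTh :: "('a \<Rightarrow> 'w \<Rightarrow> bool) \<Rightarrow> 'a \<Rightarrow> 'a \<Rightarrow> 'w \<Rightarrow> bool" where
  "GameTh C P T = (\<forall>\<^sub>k t. t \<epsilon> T \<longrightarrow>\<^sub>k
    (\<exists>\<^sub>k r s. Pair t r s \<and>\<^sub>k GameFm C P r \<and>\<^sub>k GameFm AnySet P s))"

definition Model :: "'a \<Rightarrow> 'a \<Rightarrow> 'a \<Rightarrow> 'w \<Rightarrow> bool" where
  "Model P T M = (Sub M P \<and>\<^sub>k (\<forall>\<^sub>k t r s. t \<epsilon> T \<and>\<^sub>k Pair t r s \<longrightarrow>\<^sub>k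
    Satis M r \<longrightarrow>\<^sub>k Satis M s))"

lemma ev_first_order [simp]:
  "x < n \<Longrightarrow> y < n \<Longrightarrow> ev (x \<^bold>\<subseteq> y) n \<rho> \<sigma> = Sub (\<rho> x) (\<rho> y)"
  "x < n \<Longrightarrow> ev (is_empty x) n \<rho> \<sigma> = Emp (\<rho> x)"
  "x < n \<Longrightarrow> y < n \<Longrightarrow> ev (is_succ x y) n \<rho> \<sigma> = IsSuc (\<rho> x) (\<rho> y)"
  "x < n \<Longrightarrow> y < n \<Longrightarrow> z < n \<Longrightarrow> ev (is_upair x y z) n \<rho> \<sigma> = Upair (\<rho> x) (\<rho> y) (\<rho> z)"
  by (simp_all add: subset_def Sub_def is_empty_def Emp_def is_succ_def IsSuc_def is_upair_def Upair_def)

lemma ev_omega [simp]: "x < n \<Longrightarrow> ev (is_omega x) n \<rho> \<sigma> = Omega (\<rho> x)"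
  by (simp add: is_omega_def Omega_def)

lemma ev_pair [simp]:
  "x < n \<Longrightarrow> y < n \<Longrightarrow> z < n \<Longrightarrow> ev (is_pair x y z) n \<rho> \<sigma> = Pair (\<rho> x) (\<rho> y) (\<rho> z)"
  by (simp add: is_pair_def Pair_def)

lemma ev_maps [simp]:
  "x < n \<Longrightarrow> y < n \<Longrightarrow> z < n \<Longrightarrow> ev (maps_to x y z) n \<rho> \<sigma> = Maps (\<rho> x) (\<rho> y) (\<rho> z)"
  by (simp add: maps_to_def Maps_def)

lemma ev_fun [simp]: "x < n \<Longrightarrow> y < n \<Longrightarrow> ev (function_on x y) n \<rho> \<sigma> = Fun (\<rho> x) (\<rho> y)"
  by (simp add: function_on_def Fun_def)

lemma ev_conditions [simp]:
  "x < n \<Longrightarrow> ev (is_finite x) n \<rho> \<sigma> = Fin (\<rho> x)"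
  "x < n \<Longrightarrow> ev (is_singleton x) n \<rho> \<sigma> = Sing (\<rho> x)"
  "x < n \<Longrightarrow> ev (any_set x) n \<rho> \<sigma> = AnySet (\<rho> x)"
  "x < n \<Longrightarrow> ev (no_set x) n \<rho> \<sigma> = NoSet (\<rho> x)"
  by (simp_all add: is_finite_def Fin_def is_singleton_def Sing_def any_set_def AnySet_def no_set_def NoSet_def)

lemma ev_shapes [simp]:
  "x < n \<Longrightarrow> y < n \<Longrightarrow> ev (is_letter x y) n \<rho> \<sigma> = Letter (\<rho> x) (\<rho> y)"
  "x < n \<Longrightarrow> y < n \<Longrightarrow> ev (is_Or x y) n \<rho> \<sigma> = IsOr (\<rho> x) (\<rho> y)"
  "x < n \<Longrightarrow> y < n \<Longrightarrow> ev (is_And x y) n \<rho> \<sigma> = IsAnd (\<rho> x) (\<rho> y)"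
  "x < n \<Longrightarrow> y < n \<Longrightarrow> z < n \<Longrightarrow> ev (family_in x y z) n \<rho> \<sigma> = Family (\<rho> x) (\<rho> y) (\<rho> z)"
  by (simp_all add: is_letter_def Letter_def is_Or_def IsOr_def is_And_def IsAnd_def family_in_def Family_def)

lemma ev_satisfies [simp]:
  "x < n \<Longrightarrow> y < n \<Longrightarrow> z < n \<Longrightarrow> ev (truth_set x y z) n \<rho> \<sigma> = Truth (\<rho> x) (\<rho> y) (\<rho> z)"
  "x < n \<Longrightarrow> y < n \<Longrightarrow> ev (satisfies x y) n \<rho> \<sigma> = Satis (\<rho> x) (\<rho> y)"
  by (simp_all add: truth_set_def Truth_def TruthClause_def satisfies_def Satis_def)

lemma ev_model [simp]:
  "x < n \<Longrightarrow> y < n \<Longrightarrow> z < n \<Longrightarrow> ev (is_model x y z) n \<rho> \<sigma> = Model (\<rho> x) (\<rho> y) (\<rho> z)"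
  by (simp add: is_model_def Model_def)

lemma ev_game_theory:
  assumes C: "\<And>m a \<rho>. a < m \<Longrightarrow> ev (C a) m \<rho> \<sigma> = D (\<rho> a)"
    and "x < n" "y < n"
  shows "ev (game_theory C x y) n \<rho> \<sigma> = GameTh D (\<rho> x) (\<rho> y)"
  using assms
  by (simp add: game_theory_def GameTh_def game_formula_def GameFm_def Formulas_def Shape_def)

text \<open>\<open>M\<close> may mention outer variables, whose levels lie below \<open>n\<close>.
  The quantifiers inside overwrite only levels from \<open>n\<close> on, so agreement below
  \<open>n\<close> is what the evaluation of \<open>M\<close> can rely on.\<close>

lemma ev_set_generated:
  assumes "\<And>m a \<rho>'. n \<le> m \<Longrightarrow> a < m \<Longrightarrow> (\<And>i. i < n \<Longrightarrow> \<rho>' i = \<rho> i) \<Longrightarrow> ev (M a) m \<rho>' \<sigma> = N (\<rho>' a)"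
  shows "ev (set_generated M) n \<rho> \<sigma> = SetGen N"
  using assms by (simp add: set_generated_def SetGen_def)

lemma ev_NID:
  assumes C: "\<And>m a \<rho>. a < m \<Longrightarrow> ev (C a) m \<rho> \<sigma> = D (\<rho> a)"
  shows "ev (NID C) n \<rho> \<sigma> = KNID D"
proof -
  have "ev (set_generated (\<lambda>Y. Y \<^bold>\<subseteq> n \<^bold>\<and> closed_under (Suc n) Y)) (Suc (Suc n)) (\<rho>(n := X, Suc n := R)) \<sigma> =
    SetGen (\<lambda>Y. Sub Y X \<and>\<^sub>k Closed R Y)" for X R
    by (rule ev_set_generated) (simp add: closed_under_def Closed_def)
  then show ?thesis
    by (simp add: NID_def KNID_def rules_on_def Rules_def C)
qed

lemma ev_main:
  assumes "\<And>m a \<rho>. a < m \<Longrightarrow> ev (C a) m \<rho> \<sigma> = D (\<rho> a)" "\<And>m a \<rho>. a < m \<Longrightarrow> ev (C' a) m \<rho> \<sigma> = D' (\<rho> a)"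
  shows "ev (NID C \<^bold>\<longrightarrow> (\<^bold>\<forall>P T. game_theory C' P T \<^bold>\<longrightarrow> set_generated (is_model P T))) 0 \<rho> \<sigma> =
    (KNID D \<longrightarrow>\<^sub>k (\<forall>\<^sub>k P T. GameTh D' P T \<longrightarrow>\<^sub>k SetGen (Model P T)))"
proof -
  have "ev (set_generated (is_model 0 (Suc 0))) (Suc (Suc 0)) (\<rho>(0 := P, Suc 0 := T)) \<sigma> = SetGen (Model P T)" for P T
    by (rule ev_set_generated) simp
  then show ?thesis using assms by (simp add: ev_NID ev_game_theory)
qed

end

section \<open>Basic set theory in a Kripke model of CZF\<close>

context kripke
begin

lemma Sub_iff: "Sub x y w \<longleftrightarrow> (\<forall>v z. w \<sqsubseteq> v \<longrightarrow> (z \<epsilon> x) v \<longrightarrow> (z \<epsilon> y) v)"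
  unfolding Sub_def kall_kimp using mm_E by blast

lemma Emp_iff: "Emp x w \<longleftrightarrow> (\<forall>v z. w \<sqsubseteq> v \<longrightarrow> \<not> (z \<epsilon> x) v)"
  unfolding Emp_def kall_kimp k_simps using mm_E by blast

lemma IsSuc_iff: "IsSuc y x w \<longleftrightarrow> (\<forall>v z. w \<sqsubseteq> v \<longrightarrow> ((z \<epsilon> y) v \<longleftrightarrow> (z \<epsilon> x) v \<or> (z \<approx> x) v))"
  unfolding IsSuc_def kall_kiff k_simps using mm_E qq_E by blast

lemma Upair_iff: "Upair z x y w \<longleftrightarrow> (\<forall>v u. w \<sqsubseteq> v \<longrightarrow> ((u \<epsilon> z) v \<longleftrightarrow> (u \<approx> x) v \<or> (u \<approx> y) v))"
  unfolding Upair_def kall_kiff k_simps using mm_E qq_E by blast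

lemma Pair_iff: "Pair z x y w \<longleftrightarrow>
    (\<forall>v u. w \<sqsubseteq> v \<longrightarrow> E v u \<longrightarrow> ((u \<epsilon> z) v \<longleftrightarrow> Upair u x x v \<or> Upair u x y v))"
  unfolding Pair_def kall_kiff k_simps by blast

lemma Maps_iff: "Maps f x y w \<longleftrightarrow> (\<exists>p. (p \<epsilon> f) w \<and> Pair p x y w)"
  unfolding Maps_def using mm_E by auto

lemma Fun_iff: "Fun f a w \<longleftrightarrow>
    (\<forall>v p. w \<sqsubseteq> v \<longrightarrow> (p \<epsilon> f) v \<longrightarrow> (\<exists>x y. E v y \<and> (x \<epsilon> a) v \<and> Pair p x y v)) \<and>
    (\<forall>v x. w \<sqsubseteq> v \<longrightarrow> (x \<epsilon> a) v \<longrightarrow> (\<exists>y. E v y \<and> Maps f x y v \<and>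
      (\<forall>u z. v \<sqsubseteq> u \<longrightarrow> E u z \<longrightarrow> Maps f x z u \<longrightarrow> (z \<approx> y) u)))"
  unfolding Fun_def k_simps kall_kimp using mm_E by meson

section \<open>Definability, invariance and persistence of the set-theoretic notions\<close>

lemma dfn_vocabulary:
  assumes "dterm w t" "dterm w u"
  shows "dfn w (\<lambda>e. Sub (t e) (u e))" "dfn w (\<lambda>e. Emp (t e))" "dfn w (\<lambda>e. IsSuc (t e) (u e))"
  unfolding Sub_def Emp_def IsSuc_def by (intro dfn_intros dterm_shift assms)+

lemma dfn_Upair: "dterm w r \<Longrightarrow> dterm w t \<Longrightarrow> dterm w u \<Longrightarrow> dfn w (\<lambda>e. Upair (r e) (t e) (u e))"
  unfolding Upair_def by (intro dfn_intros dterm_shift)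

lemma dfn_Pair: "dterm w r \<Longrightarrow> dterm w t \<Longrightarrow> dterm w u \<Longrightarrow> dfn w (\<lambda>e. Pair (r e) (t e) (u e))"
  unfolding Pair_def by (intro dfn_intros dfn_Upair dterm_shift)

lemma dfn_Maps: "dterm w r \<Longrightarrow> dterm w t \<Longrightarrow> dterm w u \<Longrightarrow> dfn w (\<lambda>e. Maps (r e) (t e) (u e))"
  unfolding Maps_def by (intro dfn_intros dfn_Pair dterm_shift)

lemma dfn_Fun: "dterm w t \<Longrightarrow> dterm w u \<Longrightarrow> dfn w (\<lambda>e. Fun (t e) (u e))"
  unfolding Fun_def by (intro dfn_intros dfn_Pair dfn_Maps dterm_shift)

lemma dfn_Omega: "dterm w t \<Longrightarrow> dfn w (\<lambda>e. Omega (t e))"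
  unfolding Omega_def by (intro dfn_intros dfn_vocabulary dterm_shift)

lemma dfn_cond:
  assumes "dterm w t"
  shows "dfn w (\<lambda>e. AnySet (t e))" "dfn w (\<lambda>e. NoSet (t e))" "dfn w (\<lambda>e. Fin (t e))"  "dfn w (\<lambda>e. Sing (t e))"
  unfolding AnySet_def NoSet_def Fin_def Sing_def 
  by (intro dfn_intros dfn_vocabulary dfn_Upair dfn_Omega dfn_Fun dfn_Maps dterm_shift assms)+

lemma dfn_Letter: "dterm w t \<Longrightarrow> dterm w u \<Longrightarrow> dfn w (\<lambda>e. Letter (t e) (u e))"
  unfolding Letter_def by (intro dfn_intros dfn_Pair dfn_vocabulary dterm_shift)

lemma dfn_IsOr: "dterm w t \<Longrightarrow> dterm w u \<Longrightarrow> dfn w (\<lambda>e. IsOr (t e) (u e))"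
  unfolding IsOr_def by (intro dfn_intros dfn_Pair dfn_vocabulary dterm_shift)

lemma dfn_IsAnd: "dterm w t \<Longrightarrow> dterm w u \<Longrightarrow> dfn w (\<lambda>e. IsAnd (t e) (u e))"
  unfolding IsAnd_def by (intro dfn_intros dfn_Pair dfn_vocabulary dterm_shift)

lemma dfn_Family: "dterm w r \<Longrightarrow> dterm w t \<Longrightarrow> dterm w u \<Longrightarrow> dfn w (\<lambda>e. Family (r e) (t e) (u e))"
  unfolding Family_def by (intro dfn_intros dfn_Maps dfn_Fun dterm_shift)

lemma dfn_TruthClause:
  assumes "dterm w t" "dterm w u" "dterm w r" "dterm w s"
  shows "dfn w (\<lambda>e. TruthClause (t e) (u e) (r e) (s e))"
  unfolding TruthClause_def by (intro dfn_intros dfn_Maps dfn_Letter dfn_IsOr dfn_IsAnd dterm_shift assms)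

lemma dfn_Truth: "dterm w r \<Longrightarrow> dterm w t \<Longrightarrow> dterm w u \<Longrightarrow> dfn w (\<lambda>e. Truth (r e) (t e) (u e))"
  unfolding Truth_def by (intro dfn_intros dfn_vocabulary dfn_TruthClause dterm_shift)

lemma dfn_Satis: "dterm w t \<Longrightarrow> dterm w u \<Longrightarrow> dfn w (\<lambda>e. Satis (t e) (u e))"
  unfolding Satis_def by (intro dfn_intros dfn_Truth dterm_shift)

lemma dfn_Model: "dterm w r \<Longrightarrow> dterm w t \<Longrightarrow> dterm w u \<Longrightarrow> dfn w (\<lambda>e. Model (r e) (t e) (u e))"
  unfolding Model_def by (intro dfn_intros dfn_vocabulary dfn_Pair dfn_Satis dterm_shift)

lemma dfn_Closed: "dterm w t \<Longrightarrow> dterm w u \<Longrightarrow> dfn w (\<lambda>e. Closed (t e) (u e))"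
  unfolding Closed_def by (intro dfn_intros dfn_vocabulary dfn_Pair dterm_shift)

lemma dfn_Shape:
  assumes "\<And>t. dterm w t \<Longrightarrow> dfn w (\<lambda>e. C (t e))" "dterm w r" "dterm w t" "dterm w u"
  shows "dfn w (\<lambda>e. Shape C (r e) (t e) (u e))"
  unfolding Shape_def by (intro dfn_intros dfn_Letter dfn_IsOr dfn_IsAnd dfn_Family dterm_shift assms)

lemma dfn_Formulas:
  assumes "\<And>t. dterm w t \<Longrightarrow> dfn w (\<lambda>e. C (t e))" "dterm w t" "dterm w u"
  shows "dfn w (\<lambda>e. Formulas C (t e) (u e))"
  unfolding Formulas_def by (intro dfn_intros dfn_Shape dterm_shift assms)

lemma up2: "dfn w (\<lambda>e. P (e 0) (e (Suc 0))) \<Longrightarrow> u \<sqsubseteq> v \<Longrightarrow> P x y u \<Longrightarrow> P x y v"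
  using dfn_up[of w "\<lambda>e. P (e 0) (e (Suc 0))" "case_nat x (\<lambda>_. y)" u v] by simp

lemma up3: "dfn w (\<lambda>e. P (e 0) (e (Suc 0)) (e (Suc (Suc 0)))) \<Longrightarrow> u \<sqsubseteq> v \<Longrightarrow> P x y z u \<Longrightarrow> P x y z v"
  using dfn_up[of w "\<lambda>e. P (e 0) (e (Suc 0)) (e (Suc (Suc 0)))" "case_nat x (case_nat y (\<lambda>_. z))" u v] by simp

lemma cong2:
  assumes "dfn w (\<lambda>e. P (e 0) (e (Suc 0)))" "w \<sqsubseteq> u" "P x y u" "(x \<approx> x') u" "(y \<approx> y') u"
  shows "P x' y' u"
  using dfn_cong[OF assms(1), of "case_nat x (\<lambda>_. y)" u "case_nat x' (\<lambda>_. y')"] assms(2-)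
  by (simp split: nat.split)

lemma cong3:
  assumes "dfn w (\<lambda>e. P (e 0) (e (Suc 0)) (e (Suc (Suc 0))))" "w \<sqsubseteq> u" "P x y z u"
    "(x \<approx> x') u" "(y \<approx> y') u" "(z \<approx> z') u"
  shows "P x' y' z' u"
  using dfn_cong[OF assms(1), of "case_nat x (case_nat y (\<lambda>_. z))" u "case_nat x' (case_nat y' (\<lambda>_. z'))"] assms(2-)
  by (simp split: nat.split)

lemma Upair_cong: "Upair x y z u \<Longrightarrow> (x \<approx> x') u \<Longrightarrow> (y \<approx> y') u \<Longrightarrow> (z \<approx> z') u \<Longrightarrow> Upair x' y' z' u"
  by (rule cong3[of u Upair, OF dfn_Upair[OF dterm_var dterm_var dterm_var] le_refl])

lemma Pair_cong: "Pair x y z u \<Longrightarrow> (x \<approx> x') u \<Longrightarrow> (y \<approx> y') u \<Longrightarrow> (z \<approx> z') u \<Longrightarrow> Pair x' y' z' u"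
  by (rule cong3[of u Pair, OF dfn_Pair[OF dterm_var dterm_var dterm_var] le_refl])

lemma Maps_cong: "Maps x y z u \<Longrightarrow> (x \<approx> x') u \<Longrightarrow> (y \<approx> y') u \<Longrightarrow> (z \<approx> z') u \<Longrightarrow> Maps x' y' z' u"
  by (rule cong3[of u Maps, OF dfn_Maps[OF dterm_var dterm_var dterm_var] le_refl])

lemma Letter_cong: "Letter x y u \<Longrightarrow> (x \<approx> x') u \<Longrightarrow> (y \<approx> y') u \<Longrightarrow> Letter x' y' u"
  by (rule cong2[of u Letter, OF dfn_Letter[OF dterm_var dterm_var] le_refl])

lemma IsOr_cong: "IsOr x y u \<Longrightarrow> (x \<approx> x') u \<Longrightarrow> (y \<approx> y') u \<Longrightarrow> IsOr x' y' u"
  by (rule cong2[of u IsOr, OF dfn_IsOr[OF dterm_var dterm_var] le_refl])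

lemma IsAnd_cong: "IsAnd x y u \<Longrightarrow> (x \<approx> x') u \<Longrightarrow> (y \<approx> y') u \<Longrightarrow> IsAnd x' y' u"
  by (rule cong2[of u IsAnd, OF dfn_IsAnd[OF dterm_var dterm_var] le_refl])

lemma
  assumes "w \<sqsubseteq> v"
  shows Sub_up: "Sub x y w \<Longrightarrow> Sub x y v"
    and Emp_up: "Emp x w \<Longrightarrow> Emp x v"
    and IsSuc_up: "IsSuc x y w \<Longrightarrow> IsSuc x y v"
    and Upair_up: "Upair x y z w \<Longrightarrow> Upair x y z v"
    and Pair_up: "Pair x y z w \<Longrightarrow> Pair x y z v"
    and Closed_up: "Closed x y w \<Longrightarrow> Closed x y v"
    and Formulas_up: "Formulas C x y w \<Longrightarrow> Formulas C x y v"
  using assms unfolding Sub_def Emp_def IsSuc_def Upair_def Pair_def Closed_def Formulas_def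
  by (blast intro: kall_up)+

lemma Maps_up: "w \<sqsubseteq> v \<Longrightarrow> Maps x y z w \<Longrightarrow> Maps x y z v"
  by (rule up3[of w Maps, OF dfn_Maps[OF dterm_var dterm_var dterm_var]])

lemma Fun_up: "w \<sqsubseteq> v \<Longrightarrow> Fun x y w \<Longrightarrow> Fun x y v"
  by (rule up2[of w Fun, OF dfn_Fun[OF dterm_var dterm_var]])

lemma Letter_up: "w \<sqsubseteq> v \<Longrightarrow> Letter x y w \<Longrightarrow> Letter x y v"
  by (rule up2[of w Letter, OF dfn_Letter[OF dterm_var dterm_var]])

lemma IsOr_up: "w \<sqsubseteq> v \<Longrightarrow> IsOr x y w \<Longrightarrow> IsOr x y v"
  by (rule up2[of w IsOr, OF dfn_IsOr[OF dterm_var dterm_var]])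

lemma IsAnd_up: "w \<sqsubseteq> v \<Longrightarrow> IsAnd x y w \<Longrightarrow> IsAnd x y v"
  by (rule up2[of w IsAnd, OF dfn_IsAnd[OF dterm_var dterm_var]])

lemma Truth_up: "w \<sqsubseteq> v \<Longrightarrow> Truth x y z w \<Longrightarrow> Truth x y z v"
  by (rule up3[of w Truth, OF dfn_Truth[OF dterm_var dterm_var dterm_var]])

lemma Model_up: "w \<sqsubseteq> v \<Longrightarrow> Model x y z w \<Longrightarrow> Model x y z v"
  by (rule up3[of w Model, OF dfn_Model[OF dterm_var dterm_var dterm_var]])

end

section \<open>The axioms of CZF read at a world\<close>

locale czf = kripke +
  assumes CZF: "A \<in> CZF \<Longrightarrow> (\<And>i. E w (e i)) \<Longrightarrow> sem A e w"
begin

text \<open>A closed axiom has no parameters, yet the environment has to consist of existing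
  individuals; one of them is repeated throughout.\<close>

lemma closed_axiom: "F 0 \<in> CZF \<Longrightarrow> ev F 0 \<rho> (\<lambda>_. SOME c. E w c) w"
  unfolding ev_zero[symmetric] using CZF nonempty by (simp add: someI_ex)

lemma extensionality:
  assumes "E w a" "E w b" "\<And>v x. w \<sqsubseteq> v \<Longrightarrow> (x \<epsilon> a) v = (x \<epsilon> b) v"
  shows "(a \<approx> b) w"
proof -
  have "ev extensionality 0 undefined (\<lambda>_. SOME c. E w c) w"
    by (rule closed_axiom) (simp add: CZF_def)
  then show ?thesis
    using assms by (simp add: extensionality_def kall2_kimp kall_kiff)
qed

lemma pairing: "E w a \<Longrightarrow> E w b \<Longrightarrow> \<exists>c. E w c \<and> Upair c a b w"
proof -
  have "ev Defs.pairing 0 undefined (\<lambda>_. SOME c. E w c) w"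
    by (rule closed_axiom) (simp add: CZF_def)
  then have "(\<forall>\<^sub>k a b. \<exists>\<^sub>k c. Upair c a b) w" by (simp add: pairing_def Upair_def)
  from kallD[OF kallD[OF this]] show "E w a \<Longrightarrow> E w b \<Longrightarrow> ?thesis" by simp
qed

lemma union:
  assumes "E w a" obtains c where "E w c" "\<And>v x. w \<sqsubseteq> v \<Longrightarrow> (x \<epsilon> c) v \<longleftrightarrow> (\<exists>y. (y \<epsilon> a) v \<and> (x \<epsilon> y) v)"
proof -
  have "ev Defs.union 0 undefined (\<lambda>_. SOME c. E w c) w"
    by (rule closed_axiom) (simp add: CZF_def)
  then have "(\<forall>\<^sub>k a. \<exists>\<^sub>k c. \<forall>\<^sub>k x. x \<epsilon> c \<longleftrightarrow>\<^sub>k (\<exists>\<^sub>k y. y \<epsilon> a \<and>\<^sub>k x \<epsilon> y)) w" by (simp add: union_def)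
  from kallD[OF this assms] obtain c where "E w c"
    "(\<forall>\<^sub>k x. x \<epsilon> c \<longleftrightarrow>\<^sub>k (\<exists>\<^sub>k y. y \<epsilon> a \<and>\<^sub>k x \<epsilon> y)) w" by auto
  then show thesis using that[of c] mm_E unfolding kall_kiff k_simps by meson
qed

lemma infinity: "\<exists>n. E w n \<and> Omega n w"
proof -
  have "ev Defs.infinity 0 undefined (\<lambda>_. SOME c. E w c) w"
    by (rule closed_axiom) (simp add: CZF_def)
  then show ?thesis by (simp add: infinity_def)
qed

lemma separation:
  assumes "bounded \<Phi>" "\<And>i. E w (\<sigma> i)" "E w a"
  shows "\<exists>b. E w b \<and> (\<forall>v x. w \<sqsubseteq> v \<longrightarrow> ((x \<epsilon> b) v \<longleftrightarrow> (x \<epsilon> a) v \<and> sem \<Phi> (case_nat x \<sigma>) v))"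
proof -
  have "sem (Defs.separation \<Phi> 0) \<sigma> w"
    using assms by (intro CZF) (auto simp: CZF_def)
  then have "ev (Defs.separation \<Phi>) 0 undefined \<sigma> w" by (simp add: ev_def)
  then have "(\<forall>\<^sub>k a. \<exists>\<^sub>k b. \<forall>\<^sub>k x. x \<epsilon> b \<longleftrightarrow>\<^sub>k x \<epsilon> a \<and>\<^sub>k sem \<Phi> (case_nat x \<sigma>)) w"
    by (simp add: separation_def ev_papp1)
  from kallD[OF this assms(3)] obtain b where "E w b"
    "(\<forall>\<^sub>k x. x \<epsilon> b \<longleftrightarrow>\<^sub>k x \<epsilon> a \<and>\<^sub>k sem \<Phi> (case_nat x \<sigma>)) w" by auto
  then show ?thesis using mm_E unfolding kall_kiff k_simps by meson
qed

text \<open>Both halves of strong collection are kept: the second ensures that a union over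
  \<open>b\<close> contains nothing but what the values contribute.\<close>

lemma collection:
  assumes "dfn w (\<lambda>e. Q (e 0) (e (Suc 0)))" "E w a"
    and total: "\<forall>v x. w \<sqsubseteq> v \<longrightarrow> (x \<epsilon> a) v \<longrightarrow> (\<exists>y. E v y \<and> Q x y v)"
  shows "\<exists>b. E w b \<and>
    (\<forall>v x. w \<sqsubseteq> v \<longrightarrow> (x \<epsilon> a) v \<longrightarrow> (\<exists>y. (y \<epsilon> b) v \<and> Q x y v)) \<and>
    (\<forall>v y. w \<sqsubseteq> v \<longrightarrow> (y \<epsilon> b) v \<longrightarrow> (\<exists>x. (x \<epsilon> a) v \<and> Q x y v))"
proof -
  obtain \<Phi> \<sigma> where \<sigma>: "\<And>i. E w (\<sigma> i)" and Q: "\<And>x y. Q x y = sem \<Phi> (case_nat x (case_nat y \<sigma>))"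
    by (rule dfn_env2[of w Q, OF assms(1)]) (rule that)
  have "sem (strong_collection \<Phi> 0) \<sigma> w"
    using \<sigma> by (intro CZF) (auto simp: CZF_def)
  then have "ev (strong_collection \<Phi>) 0 undefined \<sigma> w" by (simp add: ev_def)
  then have "(\<forall>\<^sub>k a. (\<forall>\<^sub>k x. x \<epsilon> a \<longrightarrow>\<^sub>k (\<exists>\<^sub>k y. Q x y)) \<longrightarrow>\<^sub>k (\<exists>\<^sub>k b. (\<forall>\<^sub>k x. x \<epsilon> a \<longrightarrow>\<^sub>k (\<exists>\<^sub>k y. y \<epsilon> b \<and>\<^sub>k Q x y)) \<and>\<^sub>k
      (\<forall>\<^sub>k y. y \<epsilon> b \<longrightarrow>\<^sub>k (\<exists>\<^sub>k x. x \<epsilon> a \<and>\<^sub>k Q x y)))) w"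
    by (simp add: strong_collection_def ev_papp2 Q)
  from kallD[OF this assms(2)]
  have *: "((\<forall>\<^sub>k x. x \<epsilon> a \<longrightarrow>\<^sub>k (\<exists>\<^sub>k y. Q x y)) \<longrightarrow>\<^sub>k (\<exists>\<^sub>k b. (\<forall>\<^sub>k x. x \<epsilon> a \<longrightarrow>\<^sub>k (\<exists>\<^sub>k y. y \<epsilon> b \<and>\<^sub>k Q x y)) \<and>\<^sub>k
      (\<forall>\<^sub>k y. y \<epsilon> b \<longrightarrow>\<^sub>k (\<exists>\<^sub>k x. x \<epsilon> a \<and>\<^sub>k Q x y)))) w" .
  have "(\<forall>\<^sub>k x. x \<epsilon> a \<longrightarrow>\<^sub>k (\<exists>\<^sub>k y. Q x y)) w"
    unfolding kall_kimp k_simps using total by blast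
  from kimpD[OF * this] obtain b where b: "E w b"
    "\<forall>v x. w \<sqsubseteq> v \<longrightarrow> E v x \<longrightarrow> (x \<epsilon> a) v \<longrightarrow> (\<exists>y. E v y \<and> (y \<epsilon> b) v \<and> Q x y v)"
    "\<forall>v y. w \<sqsubseteq> v \<longrightarrow> E v y \<longrightarrow> (y \<epsilon> b) v \<longrightarrow> (\<exists>x. E v x \<and> (x \<epsilon> a) v \<and> Q x y v)"
    unfolding kall_kimp k_simps by blast
  then show ?thesis using mm_E by blast
qed

lemma set_induction:
  assumes "dfn w (\<lambda>e. Q (e 0))"
    and step: "\<And>v a. w \<sqsubseteq> v \<Longrightarrow> E v a \<Longrightarrow> (\<And>u x. v \<sqsubseteq> u \<Longrightarrow> (x \<epsilon> a) u \<Longrightarrow> Q x u) \<Longrightarrow> Q a v"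
    and "w \<sqsubseteq> v" "E v a"
  shows "Q a v"
proof -
  obtain \<Phi> \<sigma> where \<sigma>: "\<And>i. E w (\<sigma> i)" and Q: "\<And>x. Q x = sem \<Phi> (case_nat x \<sigma>)"
    by (rule dfn_env1[of w Q, OF assms(1)]) (rule that)
  have "sem (Defs.set_induction \<Phi> 0) \<sigma> w"
    using \<sigma> by (intro CZF) (auto simp: CZF_def)
  then have "ev (Defs.set_induction \<Phi>) 0 undefined \<sigma> w" by (simp add: ev_def)
  then have "((\<forall>\<^sub>k a. (\<forall>\<^sub>k x. x \<epsilon> a \<longrightarrow>\<^sub>k Q x) \<longrightarrow>\<^sub>k Q a) \<longrightarrow>\<^sub>k (\<forall>\<^sub>k a. Q a)) w"
    by (simp add: set_induction_def ev_papp1 Q)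
  moreover have "(\<forall>\<^sub>k a. (\<forall>\<^sub>k x. x \<epsilon> a \<longrightarrow>\<^sub>k Q x) \<longrightarrow>\<^sub>k Q a) w"
    unfolding kall_kimp using step mm_E by blast
  ultimately have "(\<forall>\<^sub>k a. Q a) w" by (rule kimpD)
  from kallD[OF kall_up[OF this assms(3)] assms(4)] show ?thesis .
qed

end

context kripke
begin

lemma dfn_subst:
  assumes "dfn w (\<lambda>e. Q (e 0) (e (Suc 0)))" "dterm w t" "dterm w u"
  shows "dfn w (\<lambda>e. Q (t e) (u e))"
proof -
  obtain \<Phi> r where r: "\<And>i. dterm w (r i)" and Q: "(\<lambda>e. Q (e 0) (e (Suc 0))) = (\<lambda>e. sem \<Phi> (\<lambda>i. r i e))"
    using assms(1) unfolding dfn_def by blast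
  have "dterm w (\<lambda>e. r i (case_nat (t e) (\<lambda>_. u e)))" for i
    using r[of i] unfolding dterm_def[of w "r i"]
  proof (elim HOL.disjE HOL.exE HOL.conjE)
    fix j assume "r i = (\<lambda>e. e j)"
    then show ?thesis using assms(2,3) by (cases j) auto
  qed (simp add: dterm_const)
  then have "dfn w (\<lambda>e. sem \<Phi> (\<lambda>i. (\<lambda>e. r i (case_nat (t e) (\<lambda>_. u e))) e))" by (rule dfn_sem)
  moreover have "Q (t e) (u e) = sem \<Phi> (\<lambda>i. r i (case_nat (t e) (\<lambda>_. u e)))" for e
    using fun_cong[OF Q, of "case_nat (t e) (\<lambda>_. u e)"] by simp
  ultimately show ?thesis by simp
qed

end

context czf
begin

section \<open>Ordered pairs, ranges and functions\<close>

lemma Upair_unique: "E w z \<Longrightarrow> E w z' \<Longrightarrow> Upair z x y w \<Longrightarrow> Upair z' x y w \<Longrightarrow> (z \<approx> z') w"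
  by (rule extensionality) (simp_all add: Upair_iff)

lemma Pair_unique: "E w z \<Longrightarrow> E w z' \<Longrightarrow> Pair z x y w \<Longrightarrow> Pair z' x y w \<Longrightarrow> (z \<approx> z') w"
  unfolding Pair_iff by (rule extensionality) (use mm_E in blast)+

lemma Upair_eq_iff:
  assumes "E w c" "E w u" "E w x" "E w y" "Upair c x y w"
  shows "(u \<approx> c) w \<longleftrightarrow> Upair u x y w"
  using Upair_unique[OF assms(2,1) _ assms(5)]
    Upair_cong[OF assms(5) qq_sym qq_refl[OF assms(3)] qq_refl[OF assms(4)]] by blast

lemma pair_exists:
  assumes "E w x" "E w y"
  obtains p where "E w p" "Pair p x y w"
proof -
  obtain c d where c: "E w c" "Upair c x x w" and d: "E w d" "Upair d x y w" 
    using pairing[OF assms(1,1)] pairing[OF assms] by blast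
  obtain p where p: "E w p" "Upair p c d w" using pairing[OF c(1) d(1)] by blast
  have "(u \<epsilon> p) v \<longleftrightarrow> Upair u x x v \<or> Upair u x y v" if v: "w \<sqsubseteq> v" "E v u" for v u
  proof -
    have cd: "E v c" "Upair c x x v" "E v d" "Upair d x y v" "E v x" "E v y"
      using c d v assms E_up Upair_up by blast+
    have "(u \<epsilon> p) v \<longleftrightarrow> (u \<approx> c) v \<or> (u \<approx> d) v" using p v unfolding Upair_iff by blast
    then show ?thesis
      using Upair_eq_iff[OF cd(1) v(2) cd(5,5,2)] Upair_eq_iff[OF cd(3) v(2) cd(5,6,4)] by simp
  qed
  then show thesis using that p(1) unfolding Pair_iff by blast
qed

text \<open>Kuratowski's argument without asking whether \<open>x\<close> and \<open>y\<close> are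
  equal. The set \<open>{x}\<close> identifies the first components. The set \<open>{x, y}\<close>
  shows that each second component equals some component of the other side, and the crossed case
  still gives \<open>y = x' = x = y'\<close>.\<close>

lemma Pair_inj:
  assumes "Pair p x y w" "Pair p x' y' w" "E w x" "E w y" "E w x'" "E w y'"
  shows "(x \<approx> x') w" "(y \<approx> y') w"
proof -
  have fst: "(x \<approx> x') w" if *: "Pair p x y w" "Pair p x' y' w" "E w x" "E w x'" for x y x' y'
  proof -
    obtain c where "E w c" "Upair c x x w" using pairing[OF *(3,3)] by blast
    then have "Upair c x' x' w \<or> Upair c x' y' w" "Upair c x x w" using *(1,2) unfolding Pair_iff by blast+
    then have "(x' \<epsilon> c) w" "(x' \<epsilon> c) w \<longleftrightarrow> (x' \<approx> x) w"
      using qq_refl[OF *(4)] le_refl[of w] unfolding Upair_iff by blast+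
    then show ?thesis by (simp add: qq_sym)
  qed
  show x: "(x \<approx> x') w" by (rule fst) (use assms in auto)
  have snd: "(y \<approx> x') w \<or> (y \<approx> y') w" if *: "Pair p x y w" "Pair p x' y' w" "E w x" "E w y" for x y x' y'
  proof -
    obtain d where "E w d" "Upair d x y w" using pairing[OF *(3,4)] by blast
    then have "Upair d x' x' w \<or> Upair d x' y' w" "Upair d x y w" using *(1,2) unfolding Pair_iff by blast+
    then show ?thesis using qq_refl[OF *(4)] le_refl[of w] unfolding Upair_iff by blast
  qed
  have "(y \<approx> x') w \<or> (y \<approx> y') w" "(y' \<approx> x) w \<or> (y' \<approx> y) w"
    by (rule snd; use assms in blast)+
  then show "(y \<approx> y') w" using x qq_sym qq_trans by meson
qed

lemma Maps_E:
  assumes "Fun f I w" "Maps f i x w" "E w i" "E w x"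
  shows "(i \<epsilon> I) w"
proof -
  obtain p where p: "(p \<epsilon> f) w" "Pair p i x w" using assms(2) unfolding Maps_iff by blast
  then obtain j y where "E w y" "(j \<epsilon> I) w" "Pair p j y w" using assms(1) unfolding Fun_iff by blast
  then show ?thesis using Pair_inj(1)[of p j y w i x] p assms mm_E mm_cong qq_refl by metis
qed

lemma Maps_unique:
  assumes "Fun f I w" "Maps f i x w" "Maps f i y w" "E w i" "E w x" "E w y"
  shows "(x \<approx> y) w"
proof -
  have "(i \<epsilon> I) w" using Maps_E assms by blast
  then obtain z where "\<And>y. E w y \<Longrightarrow> Maps f i y w \<Longrightarrow> (y \<approx> z) w" using assms(1) unfolding Fun_iff by blast
  then show ?thesis using assms qq_sym qq_trans by meson
qed

text \<open>Collection returns some set of values; it contains all of them because the value at an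
  index is unique.\<close>

lemma range_exists:
  assumes "Fun f I w" "E w f" "E w I"
  obtains R where "E w R" "\<And>v x. w \<sqsubseteq> v \<Longrightarrow> (x \<epsilon> R) v \<longleftrightarrow> E v x \<and> (\<exists>i. E v i \<and> Maps f i x v)"
proof -
  have total: "\<forall>v i. w \<sqsubseteq> v \<longrightarrow> (i \<epsilon> I) v \<longrightarrow> (\<exists>x. E v x \<and> Maps f i x v)"
    using assms(1) unfolding Fun_iff by blast
  obtain R where R: "E w R" "\<forall>v i. w \<sqsubseteq> v \<longrightarrow> (i \<epsilon> I) v \<longrightarrow> (\<exists>x. (x \<epsilon> R) v \<and> Maps f i x v)"
    "\<forall>v x. w \<sqsubseteq> v \<longrightarrow> (x \<epsilon> R) v \<longrightarrow> (\<exists>i. (i \<epsilon> I) v \<and> Maps f i x v)"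
    using collection[of w "Maps f" I, OF dfn_Maps[OF dterm_const[OF assms(2)] dterm_var dterm_var] assms(3) total]
    by blast
  have "(x \<epsilon> R) v" if *: "w \<sqsubseteq> v" "E v x" "E v i" "Maps f i x v" for v x i
  proof -
    have f: "Fun f I v" using assms(1) *(1) Fun_up by blast
    then have "(i \<epsilon> I) v" using Maps_E * by blast
    then obtain y where y: "(y \<epsilon> R) v" "Maps f i y v" using R(2) *(1) by blast
    then have "(y \<approx> x) v" using Maps_unique[OF f] * mm_E by blast
    then show ?thesis using y(1) mm_cong mm_E qq_refl by blast
  qed
  then show thesis using that[OF R(1)] R(3) mm_E by blast
qed

text \<open>Collecting for each \<open>x\<close> at least one pair \<open>(x, y)\<close> with
  \<open>Q x y\<close> already yields the whole graph, since \<open>y\<close> is determined.\<close>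

lemma function_exists:
  assumes dfn: "dfn w (\<lambda>e. Q (e 0) (e (Suc 0)))" and "E w a"
    and total: "\<forall>v x. w \<sqsubseteq> v \<longrightarrow> (x \<epsilon> a) v \<longrightarrow> (\<exists>y. E v y \<and> Q x y v)"
    and unique: "\<forall>v x y z. w \<sqsubseteq> v \<longrightarrow> (x \<epsilon> a) v \<longrightarrow> E v y \<longrightarrow> E v z \<longrightarrow> Q x y v \<longrightarrow> Q x z v \<longrightarrow> (y \<approx> z) v"
  shows "\<exists>f. E w f \<and> Fun f a w \<and>
    (\<forall>v x y. w \<sqsubseteq> v \<longrightarrow> E v x \<longrightarrow> E v y \<longrightarrow> (Maps f x y v \<longleftrightarrow> (x \<epsilon> a) v \<and> Q x y v))"
proof -
  have Q_up: "Q x y v" if "Q x y u" "u \<sqsubseteq> v" for x y u v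
    by (rule up2[of w Q, OF dfn that(2,1)])
  have Q_cong: "Q x' y' v" if "Q x y v" "w \<sqsubseteq> v" "(x \<approx> x') v" "(y \<approx> y') v" for x y x' y' v
    by (rule cong2[of w Q, OF dfn that(2,1,3,4)])
  have dfn': "dfn w (\<lambda>e. \<exists>\<^sub>k y. Q (e 0) y \<and>\<^sub>k Pair (e (Suc 0)) (e 0) y)"
    by (intro dfn_ex dfn_conj dfn_subst[of w Q, OF dfn] dfn_Pair dterm_var)
  have "\<exists>p. E v p \<and> (\<exists>\<^sub>k y. Q x y \<and>\<^sub>k Pair p x y) v" if v: "w \<sqsubseteq> v" "(x \<epsilon> a) v" for v x
  proof -
    obtain y where "E v y" "Q x y v" using total v by blast
    moreover then obtain p where "E v p" "Pair p x y v" using pair_exists mm_E[OF v(2)] by blast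
    ultimately show ?thesis by auto
  qed
  then obtain f where f: "E w f"
    "\<forall>v x. w \<sqsubseteq> v \<longrightarrow> (x \<epsilon> a) v \<longrightarrow> (\<exists>p. (p \<epsilon> f) v \<and> (\<exists>\<^sub>k y. Q x y \<and>\<^sub>k Pair p x y) v)"
    "\<forall>v p. w \<sqsubseteq> v \<longrightarrow> (p \<epsilon> f) v \<longrightarrow> (\<exists>x. (x \<epsilon> a) v \<and> (\<exists>\<^sub>k y. Q x y \<and>\<^sub>k Pair p x y) v)"
    using collection[of w "\<lambda>x p. \<exists>\<^sub>k y. Q x y \<and>\<^sub>k Pair p x y" a, OF dfn' assms(2)] by blast
  have maps: "Maps f x y v \<longleftrightarrow> (x \<epsilon> a) v \<and> Q x y v" if v: "w \<sqsubseteq> v" "E v x" "E v y" for v x y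
  proof
    assume "Maps f x y v"
    then obtain p where p: "(p \<epsilon> f) v" "Pair p x y v" unfolding Maps_iff by blast
    then obtain x' y' where x': "(x' \<epsilon> a) v" "E v y'" "Q x' y' v" "Pair p x' y' v" using f(3) v unfolding k_simps by blast
    then have "(x' \<approx> x) v" "(y' \<approx> y) v" using Pair_inj[OF x'(4) p(2)] v mm_E by blast+
    then show "(x \<epsilon> a) v \<and> Q x y v" using x' Q_cong v mm_cong mm_E qq_refl by blast
  next
    assume *: "(x \<epsilon> a) v \<and> Q x y v"
    then obtain p z where p: "(p \<epsilon> f) v" "E v z" "Q x z v" "Pair p x z v" using f(2) v unfolding k_simps by blast
    then have "(z \<approx> y) v" using unique v * by blast
    then have "Pair p x y v" using Pair_cong p qq_refl v mm_E by blast
    then show "Maps f x y v" using p(1) unfolding Maps_iff by blast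
  qed
  have "Fun f a w"
    unfolding Fun_iff
  proof (intro HOL.conjI HOL.allI HOL.impI)
    fix v p assume "w \<sqsubseteq> v" "(p \<epsilon> f) v"
    then show "\<exists>x y. E v y \<and> (x \<epsilon> a) v \<and> Pair p x y v" using f(3) unfolding k_simps by blast
  next
    fix v x assume v: "w \<sqsubseteq> v" "(x \<epsilon> a) v"
    then obtain y where y: "E v y" "Q x y v" using total by blast
    have "(z \<approx> y) u" if u: "v \<sqsubseteq> u" "E u z" "Maps f x z u" for u z
    proof -
      have "w \<sqsubseteq> u" "E u x" "E u y" "(x \<epsilon> a) u" using le_trans v u E_up y mm_up mm_E by blast+
      then show ?thesis using unique u y Q_up maps by blast
    qed
    then show "\<exists>y. E v y \<and> Maps f x y v \<and> (\<forall>u z. v \<sqsubseteq> u \<longrightarrow> E u z \<longrightarrow> Maps f x z u \<longrightarrow> (z \<approx> y) u)"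
      using y maps v mm_E by blast
  qed
  then show ?thesis using f(1) maps by blast
qed

end

section \<open>Immediate subformulas, and the few instances of separation\<close>

context kripke
begin

definition Child :: "'a \<Rightarrow> 'a \<Rightarrow> 'w \<Rightarrow> bool" where
  "Child s x = (\<exists>\<^sub>k f i. (IsOr s f \<or>\<^sub>k IsAnd s f) \<and>\<^sub>k Maps f i x)"

lemma dfn_Child: "dterm w t \<Longrightarrow> dterm w u \<Longrightarrow> dfn w (\<lambda>e. Child (t e) (u e))"
  unfolding Child_def by (intro dfn_intros dfn_IsOr dfn_IsAnd dfn_Maps dterm_shift)

text \<open>Iterated, it speaks of members of members, which is how induction along
  \<open>Child\<close> is reduced to set induction.\<close>

definition Each :: "('a \<Rightarrow> 'w \<Rightarrow> bool) \<Rightarrow> 'a \<Rightarrow> 'w \<Rightarrow> bool" where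
  "Each Q a = (\<forall>\<^sub>k x. x \<epsilon> a \<longrightarrow>\<^sub>k Q x)"

lemma Each_iff: "Each Q a w \<longleftrightarrow> (\<forall>v x. w \<sqsubseteq> v \<longrightarrow> (x \<epsilon> a) v \<longrightarrow> Q x v)"
  unfolding Each_def kall_kimp using mm_E by blast

lemma dfn_Each:
  assumes "\<And>t. dterm w t \<Longrightarrow> dfn w (\<lambda>e. Q (t e))" "dterm w t"
  shows "dfn w (\<lambda>e. Each Q (t e))"
  unfolding Each_def by (intro dfn_intros assms dterm_shift)

end

context czf
begin

lemma empty_exists: obtains z where "E w z" "Emp z w"
proof -
  obtain a where a: "E w a" using nonempty by blast
  from separation[OF bounded.intros(3) this this] obtain z where "E w z"
    "\<forall>v x. w \<sqsubseteq> v \<longrightarrow> ((x \<epsilon> z) v \<longleftrightarrow> (x \<epsilon> a) v \<and> sem Bot (case_nat x (\<lambda>_. a)) v)"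
    by (elim HOL.exE HOL.conjE) (rule that)
  then show thesis using that unfolding Emp_iff by simp
qed

text \<open>Applied to a singleton this gives a set that is inhabited exactly when
  \<open>s \<in> t\<close>, a code for that truth value. This and the next two instances provide the
  values of letters, disjunctions and conjunctions.\<close>

lemma separation_mem:
  assumes "E w a" "E w s" "E w t"
  obtains b where "E w b" "\<And>v x. w \<sqsubseteq> v \<Longrightarrow> (x \<epsilon> b) v \<longleftrightarrow> (x \<epsilon> a) v \<and> (s \<epsilon> t) v"
proof -
  have "E w (case_nat s (\<lambda>_. t) i)" for i using assms by (simp split: nat.split)
  from separation[of "Mem 1 2" w "case_nat s (\<lambda>_. t)", OF bounded.intros(1) this assms(1)]
  obtain b where "E w b" "\<forall>v x. w \<sqsubseteq> v \<longrightarrow>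
    ((x \<epsilon> b) v \<longleftrightarrow> (x \<epsilon> a) v \<and> sem (Mem 1 2) (case_nat x (case_nat s (\<lambda>_. t))) v)" by (elim HOL.exE HOL.conjE) (rule that)
  then show thesis using that by (simp add: numeral_2_eq_2)
qed

lemma separation_ex:
  assumes "E w a" "E w s" "E w t"
  obtains b where "E w b" "\<And>v x. w \<sqsubseteq> v \<Longrightarrow> (x \<epsilon> b) v \<longleftrightarrow> (x \<epsilon> a) v \<and> (\<exists>y. (y \<epsilon> s) v \<and> (y \<epsilon> t) v)"
proof -
  \<comment> \<open>Under the quantifier, index 0 is \<open>y\<close>, index 1 is \<open>x\<close>,
    index 2 is \<open>s\<close> and index 3 is \<open>t\<close>.\<close>
  let ?A = "Exists (Conj (Mem 0 (Suc 1)) (Mem 0 3))"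
  have "E w (case_nat s (\<lambda>_. t) i)" for i using assms by (simp split: nat.split)
  from separation[of ?A w "case_nat s (\<lambda>_. t)", OF bounded.intros(8)[OF bounded.intros(1)] this assms(1)]
  obtain b where b: "E w b" "\<forall>v x. w \<sqsubseteq> v \<longrightarrow>
    ((x \<epsilon> b) v \<longleftrightarrow> (x \<epsilon> a) v \<and> sem ?A (case_nat x (case_nat s (\<lambda>_. t))) v)" by (elim HOL.exE HOL.conjE) (rule that)
  have "sem ?A (case_nat x (case_nat s (\<lambda>_. t))) v \<longleftrightarrow> (\<exists>y. (y \<epsilon> s) v \<and> (y \<epsilon> t) v)" for x v
    using mm_E by (auto simp: numeral_3_eq_3)
  then show thesis using that b by simp
qed

lemma separation_all:
  assumes "E w a" "E w s" "E w t"
  obtains b where "E w b" "\<And>v x. w \<sqsubseteq> v \<Longrightarrow> (x \<epsilon> b) v \<longleftrightarrow> (x \<epsilon> a) v \<and> Sub s t v"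
proof -
  let ?A = "Forall (Imp (Mem 0 (Suc 1)) (Mem 0 3))"
  have "E w (case_nat s (\<lambda>_. t) i)" for i using assms by (simp split: nat.split)
  from separation[of ?A w "case_nat s (\<lambda>_. t)", OF bounded.intros(7)[OF bounded.intros(1)] this assms(1)]
  obtain b where b: "E w b" "\<forall>v x. w \<sqsubseteq> v \<longrightarrow>
    ((x \<epsilon> b) v \<longleftrightarrow> (x \<epsilon> a) v \<and> sem ?A (case_nat x (case_nat s (\<lambda>_. t))) v)" by (elim HOL.exE HOL.conjE) (rule that)
  have "sem ?A (case_nat x (case_nat s (\<lambda>_. t))) v \<longleftrightarrow> Sub s t v" for x v
    unfolding Sub_def kall_iff kimp_iff by (simp add: numeral_3_eq_3)
  then show thesis using that b by simp
qed

lemma union2: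
  assumes "E w a" "E w b"
  obtains c where "E w c" "\<And>v x. w \<sqsubseteq> v \<Longrightarrow> (x \<epsilon> c) v \<longleftrightarrow> (x \<epsilon> a) v \<or> (x \<epsilon> b) v"
proof -
  obtain p where p: "E w p" "Upair p a b w" using pairing[OF assms] by blast
  obtain c where c: "E w c" "\<And>v x. w \<sqsubseteq> v \<Longrightarrow> (x \<epsilon> c) v \<longleftrightarrow> (\<exists>y. (y \<epsilon> p) v \<and> (x \<epsilon> y) v)"
    using union[OF p(1)] by blast
  have "(x \<epsilon> c) v \<longleftrightarrow> (x \<epsilon> a) v \<or> (x \<epsilon> b) v" if v: "w \<sqsubseteq> v" for v x
  proof
    assume "(x \<epsilon> c) v"
    then obtain y where y: "(y \<epsilon> p) v" "(x \<epsilon> y) v" using c v by blast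
    then have "(y \<approx> a) v \<or> (y \<approx> b) v" using p v unfolding Upair_iff by blast
    then show "(x \<epsilon> a) v \<or> (x \<epsilon> b) v" using mm_cong[OF y(2)] qq_refl mm_E[OF y(2)] by blast
  next
    assume "(x \<epsilon> a) v \<or> (x \<epsilon> b) v"
    moreover have "(a \<epsilon> p) v" "(b \<epsilon> p) v"
      using p v qq_refl E_up assms unfolding Upair_iff by blast+
    ultimately show "(x \<epsilon> c) v" using c v by blast
  qed
  then show thesis using that[OF c(1)] by blast
qed

lemma singleton_exists:
  assumes "E w a"
  obtains c where "E w c" "Upair c a a w" "\<And>v x. w \<sqsubseteq> v \<Longrightarrow> (x \<epsilon> c) v \<longleftrightarrow> (x \<approx> a) v"
proof -
  obtain c where "E w c" "Upair c a a w" using pairing[OF assms assms] by blast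
  then show thesis using that unfolding Upair_iff by blast
qed

subsection \<open>Shapes of game formulas\<close>

lemma Letter_inj:
  assumes "Letter s p w" "Letter s q w" "E w p" "E w q"
  shows "(p \<approx> q) w"
proof -
  obtain t u where "E w t" "Pair s t p w" "E w u" "Pair s u q w" using assms unfolding Letter_def k_simps by blast
  then show ?thesis using Pair_inj(2) assms(3,4) by blast
qed

lemma IsOr_inj:
  assumes "IsOr s p w" "IsOr s q w" "E w p" "E w q"
  shows "(p \<approx> q) w"
proof -
  obtain t u where "E w t" "Pair s t p w" "E w u" "Pair s u q w" using assms unfolding IsOr_def k_simps by blast
  then show ?thesis using Pair_inj(2) assms(3,4) by blast
qed

lemma IsAnd_inj:
  assumes "IsAnd s p w" "IsAnd s q w" "E w p" "E w q"
  shows "(p \<approx> q) w"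
proof -
  obtain t u where "E w t" "Pair s t p w" "E w u" "Pair s u q w" using assms unfolding IsAnd_def k_simps by blast
  then show ?thesis using Pair_inj(2) assms(3,4) by blast
qed

lemma Succ_mem: "IsSuc y x w \<Longrightarrow> E w x \<Longrightarrow> (x \<epsilon> y) w"
  using qq_refl le_refl unfolding IsSuc_iff by blast

text \<open>The tag 0 is empty, while the tags 1 and 2 are successors and have a member.\<close>

lemma Letter_not_IsOr:
  assumes "Letter s p w" "IsOr s f w" "E w p" "E w f"
  shows False
proof -
  obtain t where t: "E w t" "Emp t w" "Pair s t p w" using assms unfolding Letter_def k_simps by blast
  obtain z u where u: "E w z" "E w u" "IsSuc u z w" "Pair s u f w" using assms unfolding IsOr_def k_simps by blast
  have "(u \<approx> t) w" using Pair_inj(1)[OF u(4) t(3)] t u assms by blast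
  then have "(z \<epsilon> t) w" using mm_cong[OF Succ_mem[OF u(3,1)] qq_refl[OF u(1)]] by blast
  then show False using t(2) le_refl unfolding Emp_iff by blast
qed

lemma Letter_not_IsAnd:
  assumes "Letter s p w" "IsAnd s f w" "E w p" "E w f"
  shows False
proof -
  obtain t where t: "E w t" "Emp t w" "Pair s t p w" using assms unfolding Letter_def k_simps by blast
  obtain z u where u: "E w z" "E w u" "IsSuc u z w" "Pair s u f w" using assms unfolding IsAnd_def k_simps by blast
  have "(u \<approx> t) w" using Pair_inj(1)[OF u(4) t(3)] t u assms by blast
  then have "(z \<epsilon> t) w" using mm_cong[OF Succ_mem[OF u(3,1)] qq_refl[OF u(1)]] by blast
  then show False using t(2) le_refl unfolding Emp_iff by blast
qed

text \<open>If the tags 1 and 2 were equal, then 1, a member of 2, would be a member of 1 and hence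
  equal to 0; but 1 has a member.\<close>

lemma IsOr_not_IsAnd:
  assumes "IsOr s f w" "IsAnd s g w" "E w f" "E w g"
  shows False
proof -
  obtain z t where t: "E w z" "E w t" "Emp z w" "IsSuc t z w" "Pair s t f w"
    using assms unfolding IsOr_def k_simps by blast
  obtain z' u v where u: "E w z'" "E w u" "E w v" "IsSuc u z' w" "IsSuc v u w" "Pair s v g w"
    using assms unfolding IsAnd_def k_simps by blast
  have "(v \<approx> t) w" using Pair_inj(1)[OF u(6) t(5)] t u assms by blast
  then have "(u \<epsilon> t) w" using mm_cong[OF Succ_mem[OF u(5,2)] qq_refl[OF u(2)]] by blast
  then have "(u \<epsilon> z) w \<or> (u \<approx> z) w" using t(4) le_refl unfolding IsSuc_iff by blast
  moreover have no: "\<not> (x \<epsilon> z) w" for x using t(3) le_refl unfolding Emp_iff by blast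
  ultimately have "(z' \<epsilon> z) w" using mm_cong[OF Succ_mem[OF u(4,1)] qq_refl[OF u(1)]] by blast
  then show False using no by blast
qed

lemma Pair_members:
  assumes "Pair p x y w" "E w x" "E w y"
  obtains c where "(c \<epsilon> p) w" "(y \<epsilon> c) w"
proof -
  obtain c where c: "E w c" "Upair c x y w" using pairing[OF assms(2,3)] by blast
  then have "(c \<epsilon> p) w" using assms(1) le_refl unfolding Pair_iff by blast
  moreover have "(y \<epsilon> c) w" using c qq_refl[OF assms(3)] le_refl unfolding Upair_iff by blast
  ultimately show thesis using that by blast
qed

text \<open>A child \<open>x\<close> of \<open>s = (t, f)\<close> lies below it: \<open>x \<in> {i, x} \<in> (i, x) \<in> f \<in> {t, f} \<in> s\<close>.\<close>

lemma Child_chain: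
  assumes "Child s x w" "E w x"
  obtains a b c d where "(a \<epsilon> s) w" "(b \<epsilon> a) w" "(c \<epsilon> b) w" "(d \<epsilon> c) w" "(x \<epsilon> d) w"
proof -
  obtain f i where f: "E w f" "E w i" "IsOr s f w \<or> IsAnd s f w" "Maps f i x w"
    using assms(1) unfolding Child_def k_simps by blast
  then obtain t where "E w t" "Pair s t f w" unfolding IsOr_def IsAnd_def k_simps by blast
  then obtain a where a: "(a \<epsilon> s) w" "(f \<epsilon> a) w" using Pair_members f by blast
  obtain p where p: "(p \<epsilon> f) w" "Pair p i x w" using f(4) unfolding Maps_iff by blast
  then obtain c where c: "(c \<epsilon> p) w" "(x \<epsilon> c) w" using Pair_members f assms(2) by blast
  show thesis using that[OF a p(1) c] .
qed

text \<open>A child is five memberships below its parent, whereas set induction descends by one. The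
  induction formula therefore carries \<open>Q\<close> for \<open>a\<close> and for four generations
  below it; assumed for the members of \<open>a\<close>, it reaches the fifth.\<close>

lemma Child_induction:
  assumes dfn: "\<And>t. dterm w t \<Longrightarrow> dfn w (\<lambda>e. Q (t e))"
    and step: "\<And>v s. w \<sqsubseteq> v \<Longrightarrow> E v s \<Longrightarrow> (\<forall>u x. v \<sqsubseteq> u \<longrightarrow> E u x \<longrightarrow> Child s x u \<longrightarrow> Q x u) \<Longrightarrow> Q s v"
    and "w \<sqsubseteq> v" "E v s"
  shows "Q s v"
proof -
  let ?Q = "\<lambda>a. Q a \<and>\<^sub>k Each Q a \<and>\<^sub>k Each (Each Q) a \<and>\<^sub>k Each (Each (Each Q)) a \<and>\<^sub>k Each (Each (Each (Each Q))) a"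
  have "?Q s v"
  proof (rule set_induction[of w ?Q])
    show "dfn w (\<lambda>e. ?Q (e 0))" by (intro dfn_conj dfn_Each dfn dterm_var)
    fix v a assume v: "w \<sqsubseteq> v" "E v a" and IH: "\<And>u x. v \<sqsubseteq> u \<Longrightarrow> (x \<epsilon> a) u \<Longrightarrow> ?Q x u"
    have "Each Q a v" "Each (Each Q) a v" "Each (Each (Each Q)) a v" "Each (Each (Each (Each Q))) a v"
      and five: "Each (Each (Each (Each (Each Q)))) a v"
      using IH unfolding k_simps Each_iff[of _ a] by blast+
    moreover have "Q a v"
    proof (rule step[OF v], intro HOL.allI HOL.impI)
      fix u x assume u: "v \<sqsubseteq> u" "E u x" "Child a x u"
      obtain b c d d' where *: "(b \<epsilon> a) u" "(c \<epsilon> b) u" "(d \<epsilon> c) u" "(d' \<epsilon> d) u" "(x \<epsilon> d') u"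
        using Child_chain[OF u(3,2)] by blast
      show "Q x u" using five u(1) * le_refl unfolding Each_iff by blast
    qed
    ultimately show "?Q a v" unfolding k_simps by blast
  qed (use assms in auto)
  then show ?thesis by simp
qed

subsection \<open>Finite sets\<close>

text \<open>Composes the enumeration \<open>g\<close> of the index set with the family
  \<open>f\<close>. It lets the set of conjuncts of a finitary conjunction serve as the premise of a
  finitary rule.\<close>

lemma Fun_range_Fin:
  assumes "Fin I w" "E w I" "E w f" "Fun f I w" "E w R"
    and R: "\<And>v x. w \<sqsubseteq> v \<Longrightarrow> (x \<epsilon> R) v \<longleftrightarrow> E v x \<and> (\<exists>i. E v i \<and> Maps f i x v)"
  shows "Fin R w"
proof -
  obtain \<omega> n g where g: "E w \<omega>" "E w n" "E w g" "Omega \<omega> w" "(n \<epsilon> \<omega>) w" "Fun g n w"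
    "(\<forall>\<^sub>k y. y \<epsilon> I \<longleftrightarrow>\<^sub>k (\<exists>\<^sub>k x. x \<epsilon> n \<and>\<^sub>k Maps g x y)) w"
    using assms(1) unfolding Fin_def k_simps by blast
  have I: "(y \<epsilon> I) v \<longleftrightarrow> (\<exists>x. E v x \<and> (x \<epsilon> n) v \<and> Maps g x y v)" if "w \<sqsubseteq> v" "E v y" for v y
    using g(7) that unfolding kall_kiff k_simps by blast
  let ?Q = "\<lambda>k x. \<exists>\<^sub>k i. Maps g k i \<and>\<^sub>k Maps f i x"
  have dfn: "dfn w (\<lambda>e. ?Q (e 0) (e (Suc 0)))"
    by (intro dfn_intros dfn_Maps g assms)
  have total: "\<exists>x. E v x \<and> ?Q k x v" if v: "w \<sqsubseteq> v" "(k \<epsilon> n) v" for v k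
  proof -
    obtain i where i: "E v i" "Maps g k i v" using g(6) v unfolding Fun_iff by blast
    then have "(i \<epsilon> I) v" using I v mm_E by blast
    then obtain x where "E v x" "Maps f i x v" using assms(4) v(1) unfolding Fun_iff by blast
    then show ?thesis using i unfolding k_simps by blast
  qed
  have unique: "(x \<approx> y) v" if v: "w \<sqsubseteq> v" "(k \<epsilon> n) v" "E v x" "E v y" "?Q k x v" "?Q k y v" for v k x y
  proof -
    obtain i j where ij: "E v i" "Maps g k i v" "Maps f i x v" "E v j" "Maps g k j v" "Maps f j y v"
      using v(5,6) unfolding k_simps by blast
    have "(i \<approx> j) v" using Maps_unique[OF Fun_up[OF v(1) g(6)] ij(2,5)] ij mm_E v(2) by blast
    then have "Maps f j x v"
      using Maps_cong[OF ij(3)] qq_refl[OF E_up[OF assms(3) v(1)]] qq_refl[OF v(3)] by blast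
    then show ?thesis using Maps_unique[OF Fun_up[OF v(1) assms(4)] _ ij(6)] ij v by blast
  qed
  obtain h where h: "E w h" "Fun h n w"
    "\<forall>v x y. w \<sqsubseteq> v \<longrightarrow> E v x \<longrightarrow> E v y \<longrightarrow> (Maps h x y v \<longleftrightarrow> (x \<epsilon> n) v \<and> ?Q x y v)"
    using function_exists[of w ?Q n, OF dfn g(2)] total unique by blast
  have "(x \<epsilon> R) v \<longleftrightarrow> (\<exists>k. E v k \<and> (k \<epsilon> n) v \<and> Maps h k x v)" if v: "w \<sqsubseteq> v" "E v x" for v x
  proof
    assume "(x \<epsilon> R) v"
    then obtain i where i: "E v i" "Maps f i x v" using R v by blast
    then have "(i \<epsilon> I) v" using Maps_E[OF Fun_up[OF v(1) assms(4)]] v by blast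
    then obtain k where "E v k" "(k \<epsilon> n) v" "Maps g k i v" using I v i by blast
    then show "\<exists>k. E v k \<and> (k \<epsilon> n) v \<and> Maps h k x v" using h(3) v i unfolding k_simps by blast
  next
    assume "\<exists>k. E v k \<and> (k \<epsilon> n) v \<and> Maps h k x v"
    then obtain k i where "E v k" "E v i" "Maps f i x v" using h(3) v unfolding k_simps by blast
    then show "(x \<epsilon> R) v" using R v by blast
  qed
  then show ?thesis
    using g h unfolding Fin_def k_simps kall_kiff by blast
qed

text \<open>A singleton is an image of the number 1, whose only member is 0.\<close>

lemma Upair_Fin:
  assumes "E w x" "Upair a x x w"
  shows "Fin a w"
proof -
  obtain \<omega> where \<omega>: "E w \<omega>" "Omega \<omega> w" using infinity by blast
  then have \<omega>_iff: "(n \<epsilon> \<omega>) w \<longleftrightarrow> Emp n w \<or> (\<exists>y. E w y \<and> (y \<epsilon> \<omega>) w \<and> IsSuc n y w)" if "E w n" for n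
    using that le_refl unfolding Omega_def kall_kiff k_simps by blast
  obtain z where z: "E w z" "Emp z w" using empty_exists by blast
  obtain n where n: "E w n" "Upair n z z w" "\<And>v x. w \<sqsubseteq> v \<Longrightarrow> (x \<epsilon> n) v \<longleftrightarrow> (x \<approx> z) v"
    using singleton_exists[OF z(1)] by blast
  have "IsSuc n z w" using n(3) z(2) unfolding IsSuc_iff Emp_iff by blast
  moreover have "(z \<epsilon> \<omega>) w" using \<omega>_iff z by blast
  ultimately have n\<omega>: "(n \<epsilon> \<omega>) w" using \<omega>_iff n z by blast
  let ?Q = "\<lambda>k y. y \<approx> x"
  have dfn: "dfn w (\<lambda>e. ?Q (e 0) (e (Suc 0)))" by (intro dfn_intros assms)
  have total: "\<exists>y. E v y \<and> ?Q k y v" if "w \<sqsubseteq> v" "(k \<epsilon> n) v" for v k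
    using E_up[OF assms(1) that(1)] qq_refl by blast
  have unique: "(y \<approx> y') v" if "w \<sqsubseteq> v" "(k \<epsilon> n) v" "E v y" "E v y'" "?Q k y v" "?Q k y' v" for v k y y'
    using that qq_sym qq_trans by blast
  obtain h where h: "E w h" "Fun h n w"
    "\<forall>v k y. w \<sqsubseteq> v \<longrightarrow> E v k \<longrightarrow> E v y \<longrightarrow> (Maps h k y v \<longleftrightarrow> (k \<epsilon> n) v \<and> ?Q k y v)"
    using function_exists[of w ?Q n, OF dfn n(1)] total unique by blast
  have "(y \<epsilon> a) v \<longleftrightarrow> (\<exists>k. E v k \<and> (k \<epsilon> n) v \<and> Maps h k y v)" if v: "w \<sqsubseteq> v" "E v y" for v y
  proof -
    have "E v z" "(z \<epsilon> n) v" using n(3) v(1) qq_refl E_up[OF z(1) v(1)] by blast+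
    moreover have "(y \<epsilon> a) v \<longleftrightarrow> (y \<approx> x) v" using assms(2) v unfolding Upair_iff by blast
    ultimately show ?thesis using h(3) v by blast
  qed
  then show ?thesis
    using \<omega> n n\<omega> h unfolding Fin_def k_simps kall_kiff by blast
qed

end

section \<open>Truth sets\<close>

context kripke
begin

lemma Family_iff: "Family f I S w \<longleftrightarrow> Fun f I w \<and>
    (\<forall>v i x. w \<sqsubseteq> v \<longrightarrow> E v i \<longrightarrow> E v x \<longrightarrow> Maps f i x v \<longrightarrow> (x \<epsilon> S) v)"
  unfolding Family_def k_simps kall2_kimp by blast

lemma Formulas_iff: "Formulas C P S w \<longleftrightarrow> (\<forall>v s. w \<sqsubseteq> v \<longrightarrow> (s \<epsilon> S) v \<longrightarrow> Shape C P S s v)"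
  unfolding Formulas_def kall_kimp using mm_E by blast

lemma Formulas_cases:
  assumes "Formulas C P S w" "w \<sqsubseteq> v" "(s \<epsilon> S) v"
  obtains p where "(p \<epsilon> P) v" "Letter s p v"
  | f I where "E v f" "E v I" "IsOr s f v" "Family f I S v"
  | f I where "E v f" "E v I" "IsAnd s f v" "Family f I S v" "C I v"
proof -
  have "Shape C P S s v" using assms unfolding Formulas_iff by blast
  then show thesis using that unfolding Shape_def k_simps by blast
qed

text \<open>Only the clause for conjunctions looks beyond the world at which \<open>f\<close> is
  given, because a later world may know more indices of \<open>f\<close>.\<close>

lemma TruthClause_iff: "TruthClause M S V s w \<longleftrightarrow>
    (\<forall>v p. w \<sqsubseteq> v \<longrightarrow> E v p \<longrightarrow> Letter s p v \<longrightarrow> ((s \<epsilon> V) v \<longleftrightarrow> (p \<epsilon> M) v)) \<and>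
    (\<forall>v f. w \<sqsubseteq> v \<longrightarrow> E v f \<longrightarrow> IsOr s f v \<longrightarrow>
      (\<forall>i x. E v i \<longrightarrow> E v x \<longrightarrow> Maps f i x v \<longrightarrow> (x \<epsilon> S) v) \<and>
      ((s \<epsilon> V) v \<longleftrightarrow> (\<exists>i x. E v i \<and> Maps f i x v \<and> (x \<epsilon> V) v))) \<and>
    (\<forall>v f. w \<sqsubseteq> v \<longrightarrow> E v f \<longrightarrow> IsAnd s f v \<longrightarrow>
      (\<forall>i x. E v i \<longrightarrow> E v x \<longrightarrow> Maps f i x v \<longrightarrow> (x \<epsilon> S) v) \<and>
      ((s \<epsilon> V) v \<longleftrightarrow> (\<forall>u i x. v \<sqsubseteq> u \<longrightarrow> E u i \<longrightarrow> E u x \<longrightarrow> Maps f i x u \<longrightarrow> (x \<epsilon> V) u)))"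
  (is "_ \<longleftrightarrow> ?L \<and> ?O \<and> ?A")
proof -
  have "(\<forall>\<^sub>k p. Letter s p \<longrightarrow>\<^sub>k (s \<epsilon> V \<longleftrightarrow>\<^sub>k p \<epsilon> M)) w \<longleftrightarrow> ?L"
    unfolding kall_kimp kiff_iff by (meson E_up Letter_up le_refl le_trans)
  moreover have "(\<forall>\<^sub>k f. IsOr s f \<longrightarrow>\<^sub>k (\<forall>\<^sub>k i x. Maps f i x \<longrightarrow>\<^sub>k x \<epsilon> S) \<and>\<^sub>k
       (s \<epsilon> V \<longleftrightarrow>\<^sub>k (\<exists>\<^sub>k i x. Maps f i x \<and>\<^sub>k x \<epsilon> V))) w \<longleftrightarrow> ?O"
    unfolding kall_kimp[where w = w] k_simps kiff_iff kall2_kimp using mm_E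
    by (meson E_up IsOr_up le_refl le_trans)
  moreover have "(\<forall>\<^sub>k f. IsAnd s f \<longrightarrow>\<^sub>k (\<forall>\<^sub>k i x. Maps f i x \<longrightarrow>\<^sub>k x \<epsilon> S) \<and>\<^sub>k
       (s \<epsilon> V \<longleftrightarrow>\<^sub>k (\<forall>\<^sub>k i x. Maps f i x \<longrightarrow>\<^sub>k x \<epsilon> V))) w \<longleftrightarrow> ?A"
    unfolding kall_kimp[where w = w] k_simps kiff_iff kall2_kimp
    by (meson E_up IsAnd_up le_refl le_trans)
  ultimately show ?thesis unfolding TruthClause_def k_simps by blast
qed

lemma Truth_iff: "Truth M S V w \<longleftrightarrow> Sub V S w \<and> (\<forall>v s. w \<sqsubseteq> v \<longrightarrow> (s \<epsilon> S) v \<longrightarrow> TruthClause M S V s v)"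
  unfolding Truth_def k_simps kall_kimp using mm_E by blast

lemma
  assumes "Truth M S V w" "w \<sqsubseteq> v" "(s \<epsilon> S) v"
  shows Truth_Letter: "E v p \<Longrightarrow> Letter s p v \<Longrightarrow> (s \<epsilon> V) v \<longleftrightarrow> (p \<epsilon> M) v"
    and Truth_Or: "E v f \<Longrightarrow> IsOr s f v \<Longrightarrow> (s \<epsilon> V) v \<longleftrightarrow> (\<exists>i x. E v i \<and> Maps f i x v \<and> (x \<epsilon> V) v)"
    and Truth_And: "E v f \<Longrightarrow> IsAnd s f v \<Longrightarrow> (s \<epsilon> V) v \<longleftrightarrow>
      (\<forall>u i x. v \<sqsubseteq> u \<longrightarrow> E u i \<longrightarrow> E u x \<longrightarrow> Maps f i x u \<longrightarrow> (x \<epsilon> V) u)"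
    and Truth_Child: "E v x \<Longrightarrow> Child s x v \<Longrightarrow> (x \<epsilon> S) v"
proof -
  have c: "TruthClause M S V s v" using assms unfolding Truth_iff by blast
  show "E v p \<Longrightarrow> Letter s p v \<Longrightarrow> (s \<epsilon> V) v \<longleftrightarrow> (p \<epsilon> M) v"
    using c le_refl[of v] unfolding TruthClause_iff by blast
  show "E v f \<Longrightarrow> IsOr s f v \<Longrightarrow> (s \<epsilon> V) v \<longleftrightarrow> (\<exists>i x. E v i \<and> Maps f i x v \<and> (x \<epsilon> V) v)"
    using c le_refl[of v] unfolding TruthClause_iff by blast
  show "E v f \<Longrightarrow> IsAnd s f v \<Longrightarrow> (s \<epsilon> V) v \<longleftrightarrow>
      (\<forall>u i x. v \<sqsubseteq> u \<longrightarrow> E u i \<longrightarrow> E u x \<longrightarrow> Maps f i x u \<longrightarrow> (x \<epsilon> V) u)"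
    using c le_refl[of v] unfolding TruthClause_iff by blast
  show "E v x \<Longrightarrow> Child s x v \<Longrightarrow> (x \<epsilon> S) v"
    using c le_refl[of v] unfolding TruthClause_iff Child_def k_simps by blast
qed

lemma Child_iff: "Child s x w \<longleftrightarrow> (\<exists>f i. E w f \<and> E w i \<and> (IsOr s f w \<or> IsAnd s f w) \<and> Maps f i x w)"
  unfolding Child_def k_simps by blast

lemma Truth_cong: "Truth M S V u \<Longrightarrow> (M \<approx> M') u \<Longrightarrow> (S \<approx> S') u \<Longrightarrow> (V \<approx> V') u \<Longrightarrow> Truth M' S' V' u"
  by (rule cong3[of u Truth, OF dfn_Truth[OF dterm_var dterm_var dterm_var] le_refl])

lemma Child_cong: "Child x y u \<Longrightarrow> (x \<approx> x') u \<Longrightarrow> (y \<approx> y') u \<Longrightarrow> Child x' y' u"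
  by (rule cong2[of u Child, OF dfn_Child[OF dterm_var dterm_var] le_refl])

text \<open>Some fragment \<open>S\<close> of \<open>X\<close> around \<open>s\<close> carries a
  truth set. Asking for a fragment instead of all of \<open>X\<close> makes the existence of truth
  sets accessible to induction along \<open>Child\<close>.\<close>

definition Decided :: "'a \<Rightarrow> 'a \<Rightarrow> 'a \<Rightarrow> 'w \<Rightarrow> bool" where
  "Decided X M s = (\<exists>\<^sub>k S V. Sub S X \<and>\<^sub>k Truth M S V \<and>\<^sub>k s \<epsilon> S)"

lemma dfn_Decided: "dterm w r \<Longrightarrow> dterm w t \<Longrightarrow> dterm w u \<Longrightarrow> dfn w (\<lambda>e. Decided (r e) (t e) (u e))"
  unfolding Decided_def by (intro dfn_intros dfn_vocabulary dfn_Truth dterm_shift)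

end

section \<open>Uniqueness and existence of truth sets\<close>

context czf
begin

text \<open>The clauses compute the value of \<open>s\<close> from its children, which belong to
  both domains by the clauses themselves; \<open>X\<close> supplies the case distinction on
  shapes.\<close>

lemma truth_unique:
  assumes X: "Formulas C P X w" "E w X"
    and T: "Truth M S V w" "E w S" "E w V" and T': "Truth M S' V' w" "E w S'" "E w V'"
    and v: "w \<sqsubseteq> v" "(s \<epsilon> X) v" "(s \<epsilon> S) v" "(s \<epsilon> S') v"
  shows "(s \<epsilon> V) v \<longleftrightarrow> (s \<epsilon> V') v"
proof -
  let ?Q = "\<lambda>s. s \<epsilon> X \<and>\<^sub>k s \<epsilon> S \<and>\<^sub>k s \<epsilon> S' \<longrightarrow>\<^sub>k (s \<epsilon> V \<longleftrightarrow>\<^sub>k s \<epsilon> V')"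
  have "?Q s v"
  proof (rule Child_induction[of w ?Q])
    show "dfn w (\<lambda>e. ?Q (t e))" if "dterm w t" for t
      by (intro dfn_intros that X T T')
  next
    fix v s assume v: "w \<sqsubseteq> v" "E v s"
      and IH: "\<forall>u x. v \<sqsubseteq> u \<longrightarrow> E u x \<longrightarrow> Child s x u \<longrightarrow> ?Q x u"
    have "(s \<epsilon> V) u \<longleftrightarrow> (s \<epsilon> V') u" if vu: "v \<sqsubseteq> u" and s: "(s \<epsilon> X) u" "(s \<epsilon> S) u" "(s \<epsilon> S') u" for u
    proof -
      have wu: "w \<sqsubseteq> u" using v(1) vu le_trans by blast
      have child: "(x \<epsilon> V) u' \<longleftrightarrow> (x \<epsilon> V') u'" if x: "u \<sqsubseteq> u'" "E u' x" "Child s x u'" "(x \<epsilon> X) u'" for u' x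
      proof -
        have "(s \<epsilon> S) u'" "(s \<epsilon> S') u'" "w \<sqsubseteq> u'" "v \<sqsubseteq> u'" using s x(1) mm_up wu vu le_trans by blast+
        then have "(x \<epsilon> S) u'" "(x \<epsilon> S') u'" "?Q x u'"
          using Truth_Child[OF T(1) _ _ x(2,3)] Truth_Child[OF T'(1) _ _ x(2,3)] IH x by blast+
        then show ?thesis using x(4) unfolding kimp_iff kiff_iff k_simps by (meson le_refl)
      qed
      from X(1) wu s(1) show ?thesis
      proof (cases rule: Formulas_cases)
        case (1 p)
        then show ?thesis
          using Truth_Letter[OF T(1) wu s(2)] Truth_Letter[OF T'(1) wu s(3)] mm_E by blast
      next
        case (2 f I)
        have "(x \<epsilon> V) u \<longleftrightarrow> (x \<epsilon> V') u" if "E u i" "E u x" "Maps f i x u" for i x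
          using child[of u x] that 2 le_refl[of u] unfolding Child_iff Family_iff by blast
        then show ?thesis
          using Truth_Or[OF T(1) wu s(2) 2(1,3)] Truth_Or[OF T'(1) wu s(3) 2(1,3)] mm_E by metis
      next
        case (3 f I)
        have "(x \<epsilon> V) u' \<longleftrightarrow> (x \<epsilon> V') u'" if "u \<sqsubseteq> u'" "E u' i" "E u' x" "Maps f i x u'" for u' i x
          using child[of u' x] that 3 E_up[OF 3(1) that(1)] IsAnd_up[OF that(1) 3(3)]
          unfolding Child_iff Family_iff by blast
        then show ?thesis
          using Truth_And[OF T(1) wu s(2) 3(1,3)] Truth_And[OF T'(1) wu s(3) 3(1,3)] by metis
      qed
    qed
    then show "?Q s v"
      unfolding kimp_iff kiff_iff k_simps using le_trans mm_up by meson
  qed (use v mm_E in blast)+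
  then show ?thesis using v(2-) le_refl unfolding kimp_iff kiff_iff k_simps by blast
qed

text \<open>The fragments are collected first and truth sets for them afterwards, so that no pairs
  have to be collected. The union of the truth sets obeys the clauses because, by uniqueness, it
  restricts on each fragment to any truth set collected for it; this is \<open>agree\<close>
  below.\<close>

lemma truth_union:
  assumes X: "Formulas C P X w" "E w X" and "E w M" "E w a"
    and a: "\<forall>v s. w \<sqsubseteq> v \<longrightarrow> (s \<epsilon> a) v \<longrightarrow> Decided X M s v"
  obtains S V where "E w S" "E w V" "Sub a S w" "Sub S X w" "Truth M S V w"
proof -
  let ?Q = "\<lambda>s S. s \<epsilon> S \<and>\<^sub>k Sub S X \<and>\<^sub>k (\<exists>\<^sub>k V. Truth M S V)"
  have dfn: "dfn w (\<lambda>e. ?Q (e 0) (e (Suc 0)))"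
    by (intro dfn_intros dfn_vocabulary dfn_Truth X assms)
  have "\<forall>v s. w \<sqsubseteq> v \<longrightarrow> (s \<epsilon> a) v \<longrightarrow> (\<exists>S. E v S \<and> ?Q s S v)"
    using a unfolding Decided_def k_simps by blast
  then obtain b where b: "E w b"
    "\<forall>v s. w \<sqsubseteq> v \<longrightarrow> (s \<epsilon> a) v \<longrightarrow> (\<exists>S. (S \<epsilon> b) v \<and> ?Q s S v)"
    "\<forall>v S. w \<sqsubseteq> v \<longrightarrow> (S \<epsilon> b) v \<longrightarrow> (\<exists>s. (s \<epsilon> a) v \<and> ?Q s S v)"
    using collection[of w ?Q a, OF dfn assms(4)] by blast
  have dfn': "dfn w (\<lambda>e. Truth M (e 0) (e (Suc 0)))"
    by (intro dfn_intros dfn_Truth assms)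
  have "\<forall>v S. w \<sqsubseteq> v \<longrightarrow> (S \<epsilon> b) v \<longrightarrow> (\<exists>V. E v V \<and> Truth M S V v)"
    using b(3) unfolding k_simps by blast
  then obtain c where c: "E w c"
    "\<forall>v S. w \<sqsubseteq> v \<longrightarrow> (S \<epsilon> b) v \<longrightarrow> (\<exists>V. (V \<epsilon> c) v \<and> Truth M S V v)"
    "\<forall>v V. w \<sqsubseteq> v \<longrightarrow> (V \<epsilon> c) v \<longrightarrow> (\<exists>S. (S \<epsilon> b) v \<and> Truth M S V v)"
    using collection[of w "Truth M" b, OF dfn' b(1)] by blast
  obtain S where S: "E w S" "\<And>v x. w \<sqsubseteq> v \<Longrightarrow> (x \<epsilon> S) v \<longleftrightarrow> (\<exists>y. (y \<epsilon> b) v \<and> (x \<epsilon> y) v)"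
    using union[OF b(1)] by blast
  obtain V where V: "E w V" "\<And>v x. w \<sqsubseteq> v \<Longrightarrow> (x \<epsilon> V) v \<longleftrightarrow> (\<exists>y. (y \<epsilon> c) v \<and> (x \<epsilon> y) v)"
    using union[OF c(1)] by blast
  have sub: "(s \<epsilon> X) v" if "w \<sqsubseteq> v" "(S' \<epsilon> b) v" "(s \<epsilon> S') v" for v S' s
    using b(3) that le_refl[of v] unfolding k_simps Sub_iff by blast
  have agree: "(s \<epsilon> V) v \<longleftrightarrow> (s \<epsilon> V') v"
    if h: "w \<sqsubseteq> v" "(S' \<epsilon> b) v" "(V' \<epsilon> c) v" "Truth M S' V' v" "(s \<epsilon> S') v" for v s S' V'
  proof
    assume "(s \<epsilon> V) v"
    then obtain V2 where V2: "(V2 \<epsilon> c) v" "(s \<epsilon> V2) v" using V h by blast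
    then obtain S2 where S2: "(S2 \<epsilon> b) v" "Truth M S2 V2 v" using c h by blast
    then have "(s \<epsilon> S2) v" using V2 le_refl[of v] unfolding Truth_iff Sub_iff by blast
    then show "(s \<epsilon> V') v"
      using truth_unique[OF Formulas_up[OF h(1) X(1)] E_up[OF X(2) h(1)] S2(2) _ _ h(4) _ _ le_refl sub[OF h(1,2,5)] _ h(5)]
        S2(1) V2 h mm_E by blast
  next
    assume "(s \<epsilon> V') v"
    then show "(s \<epsilon> V) v" using V h by blast
  qed
  have "Truth M S V w" unfolding Truth_iff
  proof (intro HOL.conjI HOL.allI HOL.impI)
    show "Sub V S w" unfolding Sub_iff
    proof (intro HOL.allI HOL.impI)
      fix v s assume v: "w \<sqsubseteq> v" "(s \<epsilon> V) v"
      then obtain V' where V': "(V' \<epsilon> c) v" "(s \<epsilon> V') v" using V by blast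
      then obtain S' where "(S' \<epsilon> b) v" "Truth M S' V' v" using c v by blast
      then show "(s \<epsilon> S) v" using V' S v le_refl[of v] unfolding Truth_iff Sub_iff by blast
    qed
  next
    fix v s assume v: "w \<sqsubseteq> v" "(s \<epsilon> S) v"
    then obtain S' where S': "(S' \<epsilon> b) v" "(s \<epsilon> S') v" using S by blast
    then obtain V' where V': "(V' \<epsilon> c) v" "Truth M S' V' v" using c v by blast
    have cl: "TruthClause M S' V' s v" using V'(2) S'(2) le_refl[of v] unfolding Truth_iff by blast
    have up: "w \<sqsubseteq> u" "(S' \<epsilon> b) u" "(V' \<epsilon> c) u" "Truth M S' V' u" "(s \<epsilon> S') u" if "v \<sqsubseteq> u" for u
      using that v S' V' mm_up Truth_up le_trans by blast+
    have ag: "(t \<epsilon> V) u \<longleftrightarrow> (t \<epsilon> V') u" if "v \<sqsubseteq> u" "(t \<epsilon> S') u" for u t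
      using agree up[OF that(1)] that(2) by blast
    have inS: "(t \<epsilon> S) u" if "v \<sqsubseteq> u" "(t \<epsilon> S') u" for u t
      using S up[OF that(1)] that(2) by blast
    have ch: "(x \<epsilon> S') u" if "v \<sqsubseteq> u" "E u x" "Child s x u" for u x
      using Truth_Child[OF V'(2) that(1) up(5)[OF that(1)] that(2,3)] .
    show "TruthClause M S V s v" unfolding TruthClause_iff
    proof (intro HOL.conjI HOL.allI HOL.impI)
      fix u p assume u: "v \<sqsubseteq> u" "E u p" "Letter s p u"
      show "(s \<epsilon> V) u \<longleftrightarrow> (p \<epsilon> M) u"
        using Truth_Letter[OF V'(2) u(1) up(5)[OF u(1)] u(2,3)] ag up(5) u(1) by blast
    next
      fix u f i x assume u: "v \<sqsubseteq> u" "E u f" "IsOr s f u" "E u i" "E u x" "Maps f i x u"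
      then have "(x \<epsilon> S') u" using ch unfolding Child_iff by blast
      then show "(x \<epsilon> S) u" using inS u(1) by blast
    next
      fix u f assume u: "v \<sqsubseteq> u" "E u f" "IsOr s f u"
      have "(x \<epsilon> V) u \<longleftrightarrow> (x \<epsilon> V') u" if "E u i" "E u x" "Maps f i x u" for i x
        using ag ch u that unfolding Child_iff by blast
      then show "(s \<epsilon> V) u \<longleftrightarrow> (\<exists>i x. E u i \<and> Maps f i x u \<and> (x \<epsilon> V) u)"
        using Truth_Or[OF V'(2) u(1) up(5)[OF u(1)] u(2,3)] ag[OF u(1) up(5)[OF u(1)]] mm_E by blast
    next
      fix u f i x assume u: "v \<sqsubseteq> u" "E u f" "IsAnd s f u" "E u i" "E u x" "Maps f i x u"
      then have "(x \<epsilon> S') u" using ch unfolding Child_iff by blast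
      then show "(x \<epsilon> S) u" using inS u(1) by blast
    next
      fix u f assume u: "v \<sqsubseteq> u" "E u f" "IsAnd s f u"
      have "(x \<epsilon> V) u' \<longleftrightarrow> (x \<epsilon> V') u'" if x: "u \<sqsubseteq> u'" "E u' i" "E u' x" "Maps f i x u'" for u' i x
      proof -
        have "v \<sqsubseteq> u'" "E u' f" "IsAnd s f u'" using u x(1) le_trans E_up IsAnd_up by blast+
        then show ?thesis using ag ch x unfolding Child_iff by blast
      qed
      then show "(s \<epsilon> V) u \<longleftrightarrow> (\<forall>u' i x. u \<sqsubseteq> u' \<longrightarrow> E u' i \<longrightarrow> E u' x \<longrightarrow> Maps f i x u' \<longrightarrow> (x \<epsilon> V) u')"
        using Truth_And[OF V'(2) u(1) up(5)[OF u(1)] u(2,3)] ag[OF u(1) up(5)[OF u(1)]] by metis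
    qed
  qed
  moreover have "Sub a S w" using b(2) S(2) unfolding Sub_iff k_simps by blast
  moreover have "Sub S X w" using S(2) sub unfolding Sub_iff by blast
  ultimately show thesis using that S(1) V(1) by blast
qed

text \<open>No case distinction on \<open>s\<close> lying in \<open>S\<close> at \<open>w\<close>
  would help, as \<open>s\<close> may enter \<open>S\<close> at a later world. So \<open>s\<close>
  is added regardless, with the truth value \<open>K\<close> coded by \<open>c\<close>, and
  \<open>K\<close> is shown to agree with \<open>V\<close> at those worlds where \<open>s\<close>
  was present before.\<close>

lemma truth_extend:
  assumes X: "Formulas C P X w" "(s \<epsilon> X) w"
    and T: "Truth M S V w" "E w S" "E w V" "Sub S X w"
    and c: "E w c" "\<forall>v z. w \<sqsubseteq> v \<longrightarrow> ((z \<epsilon> c) v \<longleftrightarrow> (z \<approx> s) v \<and> K v)"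
    and child: "\<forall>v x. w \<sqsubseteq> v \<longrightarrow> E v x \<longrightarrow> Child s x v \<longrightarrow> (x \<epsilon> S) v"
    and Letter: "\<forall>v p. w \<sqsubseteq> v \<longrightarrow> E v p \<longrightarrow> Letter s p v \<longrightarrow> (K v \<longleftrightarrow> (p \<epsilon> M) v)"
    and Or: "\<forall>v f. w \<sqsubseteq> v \<longrightarrow> E v f \<longrightarrow> IsOr s f v \<longrightarrow>
      (K v \<longleftrightarrow> (\<exists>i x. E v i \<and> Maps f i x v \<and> (x \<epsilon> V) v))"
    and And: "\<forall>v f. w \<sqsubseteq> v \<longrightarrow> E v f \<longrightarrow> IsAnd s f v \<longrightarrow>
      (K v \<longleftrightarrow> (\<forall>u i x. v \<sqsubseteq> u \<longrightarrow> E u i \<longrightarrow> E u x \<longrightarrow> Maps f i x u \<longrightarrow> (x \<epsilon> V) u))"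
  shows "Decided X M s w"
proof -
  have s: "E w s" using X mm_E by blast
  obtain d where d: "E w d" "\<And>v x. w \<sqsubseteq> v \<Longrightarrow> (x \<epsilon> d) v \<longleftrightarrow> (x \<approx> s) v"
    by (rule singleton_exists[OF s]) (rule that)
  obtain S' where S': "E w S'" "\<And>v x. w \<sqsubseteq> v \<Longrightarrow> (x \<epsilon> S') v \<longleftrightarrow> (x \<epsilon> S) v \<or> (x \<epsilon> d) v"
    by (rule union2[OF T(2) d(1)]) (rule that)
  obtain V' where V': "E w V'" "\<And>v x. w \<sqsubseteq> v \<Longrightarrow> (x \<epsilon> V') v \<longleftrightarrow> (x \<epsilon> V) v \<or> (x \<epsilon> c) v"
    by (rule union2[OF T(3) c(1)]) (rule that)
  have S'_iff: "(x \<epsilon> S') v \<longleftrightarrow> (x \<epsilon> S) v \<or> (x \<approx> s) v" if "w \<sqsubseteq> v" for v x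
    using S'(2) d(2) that by blast
  have V'_iff: "(x \<epsilon> V') v \<longleftrightarrow> (x \<epsilon> V) v \<or> (x \<approx> s) v \<and> K v" if "w \<sqsubseteq> v" for v x
    using V'(2) c(2) that by blast
  have sX: "(s \<epsilon> X) v" if "w \<sqsubseteq> v" for v using X(2) mm_up that by blast
  have K: "(s \<epsilon> V) v \<longleftrightarrow> K v" if v: "w \<sqsubseteq> v" "(s \<epsilon> S) v" for v
    using X(1) v(1) sX[OF v(1)]
  proof (cases rule: Formulas_cases)
    case (1 p)
    then show ?thesis using Truth_Letter[OF T(1) v] Letter v mm_E by blast
  next
    case (2 f I)
    then show ?thesis using Truth_Or[OF T(1) v 2(1,3)] Or v by blast
  next
    case (3 f I)
    then show ?thesis using Truth_And[OF T(1) v 3(1,3)] And v by blast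
  qed
  have VS: "(x \<epsilon> S) v" if "w \<sqsubseteq> v" "(x \<epsilon> V) v" for v x
    using T(1) that unfolding Truth_iff Sub_iff by blast
  have old: "(t \<epsilon> V') v \<longleftrightarrow> (t \<epsilon> V) v" if v: "w \<sqsubseteq> v" "(t \<epsilon> S) v" for v t
  proof -
    have "(t \<epsilon> V) v" if t: "(t \<approx> s) v" "K v"
    proof -
      have "(s \<epsilon> S) v" using mm_cong[OF v(2) t(1) qq_refl] mm_E[OF v(2)] by blast
      then have "(s \<epsilon> V) v" using K v(1) t(2) by blast
      then show ?thesis using mm_cong[OF _ qq_sym[OF t(1)] qq_refl] mm_E by blast
    qed
    then show ?thesis using V'_iff[OF v(1)] by blast
  qed
  have new: "(t \<epsilon> V') v \<longleftrightarrow> K v" if v: "w \<sqsubseteq> v" "(t \<approx> s) v" for v t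
  proof -
    have "K v" if t: "(t \<epsilon> V) v"
    proof -
      have "(s \<epsilon> V) v" using mm_cong[OF t v(2) qq_refl] mm_E[OF t] by blast
      then show ?thesis using K VS v(1) by blast
    qed
    then show ?thesis using V'_iff[OF v(1)] v(2) by blast
  qed
  have ch: "(x \<epsilon> S) v" if v: "w \<sqsubseteq> v" "(t \<epsilon> S') v" "E v x" "Child t x v" for v t x
  proof -
    consider "(t \<epsilon> S) v" | "(t \<approx> s) v" using S'_iff v by blast
    then show ?thesis
    proof cases
      case 1
      then show ?thesis using Truth_Child[OF T(1) v(1) 1 v(3,4)] by blast
    next
      case 2
      then show ?thesis using child v Child_cong[OF v(4) 2 qq_refl[OF v(3)]] by blast
    qed
  qed
  have chV: "(x \<epsilon> V') v \<longleftrightarrow> (x \<epsilon> V) v" if "w \<sqsubseteq> v" "(t \<epsilon> S') v" "E v x" "Child t x v" for v t x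
    using old ch that by blast
  have "\<forall>v t. w \<sqsubseteq> v \<longrightarrow> (t \<epsilon> S') v \<longrightarrow> TruthClause M S' V' t v"
  proof (intro HOL.allI HOL.impI)
    fix v t assume t: "w \<sqsubseteq> v" "(t \<epsilon> S') v"
    show "TruthClause M S' V' t v"
    unfolding TruthClause_iff
  proof (intro HOL.conjI HOL.allI HOL.impI)
    fix u p assume u: "v \<sqsubseteq> u" "E u p" "Letter t p u"
    have wu: "w \<sqsubseteq> u" "(t \<epsilon> S') u" using t u le_trans mm_up by blast+
    consider "(t \<epsilon> S) u" | "(t \<approx> s) u" using S'_iff wu by blast
    then show "(t \<epsilon> V') u \<longleftrightarrow> (p \<epsilon> M) u"
    proof cases
      case 1
      then show ?thesis using old[OF wu(1) 1] Truth_Letter[OF T(1) wu(1) 1 u(2,3)] by blast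
    next
      case 2
      then show ?thesis using new[OF wu(1) 2] Letter wu(1) u(2) Letter_cong[OF u(3) 2 qq_refl[OF u(2)]] by blast
    qed
  next
    fix u f assume u: "v \<sqsubseteq> u" "E u f" "IsOr t f u"
    have wu: "w \<sqsubseteq> u" "(t \<epsilon> S') u" using t u le_trans mm_up by blast+
    have x: "(x \<epsilon> V') u \<longleftrightarrow> (x \<epsilon> V) u" if "E u i" "E u x" "Maps f i x u" for i x
      using chV[OF wu] u that unfolding Child_iff by blast
    consider "(t \<epsilon> S) u" | "(t \<approx> s) u" using S'_iff wu by blast
    then have "(t \<epsilon> V') u \<longleftrightarrow> (\<exists>i x. E u i \<and> Maps f i x u \<and> (x \<epsilon> V) u)"
    proof cases
      case 1
      then show ?thesis using old[OF wu(1) 1] Truth_Or[OF T(1) wu(1) 1 u(2,3)] by blast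
    next
      case 2
      then show ?thesis using new[OF wu(1) 2] Or wu(1) u(2) IsOr_cong[OF u(3) 2 qq_refl[OF u(2)]] by blast
    qed
    then show "(t \<epsilon> V') u \<longleftrightarrow> (\<exists>i x. E u i \<and> Maps f i x u \<and> (x \<epsilon> V') u)"
      using x mm_E by blast
  next
    fix u f assume u: "v \<sqsubseteq> u" "E u f" "IsAnd t f u"
    have wu: "w \<sqsubseteq> u" "(t \<epsilon> S') u" using t u le_trans mm_up by blast+
    have x: "(x \<epsilon> V') u' \<longleftrightarrow> (x \<epsilon> V) u'" if *: "u \<sqsubseteq> u'" "E u' i" "E u' x" "Maps f i x u'" for u' i x
    proof -
      have "w \<sqsubseteq> u'" "(t \<epsilon> S') u'" "E u' f" "IsAnd t f u'"
        using wu u *(1) le_trans mm_up E_up IsAnd_up by blast+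
      then show ?thesis using chV[of u' t x] * unfolding Child_iff by blast
    qed
    consider "(t \<epsilon> S) u" | "(t \<approx> s) u" using S'_iff wu by blast
    then have "(t \<epsilon> V') u \<longleftrightarrow> (\<forall>u' i x. u \<sqsubseteq> u' \<longrightarrow> E u' i \<longrightarrow> E u' x \<longrightarrow> Maps f i x u' \<longrightarrow> (x \<epsilon> V) u')"
    proof cases
      case 1
      then show ?thesis using old[OF wu(1) 1] Truth_And[OF T(1) wu(1) 1 u(2,3)] by blast
    next
      case 2
      then show ?thesis using new[OF wu(1) 2] And wu(1) u(2) IsAnd_cong[OF u(3) 2 qq_refl[OF u(2)]] by blast
    qed
    then show "(t \<epsilon> V') u \<longleftrightarrow> (\<forall>u' i x. u \<sqsubseteq> u' \<longrightarrow> E u' i \<longrightarrow> E u' x \<longrightarrow> Maps f i x u' \<longrightarrow> (x \<epsilon> V') u')"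
      using x by meson
  next
    fix u f i x assume u: "v \<sqsubseteq> u" "E u f" "IsOr t f u" "E u i" "E u x" "Maps f i x u"
    have wu: "w \<sqsubseteq> u" "(t \<epsilon> S') u" using t u le_trans mm_up by blast+
    then show "(x \<epsilon> S') u" using ch[OF wu u(5)] S'_iff u unfolding Child_iff by blast
  next
    fix u f i x assume u: "v \<sqsubseteq> u" "E u f" "IsAnd t f u" "E u i" "E u x" "Maps f i x u"
    have wu: "w \<sqsubseteq> u" "(t \<epsilon> S') u" using t u le_trans mm_up by blast+
    then show "(x \<epsilon> S') u" using ch[OF wu u(5)] S'_iff u unfolding Child_iff by blast
  qed
  qed
  moreover have "Sub V' S' w"
    unfolding Sub_iff using V'_iff S'_iff VS by blast
  ultimately have T': "Truth M S' V' w"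
    unfolding Truth_iff by blast
  have "Sub S' X w"
    unfolding Sub_iff
  proof (intro HOL.allI HOL.impI)
    fix v z assume v: "w \<sqsubseteq> v" "(z \<epsilon> S') v"
    consider "(z \<epsilon> S) v" | "(z \<approx> s) v" using S'_iff v by blast
    then show "(z \<epsilon> X) v"
    proof cases
      case 1
      then show ?thesis using T(4) v unfolding Sub_iff by blast
    next
      case 2
      then show ?thesis using mm_cong[OF sX[OF v(1)] qq_sym[OF 2] qq_refl] mm_E[OF sX[OF v(1)]] by blast
    qed
  qed
  moreover have "(s \<epsilon> S') w" using S'_iff le_refl qq_refl[OF s] by blast
  ultimately show ?thesis
    using S'(1) V'(1) T' unfolding Decided_def k_simps by (intro HOL.exI[of _ S'] HOL.exI[of _ V'] HOL.conjI)
qed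

text \<open>The truth value \<open>K\<close> of \<open>s\<close> is one of the three separable
  conditions: the letter is in \<open>M\<close>, the range \<open>R\<close> of the family meets
  \<open>V\<close>, or \<open>R\<close> is included in \<open>V\<close>. Glueing the fragments of
  the children provides the \<open>S\<close> and \<open>V\<close> needed for the latter two.\<close>

lemma truth_step:
  assumes X: "Formulas C P X w" "E w X" "(s \<epsilon> X) w" and M: "E w M"
    and IH: "\<forall>v x. w \<sqsubseteq> v \<longrightarrow> E v x \<longrightarrow> Child s x v \<longrightarrow> Decided X M x v"
  shows "Decided X M s w"
proof -
  have s: "E w s" using X mm_E by blast
  obtain d where d: "E w d" "\<And>v x. w \<sqsubseteq> v \<Longrightarrow> (x \<epsilon> d) v \<longleftrightarrow> (x \<approx> s) v"
    by (rule singleton_exists[OF s]) (rule that)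
  have children: thesis
    if f: "E w f" "E w I" "IsOr s f w \<or> IsAnd s f w" "Fun f I w"
      and thesis: "\<And>R S V. E w R \<Longrightarrow> (\<And>v x. w \<sqsubseteq> v \<Longrightarrow> (x \<epsilon> R) v \<longleftrightarrow> E v x \<and> (\<exists>i. E v i \<and> Maps f i x v)) \<Longrightarrow>
        E w S \<Longrightarrow> E w V \<Longrightarrow> Sub R S w \<Longrightarrow> Sub S X w \<Longrightarrow> Truth M S V w \<Longrightarrow> thesis" for f I thesis
  proof -
    obtain R where R: "E w R" "\<And>v x. w \<sqsubseteq> v \<Longrightarrow> (x \<epsilon> R) v \<longleftrightarrow> E v x \<and> (\<exists>i. E v i \<and> Maps f i x v)"
      by (rule range_exists[OF f(4,1,2)]) (rule that)
    have "\<forall>v x. w \<sqsubseteq> v \<longrightarrow> (x \<epsilon> R) v \<longrightarrow> Decided X M x v"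
    proof (intro HOL.allI HOL.impI)
      fix v x assume v: "w \<sqsubseteq> v" "(x \<epsilon> R) v"
      then obtain i where "E v x" "E v i" "Maps f i x v" using R by blast
      moreover have "E v f" "IsOr s f v \<or> IsAnd s f v" using f v E_up IsOr_up IsAnd_up by blast+
      ultimately show "Decided X M x v" using IH v unfolding Child_iff by blast
    qed
    then show thesis using truth_union[OF X(1,2) M R(1)] thesis[OF R] by blast
  qed
  from X(1) le_refl X(3) show ?thesis
  proof (cases rule: Formulas_cases)
    case (1 p)
    have p: "E w p" using 1 mm_E by blast
    obtain z where z: "E w z" "Emp z w" using empty_exists by blast
    \<comment> \<open>Below a letter there is nothing, so the empty fragment can be
      extended.\<close>
    have "Truth M z z w" using z unfolding Truth_iff Sub_iff Emp_iff by blast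
    moreover have "Sub z X w" using z unfolding Sub_iff Emp_iff by blast
    moreover obtain c where c: "E w c" "\<And>v x. w \<sqsubseteq> v \<Longrightarrow> (x \<epsilon> c) v \<longleftrightarrow> (x \<epsilon> d) v \<and> (p \<epsilon> M) v"
      by (rule separation_mem[OF d(1) p M]) (rule that)
    moreover have letter: "Letter s p v" "E v p" if "w \<sqsubseteq> v" for v using 1 that Letter_up mm_E mm_up by blast+
    moreover have "(p \<epsilon> M) v \<longleftrightarrow> (q \<epsilon> M) v" if q: "w \<sqsubseteq> v" "E v q" "Letter s q v" for v q
    proof -
      have "(p \<approx> q) v" using Letter_inj[OF letter(1)] letter(2) q by blast
      then show ?thesis using mm_cong[OF _ _ qq_refl] qq_sym E_up[OF M q(1)] by blast
    qed
    ultimately show ?thesis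
      using truth_extend[OF X(1,3), of M z z c "p \<epsilon> M"] z d(2)
        Letter_not_IsOr[OF letter(1)] Letter_not_IsAnd[OF letter(1)] unfolding Child_iff by blast
  next
    case (2 f I)
    have f: "Fun f I w" using 2 unfolding Family_iff by blast
    obtain R S V where R: "E w R" "\<And>v x. w \<sqsubseteq> v \<Longrightarrow> (x \<epsilon> R) v \<longleftrightarrow> E v x \<and> (\<exists>i. E v i \<and> Maps f i x v)"
      and S: "E w S" "E w V" "Sub R S w" "Sub S X w" "Truth M S V w"
      using children[of f I thesis] 2 f by blast
    obtain c where c: "E w c" "\<And>v x. w \<sqsubseteq> v \<Longrightarrow> (x \<epsilon> c) v \<longleftrightarrow> (x \<epsilon> d) v \<and> (\<exists>y. (y \<epsilon> R) v \<and> (y \<epsilon> V) v)"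
      by (rule separation_ex[OF d(1) R(1) S(2)]) (rule that)
    have up: "E v f" "IsOr s f v" if "w \<sqsubseteq> v" for v using that 2 E_up IsOr_up by blast+
    \<comment> \<open>The clauses quantify over every \<open>g\<close> that \<open>s\<close> is a
      disjunction of; all these are equal to \<open>f\<close>.\<close>
    have same: "Maps g i x v \<longleftrightarrow> Maps f i x v" if g: "w \<sqsubseteq> v" "E v g" "IsOr s g v" "E v i" "E v x" for v g i x
    proof -
      have "(g \<approx> f) v" using IsOr_inj[OF g(3) up(2) g(2) up(1)] g(1) by blast
      then show ?thesis using Maps_cong[OF _ _ qq_refl[OF g(4)] qq_refl[OF g(5)]] qq_sym by blast
    qed
    show ?thesis
    proof (rule truth_extend[OF X(1,3) S(5,1,2,4) c(1), where K = "\<lambda>v. \<exists>y. (y \<epsilon> R) v \<and> (y \<epsilon> V) v"])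
      show "\<forall>v z. w \<sqsubseteq> v \<longrightarrow> ((z \<epsilon> c) v \<longleftrightarrow> (z \<approx> s) v \<and> (\<exists>y. (y \<epsilon> R) v \<and> (y \<epsilon> V) v))"
        using c(2) d(2) by blast
      show "\<forall>v x. w \<sqsubseteq> v \<longrightarrow> E v x \<longrightarrow> Child s x v \<longrightarrow> (x \<epsilon> S) v"
        using same IsOr_not_IsAnd[OF up(2) _ up(1)] R(2) S(3) unfolding Child_iff Sub_iff by meson
      show "\<forall>v p. w \<sqsubseteq> v \<longrightarrow> E v p \<longrightarrow> Letter s p v \<longrightarrow> ((\<exists>y. (y \<epsilon> R) v \<and> (y \<epsilon> V) v) \<longleftrightarrow> (p \<epsilon> M) v)"
        using Letter_not_IsOr[OF _ up(2) _ up(1)] by blast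
      show "\<forall>v g. w \<sqsubseteq> v \<longrightarrow> E v g \<longrightarrow> IsOr s g v \<longrightarrow> ((\<exists>y. (y \<epsilon> R) v \<and> (y \<epsilon> V) v) \<longleftrightarrow>
          (\<exists>i x. E v i \<and> Maps g i x v \<and> (x \<epsilon> V) v))"
        using same R(2) mm_E by meson
      show "\<forall>v g. w \<sqsubseteq> v \<longrightarrow> E v g \<longrightarrow> IsAnd s g v \<longrightarrow> ((\<exists>y. (y \<epsilon> R) v \<and> (y \<epsilon> V) v) \<longleftrightarrow>
          (\<forall>u i x. v \<sqsubseteq> u \<longrightarrow> E u i \<longrightarrow> E u x \<longrightarrow> Maps g i x u \<longrightarrow> (x \<epsilon> V) u))"
        using IsOr_not_IsAnd[OF up(2) _ up(1)] by blast
    qed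
  next
    case (3 f I)
    have f: "Fun f I w" using 3 unfolding Family_iff by blast
    obtain R S V where R: "E w R" "\<And>v x. w \<sqsubseteq> v \<Longrightarrow> (x \<epsilon> R) v \<longleftrightarrow> E v x \<and> (\<exists>i. E v i \<and> Maps f i x v)"
      and S: "E w S" "E w V" "Sub R S w" "Sub S X w" "Truth M S V w"
      using children[of f I thesis] 3 f by blast
    obtain c where c: "E w c" "\<And>v x. w \<sqsubseteq> v \<Longrightarrow> (x \<epsilon> c) v \<longleftrightarrow> (x \<epsilon> d) v \<and> Sub R V v"
      by (rule separation_all[OF d(1) R(1) S(2)]) (rule that)
    have up: "E v f" "IsAnd s f v" if "w \<sqsubseteq> v" for v using that 3 E_up IsAnd_up by blast+
    have same: "Maps g i x v \<longleftrightarrow> Maps f i x v" if g: "w \<sqsubseteq> v" "E v g" "IsAnd s g v" "E v i" "E v x" for v g i x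
    proof -
      have "(g \<approx> f) v" using IsAnd_inj[OF g(3) up(2) g(2) up(1)] g(1) by blast
      then show ?thesis using Maps_cong[OF _ _ qq_refl[OF g(4)] qq_refl[OF g(5)]] qq_sym by blast
    qed
    show ?thesis
    proof (rule truth_extend[OF X(1,3) S(5,1,2,4) c(1), where K = "Sub R V"])
      show "\<forall>v z. w \<sqsubseteq> v \<longrightarrow> ((z \<epsilon> c) v \<longleftrightarrow> (z \<approx> s) v \<and> Sub R V v)"
        using c(2) d(2) by blast
      show "\<forall>v x. w \<sqsubseteq> v \<longrightarrow> E v x \<longrightarrow> Child s x v \<longrightarrow> (x \<epsilon> S) v"
        using same IsOr_not_IsAnd[OF _ up(2) _ up(1)] R(2) S(3) unfolding Child_iff Sub_iff by meson
      show "\<forall>v p. w \<sqsubseteq> v \<longrightarrow> E v p \<longrightarrow> Letter s p v \<longrightarrow> (Sub R V v \<longleftrightarrow> (p \<epsilon> M) v)"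
        using Letter_not_IsAnd[OF _ up(2) _ up(1)] by blast
      show "\<forall>v g. w \<sqsubseteq> v \<longrightarrow> E v g \<longrightarrow> IsOr s g v \<longrightarrow> (Sub R V v \<longleftrightarrow>
          (\<exists>i x. E v i \<and> Maps g i x v \<and> (x \<epsilon> V) v))"
        using IsOr_not_IsAnd[OF _ up(2) _ up(1)] by blast
      show "\<forall>v g. w \<sqsubseteq> v \<longrightarrow> E v g \<longrightarrow> IsAnd s g v \<longrightarrow> (Sub R V v \<longleftrightarrow>
          (\<forall>u i x. v \<sqsubseteq> u \<longrightarrow> E u i \<longrightarrow> E u x \<longrightarrow> Maps g i x u \<longrightarrow> (x \<epsilon> V) u))"
      proof (intro HOL.allI HOL.impI)
        fix v g assume v: "w \<sqsubseteq> v" "E v g" "IsAnd s g v"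
        have "(x \<epsilon> R) u \<longleftrightarrow> E u x \<and> (\<exists>i. E u i \<and> Maps g i x u)" if u: "v \<sqsubseteq> u" for u x
        proof -
          have "w \<sqsubseteq> u" "E u g" "IsAnd s g u" using v u le_trans E_up IsAnd_up by blast+
          then show ?thesis using same R(2) by blast
        qed
        then show "Sub R V v \<longleftrightarrow> (\<forall>u i x. v \<sqsubseteq> u \<longrightarrow> E u i \<longrightarrow> E u x \<longrightarrow> Maps g i x u \<longrightarrow> (x \<epsilon> V) u)"
          unfolding Sub_iff by blast
      qed
    qed
  qed
qed

text \<open>Every member of \<open>X\<close> is decided, by induction along \<open>Child\<close>.
  Glueing all fragments yields one that contains \<open>X\<close> and is contained in it.\<close>

lemma truth_exists:
  assumes X: "Formulas C P X w" "E w X" and M: "E w M"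
  obtains V where "E w V" "Truth M X V w"
proof -
  let ?Q = "\<lambda>s. s \<epsilon> X \<longrightarrow>\<^sub>k Decided X M s"
  have Q: "?Q s v" if v: "w \<sqsubseteq> v" "E v s" for v s
  proof (rule Child_induction[of w ?Q, OF _ _ v])
    show "dfn w (\<lambda>e. ?Q (t e))" if "dterm w t" for t
      by (intro dfn_intros dfn_Decided that X M)
  next
    fix v s assume v: "w \<sqsubseteq> v" "E v s"
      and IH: "\<forall>u x. v \<sqsubseteq> u \<longrightarrow> E u x \<longrightarrow> Child s x u \<longrightarrow> ?Q x u"
    show "?Q s v" unfolding kimp_iff
    proof (intro HOL.allI HOL.impI)
      fix u assume u: "v \<sqsubseteq> u" "(s \<epsilon> X) u"
      have wu: "w \<sqsubseteq> u" using v u le_trans by blast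
      note XU = Formulas_up[OF wu X(1)] E_up[OF X(2) wu]
      show "Decided X M s u"
      proof (rule truth_step[OF XU u(2) E_up[OF M wu]], intro HOL.allI HOL.impI)
        fix u' x assume u': "u \<sqsubseteq> u'" "E u' x" "Child s x u'"
        \<comment> \<open>The induction hypothesis speaks of members of \<open>X\<close>, so the
          child must be located there first. The family that makes it a child is only equal, not
          identical, to the one found by the case distinction on \<open>s\<close>.\<close>
        have "(x \<epsilon> X) u'"
        proof -
          have s: "(s \<epsilon> X) u'" using u(2) u'(1) mm_up by blast
          obtain f i where f: "E u' f" "E u' i" "IsOr s f u' \<or> IsAnd s f u'" "Maps f i x u'"
            using u'(3) unfolding Child_iff by blast
          from XU(1) u'(1) s show ?thesis
          proof (cases rule: Formulas_cases)
            case (1 p)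
            then show ?thesis using Letter_not_IsOr Letter_not_IsAnd f mm_E by blast
          next
            case (2 g I)
            then have "IsOr s f u'" using IsOr_not_IsAnd f by blast
            then have "(f \<approx> g) u'" using IsOr_inj 2 f by blast
            then have "Maps g i x u'" using Maps_cong[OF f(4) _ qq_refl[OF f(2)] qq_refl[OF u'(2)]] by blast
            then show ?thesis using 2 f u' le_refl unfolding Family_iff by blast
          next
            case (3 g I)
            then have "IsAnd s f u'" using IsOr_not_IsAnd f by blast
            then have "(f \<approx> g) u'" using IsAnd_inj 3 f by blast
            then have "Maps g i x u'" using Maps_cong[OF f(4) _ qq_refl[OF f(2)] qq_refl[OF u'(2)]] by blast
            then show ?thesis using 3 f u' le_refl unfolding Family_iff by blast
          qed
        qed
        moreover have "v \<sqsubseteq> u'" using u u' le_trans by blast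
        ultimately show "Decided X M x u'" using IH u' le_refl unfolding kimp_iff by blast
      qed
    qed
  qed
  have "\<forall>v s. w \<sqsubseteq> v \<longrightarrow> (s \<epsilon> X) v \<longrightarrow> Decided X M s v"
  proof (intro HOL.allI HOL.impI)
    fix v s assume v: "w \<sqsubseteq> v" "(s \<epsilon> X) v"
    then have "?Q s v" using Q mm_E by blast
    then show "Decided X M s v" using v(2) by (rule kimpD)
  qed
  then obtain S V where S: "E w S" "E w V" "Sub X S w" "Sub S X w" "Truth M S V w"
    using truth_union[OF X M X(2)] by blast
  have "(S \<approx> X) w"
    by (rule extensionality[OF S(1) X(2)]) (use S(3,4) in \<open>unfold Sub_iff, blast\<close>)
  then have "Truth M X V w" using Truth_cong[OF S(5)] qq_refl M S(2) by blast
  then show thesis using that S(2) by blast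
qed

end

section \<open>From game theories to rules\<close>

context kripke
begin

lemma Closed_iff: "Closed R Y w \<longleftrightarrow> (\<forall>v r a b. w \<sqsubseteq> v \<longrightarrow> (r \<epsilon> R) v \<longrightarrow> E v a \<longrightarrow> E v b \<longrightarrow>
    Pair r a b v \<longrightarrow> Sub a Y v \<longrightarrow> (\<exists>x. (x \<epsilon> b) v \<and> (x \<epsilon> Y) v))" (is "_ \<longleftrightarrow> ?rhs")
proof
  show "Closed R Y w \<Longrightarrow> ?rhs"
    unfolding Closed_def kall3_kimp kimp_iff k_simps using mm_E le_refl by meson
  assume ?rhs
  then show "Closed R Y w"
    unfolding Closed_def kall3_kimp kimp_iff k_simps
    using le_trans mm_up E_up Pair_up mm_E by meson
qed

lemma Model_iff: "Model P T M w \<longleftrightarrow> Sub M P w \<and> (\<forall>v t r s. w \<sqsubseteq> v \<longrightarrow> (t \<epsilon> T) v \<longrightarrow> E v r \<longrightarrow> E v s \<longrightarrow>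
    Pair t r s v \<longrightarrow> Satis M r v \<longrightarrow> Satis M s v)" (is "_ \<longleftrightarrow> _ \<and> ?rhs")
proof -
  have "(\<forall>\<^sub>k t r s. t \<epsilon> T \<and>\<^sub>k Pair t r s \<longrightarrow>\<^sub>k Satis M r \<longrightarrow>\<^sub>k Satis M s) w \<longleftrightarrow> ?rhs"
  proof
    show "(\<forall>\<^sub>k t r s. t \<epsilon> T \<and>\<^sub>k Pair t r s \<longrightarrow>\<^sub>k Satis M r \<longrightarrow>\<^sub>k Satis M s) w \<Longrightarrow> ?rhs"
      unfolding kall3_kimp kimp_iff k_simps using mm_E le_refl by meson
    assume ?rhs
    then show "(\<forall>\<^sub>k t r s. t \<epsilon> T \<and>\<^sub>k Pair t r s \<longrightarrow>\<^sub>k Satis M r \<longrightarrow>\<^sub>k Satis M s) w"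
      unfolding kall3_kimp kimp_iff k_simps using le_trans mm_up E_up Pair_up by meson
  qed
  then show ?thesis unfolding Model_def k_simps by blast
qed

lemma SetGen_iff:
  assumes "\<forall>a u v. N a u \<longrightarrow> u \<sqsubseteq> v \<longrightarrow> N a v"
  shows "SetGen N w \<longleftrightarrow> (\<exists>G. E w G \<and> (\<forall>v b. w \<sqsubseteq> v \<longrightarrow> (b \<epsilon> G) v \<longrightarrow> N b v) \<and>
    (\<forall>v a x. w \<sqsubseteq> v \<longrightarrow> N a v \<longrightarrow> (x \<epsilon> a) v \<longrightarrow> (\<exists>b. (b \<epsilon> G) v \<and> (x \<epsilon> b) v \<and> Sub b a v)))"
proof -
  have "(\<forall>\<^sub>k b. b \<epsilon> G \<longrightarrow>\<^sub>k N b) w \<longleftrightarrow> (\<forall>v b. w \<sqsubseteq> v \<longrightarrow> (b \<epsilon> G) v \<longrightarrow> N b v)" for G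
    unfolding kall_kimp using mm_E by blast
  moreover have "(\<forall>\<^sub>k a. N a \<longrightarrow>\<^sub>k (\<forall>\<^sub>k x. x \<epsilon> a \<longrightarrow>\<^sub>k (\<exists>\<^sub>k b. b \<epsilon> G \<and>\<^sub>k x \<epsilon> b \<and>\<^sub>k Sub b a))) w \<longleftrightarrow>
    (\<forall>v a x. w \<sqsubseteq> v \<longrightarrow> N a v \<longrightarrow> (x \<epsilon> a) v \<longrightarrow> (\<exists>b. (b \<epsilon> G) v \<and> (x \<epsilon> b) v \<and> Sub b a v))" (is "_ \<longleftrightarrow> ?rhs") for G
  proof
    show "(\<forall>\<^sub>k a. N a \<longrightarrow>\<^sub>k (\<forall>\<^sub>k x. x \<epsilon> a \<longrightarrow>\<^sub>k (\<exists>\<^sub>k b. b \<epsilon> G \<and>\<^sub>k x \<epsilon> b \<and>\<^sub>k Sub b a))) w \<Longrightarrow> ?rhs"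
      unfolding kall_kimp k_simps using mm_E le_refl by meson
    show "?rhs \<Longrightarrow> (\<forall>\<^sub>k a. N a \<longrightarrow>\<^sub>k (\<forall>\<^sub>k x. x \<epsilon> a \<longrightarrow>\<^sub>k (\<exists>\<^sub>k b. b \<epsilon> G \<and>\<^sub>k x \<epsilon> b \<and>\<^sub>k Sub b a))) w"
      unfolding kall_kimp k_simps using assms mm_E le_trans by meson
  qed
  ultimately show ?thesis unfolding SetGen_def k_simps by presburger
qed

definition Sound :: "'a \<Rightarrow> 'a \<Rightarrow> 'a \<Rightarrow> 'a \<Rightarrow> 'a \<Rightarrow> 'w \<Rightarrow> bool" where
  "Sound X P T a b = (\<forall>\<^sub>k M V. Truth M X V \<and>\<^sub>k Model P T M \<and>\<^sub>k Sub a V \<longrightarrow>\<^sub>k (\<exists>\<^sub>k x. x \<epsilon> b \<and>\<^sub>k x \<epsilon> V))"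

definition Valid :: "('a \<Rightarrow> 'w \<Rightarrow> bool) \<Rightarrow> 'a \<Rightarrow> 'a \<Rightarrow> 'a \<Rightarrow> 'a \<Rightarrow> 'w \<Rightarrow> bool" where
  "Valid D X P T r = (\<exists>\<^sub>k a b. Pair r a b \<and>\<^sub>k Sub a X \<and>\<^sub>k Sub b X \<and>\<^sub>k D a \<and>\<^sub>k Sound X P T a b)"

text \<open>
  Rule sets are recorded only through the property \<open>\<Psi>\<close> that they force on closed sets, so that those
  for the individual members of \<open>X\<close> can be collected and united.
\<close>

definition RuleSet :: "('a \<Rightarrow> 'w \<Rightarrow> bool) \<Rightarrow> 'a \<Rightarrow> 'a \<Rightarrow> 'a \<Rightarrow> 'a \<Rightarrow> ('a \<Rightarrow> 'w \<Rightarrow> bool) \<Rightarrow> 'w \<Rightarrow> bool" where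
  "RuleSet D X P T R \<Psi> = ((\<forall>\<^sub>k r. r \<epsilon> R \<longrightarrow>\<^sub>k Valid D X P T r) \<and>\<^sub>k
    (\<forall>\<^sub>k Y. Sub Y X \<and>\<^sub>k Closed R Y \<longrightarrow>\<^sub>k \<Psi> Y))"

definition Enforced :: "('a \<Rightarrow> 'w \<Rightarrow> bool) \<Rightarrow> 'a \<Rightarrow> 'a \<Rightarrow> 'a \<Rightarrow> ('a \<Rightarrow> 'w \<Rightarrow> bool) \<Rightarrow> 'w \<Rightarrow> bool" where
  "Enforced D X P T \<Psi> = (\<exists>\<^sub>k R. RuleSet D X P T R \<Psi>)"

lemma Sound_iff: "Sound X P T a b w \<longleftrightarrow> (\<forall>v M V. w \<sqsubseteq> v \<longrightarrow> E v M \<longrightarrow> E v V \<longrightarrow> Truth M X V v \<longrightarrow>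
    Model P T M v \<longrightarrow> Sub a V v \<longrightarrow> (\<exists>x. (x \<epsilon> b) v \<and> (x \<epsilon> V) v))"
  unfolding Sound_def kall2_kimp k_simps using mm_E by blast

lemma RuleSet_iff: "RuleSet D X P T R \<Psi> w \<longleftrightarrow> (\<forall>v r. w \<sqsubseteq> v \<longrightarrow> (r \<epsilon> R) v \<longrightarrow> Valid D X P T r v) \<and>
    (\<forall>v Y. w \<sqsubseteq> v \<longrightarrow> E v Y \<longrightarrow> Sub Y X v \<longrightarrow> Closed R Y v \<longrightarrow> \<Psi> Y v)"
  unfolding RuleSet_def kall_kimp k_simps using mm_E by blast

lemma dfn_RuleSet:
  assumes "\<And>t. dterm w t \<Longrightarrow> dfn w (\<lambda>e. D (t e))"
    "\<And>t u. dterm w t \<Longrightarrow> dterm w u \<Longrightarrow> dfn w (\<lambda>e. Q (t e) (u e))"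
    "dterm w t" "dterm w u" "E w X" "E w P" "E w T"
  shows "dfn w (\<lambda>e. RuleSet D X P T (t e) (Q (u e)))"
  unfolding RuleSet_def Valid_def Sound_def
  by (intro dfn_intros dfn_Closed dfn_vocabulary dfn_Pair dfn_Truth dfn_Model assms dterm_shift)

end

text \<open>\<open>C\<close> restricts the index sets of conjunctions in hypotheses,
  \<open>D\<close> the premises of rules. Premises will be singletons, or the set of all conjuncts
  of a conjunction inside a hypothesis; these are the two assumptions on \<open>D\<close>.\<close>

locale game_condition = czf +
  fixes C D
  assumes dfn_C: "dterm w t \<Longrightarrow> dfn w (\<lambda>e. C (t e))"
    and dfn_D: "dterm w t \<Longrightarrow> dfn w (\<lambda>e. D (t e))"
    and D_singleton: "E w x \<Longrightarrow> E w a \<Longrightarrow> Upair a x x w \<Longrightarrow> D a w"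
    and D_range: "C I w \<Longrightarrow> E w I \<Longrightarrow> E w f \<Longrightarrow> Fun f I w \<Longrightarrow> E w R \<Longrightarrow>
      (\<And>v x. w \<sqsubseteq> v \<Longrightarrow> (x \<epsilon> R) v \<longleftrightarrow> E v x \<and> (\<exists>i. E v i \<and> Maps f i x v)) \<Longrightarrow> D R w"
begin

section \<open>What rule sets can force on closed sets\<close>

lemma enforced_mono:
  assumes "Enforced D X P T \<Psi> w"
    "\<forall>v Y. w \<sqsubseteq> v \<longrightarrow> E v Y \<longrightarrow> Sub Y X v \<longrightarrow> (\<forall>u. v \<sqsubseteq> u \<longrightarrow> \<Psi> Y u) \<longrightarrow> \<Psi>' Y v"
  shows "Enforced D X P T \<Psi>' w"
proof -
  obtain R where R: "E w R" "RuleSet D X P T R \<Psi> w"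
    using assms(1) unfolding Enforced_def k_simps by blast
  have "\<Psi> Y u" if "w \<sqsubseteq> v" "E v Y" "Sub Y X v" "Closed R Y v" "v \<sqsubseteq> u" for v Y u
    using R(2) le_trans[OF that(1,5)] E_up[OF that(2,5)] Sub_up[OF that(5,3)] Closed_up[OF that(5,4)]
    unfolding RuleSet_iff by blast
  then have "RuleSet D X P T R \<Psi>' w"
    using R(2) assms(2) unfolding RuleSet_iff by blast
  then show ?thesis using R(1) unfolding Enforced_def k_simps by blast
qed

lemma enforced_true:
  shows "Enforced D X P T (\<lambda>Y v. True) w"
proof -
  obtain z where "E w z" "Emp z w" using empty_exists by blast
  then show ?thesis unfolding Enforced_def RuleSet_iff k_simps Emp_iff by blast
qed

lemma Closed_antimono: "Closed R Y w \<Longrightarrow> Sub R' R w \<Longrightarrow> Closed R' Y w"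
  unfolding Closed_iff Sub_iff by blast

text \<open>More rules leave fewer closed sets, and validity concerns single rules, so the union of
  two rule sets forces both properties.\<close>

lemma enforced_conj:
  assumes "Enforced D X P T \<Psi> w" "Enforced D X P T \<Psi>' w"
  shows "Enforced D X P T (\<lambda>Y v. \<Psi> Y v \<and> \<Psi>' Y v) w"
proof -
  obtain R R' where R: "E w R" "RuleSet D X P T R \<Psi> w" "E w R'" "RuleSet D X P T R' \<Psi>' w"
    using assms unfolding Enforced_def k_simps by blast
  obtain S where S: "E w S" "\<And>v x. w \<sqsubseteq> v \<Longrightarrow> (x \<epsilon> S) v \<longleftrightarrow> (x \<epsilon> R) v \<or> (x \<epsilon> R') v"
    by (rule union2[OF R(1,3)]) (rule that)
  have sub: "Sub R S v" "Sub R' S v" if "w \<sqsubseteq> v" for v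
    using that S(2) le_trans unfolding Sub_iff by blast+
  have "RuleSet D X P T S (\<lambda>Y v. \<Psi> Y v \<and> \<Psi>' Y v) w"
    using R(2,4) S(2) sub Closed_antimono unfolding RuleSet_iff by meson
  then show ?thesis using S(1) unfolding Enforced_def k_simps by blast
qed

text \<open>The infinitary counterpart. Collection may return several rule sets for the same
  \<open>x\<close>, but additional valid rules do no harm.\<close>

lemma enforced_all:
  assumes Q: "\<And>t u. dterm w t \<Longrightarrow> dterm w u \<Longrightarrow> dfn w (\<lambda>e. Q (t e) (u e))"
    and E: "E w X" "E w P" "E w T" "E w a"
    and a: "\<forall>v x. w \<sqsubseteq> v \<longrightarrow> (x \<epsilon> a) v \<longrightarrow> Enforced D X P T (Q x) v"
  shows "Enforced D X P T (\<lambda>Y v. \<forall>u x. v \<sqsubseteq> u \<longrightarrow> (x \<epsilon> a) u \<longrightarrow> Q x Y u) w"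
proof -
  have dfn: "dfn w (\<lambda>e. RuleSet D X P T (e (Suc 0)) (Q (e 0)))"
    by (intro dfn_RuleSet dfn_D Q dterm_var E)
  have "\<forall>v x. w \<sqsubseteq> v \<longrightarrow> (x \<epsilon> a) v \<longrightarrow> (\<exists>R. E v R \<and> RuleSet D X P T R (Q x) v)"
    using a unfolding Enforced_def k_simps by blast
  then obtain b where b: "E w b"
    "\<forall>v x. w \<sqsubseteq> v \<longrightarrow> (x \<epsilon> a) v \<longrightarrow> (\<exists>R. (R \<epsilon> b) v \<and> RuleSet D X P T R (Q x) v)"
    "\<forall>v R. w \<sqsubseteq> v \<longrightarrow> (R \<epsilon> b) v \<longrightarrow> (\<exists>x. (x \<epsilon> a) v \<and> RuleSet D X P T R (Q x) v)"
    using collection[of w "\<lambda>x R. RuleSet D X P T R (Q x)" a, OF dfn E(4)] by blast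
  obtain S where S: "E w S" "\<And>v x. w \<sqsubseteq> v \<Longrightarrow> (x \<epsilon> S) v \<longleftrightarrow> (\<exists>y. (y \<epsilon> b) v \<and> (x \<epsilon> y) v)"
    by (rule union[OF b(1)]) (rule that)
  have "Valid D X P T r v" if r: "w \<sqsubseteq> v" "(r \<epsilon> S) v" for r v
  proof -
    obtain R where "(R \<epsilon> b) v" "(r \<epsilon> R) v" using S r by blast
    then show ?thesis using b(3) r le_refl[of v] unfolding RuleSet_iff by blast
  qed
  moreover have "Q x Y u" if Y: "w \<sqsubseteq> v" "E v Y" "Sub Y X v" "Closed S Y v" "v \<sqsubseteq> u" "(x \<epsilon> a) u" for v u x Y
  proof -
    have wu: "w \<sqsubseteq> u" using Y le_trans by blast
    obtain R where R: "(R \<epsilon> b) u" "RuleSet D X P T R (Q x) u" using b(2) wu Y by blast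
    have "Sub R S u" using R(1) S(2) wu le_trans mm_up unfolding Sub_iff by blast
    then have "Closed R Y u" using Closed_antimono Closed_up[OF Y(5,4)] by blast
    then show ?thesis
      using R(2) E_up[OF Y(2,5)] Sub_up[OF Y(5,3)] le_refl[of u] unfolding RuleSet_iff by blast
  qed
  ultimately have "RuleSet D X P T S (\<lambda>Y v. \<forall>u x. v \<sqsubseteq> u \<longrightarrow> (x \<epsilon> a) u \<longrightarrow> Q x Y u) w"
    unfolding RuleSet_iff by blast
  then show ?thesis using S(1) unfolding Enforced_def k_simps by blast
qed

lemma Sub_cong: "Sub x y u \<Longrightarrow> (x \<approx> x') u \<Longrightarrow> (y \<approx> y') u \<Longrightarrow> Sub x' y' u"
  by (rule cong2[of u Sub, OF dfn_vocabulary(1)[OF dterm_var dterm_var] le_refl])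

lemma enforced_rule:
  assumes "E w a" "E w b" "Sub a X w" "Sub b X w" "D a w" "Sound X P T a b w"
  shows "Enforced D X P T (\<lambda>Y v. Sub a Y v \<longrightarrow> (\<exists>x. (x \<epsilon> b) v \<and> (x \<epsilon> Y) v)) w"
proof -
  obtain r where r: "E w r" "Pair r a b w" using pair_exists[OF assms(1,2)] by blast
  obtain R where R: "E w R" "Upair R r r w" "\<And>v x. w \<sqsubseteq> v \<Longrightarrow> (x \<epsilon> R) v \<longleftrightarrow> (x \<approx> r) v"
    using singleton_exists[OF r(1)] by blast
  have D_up: "D a v" if "w \<sqsubseteq> v" for v
    using dfn_up[of w "\<lambda>e. D (e 0)" "\<lambda>_. a", OF dfn_D[OF dterm_var] assms(5) that] .
  \<comment> \<open>The members of \<open>{r}\<close> are the individuals equal to \<open>r\<close>,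
    so validity has to be transported along \<open>\<approx>\<close>.\<close>
  have "Valid D X P T q v" if q: "w \<sqsubseteq> v" "(q \<epsilon> R) v" for q v
  proof -
    have E: "E v a" "E v b" using assms E_up q by blast+
    have "(r \<approx> q) v" using R q qq_sym by blast
    then have "Pair q a b v" using Pair_cong[OF Pair_up[OF q(1) r(2)]] qq_refl E by blast
    moreover have "Sound X P T a b v" using assms(6) q(1) le_trans unfolding Sound_iff by blast
    ultimately show ?thesis using E D_up[OF q(1)] Sub_up[OF q(1)] assms(3,4) unfolding Valid_def k_simps by blast
  qed
  moreover have "\<exists>x. (x \<epsilon> b) v \<and> (x \<epsilon> Y) v" if Y: "w \<sqsubseteq> v" "Closed R Y v" "Sub a Y v" for v Y
  proof -
    have "(r \<epsilon> R) v" using R(3) Y(1) qq_refl E_up[OF r(1)] by blast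
    then show ?thesis using Y Pair_up[OF Y(1) r(2)] E_up[OF _ Y(1)] assms(1,2) le_refl[of v] unfolding Closed_iff by blast
  qed
  ultimately have "RuleSet D X P T R (\<lambda>Y v. Sub a Y v \<longrightarrow> (\<exists>x. (x \<epsilon> b) v \<and> (x \<epsilon> Y) v)) w"
    unfolding RuleSet_iff by blast
  then show ?thesis using R(1) unfolding Enforced_def k_simps by blast
qed

lemma Sub_singleton:
  assumes "Upair c x x w" "E w x"
  shows "Sub c Y w \<longleftrightarrow> (x \<epsilon> Y) w"
proof
  assume "Sub c Y w"
  then show "(x \<epsilon> Y) w" using assms qq_refl le_refl unfolding Sub_iff Upair_iff by blast
next
  assume x: "(x \<epsilon> Y) w"
  show "Sub c Y w" unfolding Sub_iff
  proof (intro HOL.allI HOL.impI)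
    fix v z assume v: "w \<sqsubseteq> v" "(z \<epsilon> c) v"
    then have "(x \<approx> z) v" using assms(1) qq_sym unfolding Upair_iff by blast
    then show "(z \<epsilon> Y) v" using mm_cong[OF mm_up[OF x v(1)] _ qq_refl] mm_E[OF mm_up[OF x v(1)]] by blast
  qed
qed

lemma enforced_rule_to:
  assumes "E w a" "(y \<epsilon> X) w" "Sub a X w" "D a w"
    and "\<forall>v M V. w \<sqsubseteq> v \<longrightarrow> E v M \<longrightarrow> E v V \<longrightarrow> Truth M X V v \<longrightarrow> Model P T M v \<longrightarrow> Sub a V v \<longrightarrow> (y \<epsilon> V) v"
  shows "Enforced D X P T (\<lambda>Y v. Sub a Y v \<longrightarrow> (y \<epsilon> Y) v) w"
proof -
  have y: "E w y" using assms mm_E by blast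
  obtain b where b: "E w b" "Upair b y y w" "\<And>v x. w \<sqsubseteq> v \<Longrightarrow> (x \<epsilon> b) v \<longleftrightarrow> (x \<approx> y) v"
    using singleton_exists[OF y] by blast
  have "Sub b X w" using Sub_singleton[OF b(2) y] assms(2) by blast
  moreover have yb: "(y \<epsilon> b) v" if "w \<sqsubseteq> v" for v using b(3) that qq_refl E_up[OF y] by blast
  then have "Sound X P T a b w" using assms(5) unfolding Sound_iff by blast
  ultimately have "Enforced D X P T (\<lambda>Y v. Sub a Y v \<longrightarrow> (\<exists>x. (x \<epsilon> b) v \<and> (x \<epsilon> Y) v)) w"
    using enforced_rule assms(1,3,4) b(1) by blast
  then show ?thesis
  proof (rule enforced_mono, intro HOL.allI HOL.impI)
    fix v Y assume v: "w \<sqsubseteq> v" "\<forall>u. v \<sqsubseteq> u \<longrightarrow> Sub a Y u \<longrightarrow> (\<exists>x. (x \<epsilon> b) u \<and> (x \<epsilon> Y) u)" "Sub a Y v"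
    then obtain x where "(x \<approx> y) v" "(x \<epsilon> Y) v" using b(3) le_refl by blast
    then show "(y \<epsilon> Y) v" using mm_cong qq_refl mm_E by blast
  qed
qed

lemma enforced_rule_from:
  assumes "E w b" "(y \<epsilon> X) w" "Sub b X w"
    and "\<forall>v M V. w \<sqsubseteq> v \<longrightarrow> E v M \<longrightarrow> E v V \<longrightarrow> Truth M X V v \<longrightarrow> Model P T M v \<longrightarrow> (y \<epsilon> V) v \<longrightarrow>
      (\<exists>x. (x \<epsilon> b) v \<and> (x \<epsilon> V) v)"
  shows "Enforced D X P T (\<lambda>Y v. (y \<epsilon> Y) v \<longrightarrow> (\<exists>x. (x \<epsilon> b) v \<and> (x \<epsilon> Y) v)) w"
proof -
  have y: "E w y" using assms mm_E by blast
  obtain a where a: "E w a" "Upair a y y w" using pairing[OF y y] by blast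
  have sub: "Sub a V v \<longleftrightarrow> (y \<epsilon> V) v" if "w \<sqsubseteq> v" for v V
    using Sub_singleton[OF Upair_up[OF that a(2)] E_up[OF y that]] .
  have "Sub a X w" using sub le_refl assms(2) by blast
  moreover have "Sound X P T a b w" using assms(4) sub unfolding Sound_iff by blast
  ultimately have "Enforced D X P T (\<lambda>Y v. Sub a Y v \<longrightarrow> (\<exists>x. (x \<epsilon> b) v \<and> (x \<epsilon> Y) v)) w"
    using enforced_rule assms(1,3) a D_singleton[OF y a] by blast
  then show ?thesis
    by (rule enforced_mono) (use sub le_refl in blast)
qed

text \<open>Premise and conclusion are both singletons. Rules of this kind put a disjunction into
  \<open>Y\<close>, take a conjunct out of a conjunction, and express a sequent.\<close>

lemma enforced_rule_elem:
  assumes "(x \<epsilon> X) w" "(y \<epsilon> X) w"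
    and "\<forall>v M V. w \<sqsubseteq> v \<longrightarrow> E v M \<longrightarrow> E v V \<longrightarrow> Truth M X V v \<longrightarrow> Model P T M v \<longrightarrow> (x \<epsilon> V) v \<longrightarrow> (y \<epsilon> V) v"
  shows "Enforced D X P T (\<lambda>Y v. (x \<epsilon> Y) v \<longrightarrow> (y \<epsilon> Y) v) w"
proof -
  have x: "E w x" using assms mm_E by blast
  obtain a where a: "E w a" "Upair a x x w" using pairing[OF x x] by blast
  have sub: "Sub a V v \<longleftrightarrow> (x \<epsilon> V) v" if "w \<sqsubseteq> v" for v V
    using Sub_singleton[OF Upair_up[OF that a(2)] E_up[OF x that]] .
  have "Sub a X w" using sub le_refl assms(1) by blast
  then have "Enforced D X P T (\<lambda>Y v. Sub a Y v \<longrightarrow> (y \<epsilon> Y) v) w"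
    using enforced_rule_to[OF a(1) assms(2)] D_singleton[OF x a] assms(3) sub by blast
  then show ?thesis
    by (rule enforced_mono) (use sub le_refl in blast)
qed

end

section \<open>Closure clauses and the rules that force them\<close>

context kripke
begin

text \<open>These clauses cost singleton premises only. Letters are left free, because the letters
  in \<open>Y\<close> are what the model will be made of.\<close>

definition Clause :: "'a \<Rightarrow> 'a \<Rightarrow> 'w \<Rightarrow> bool" where
  "Clause s Y = ((\<forall>\<^sub>k f i x. IsOr s f \<and>\<^sub>k Maps f i x \<and>\<^sub>k x \<epsilon> Y \<longrightarrow>\<^sub>k s \<epsilon> Y) \<and>\<^sub>k
    (\<forall>\<^sub>k f. IsOr s f \<and>\<^sub>k s \<epsilon> Y \<longrightarrow>\<^sub>k (\<exists>\<^sub>k i x. Maps f i x \<and>\<^sub>k x \<epsilon> Y)) \<and>\<^sub>k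
    (\<forall>\<^sub>k f i x. IsAnd s f \<and>\<^sub>k Maps f i x \<and>\<^sub>k s \<epsilon> Y \<longrightarrow>\<^sub>k x \<epsilon> Y))"

text \<open>Kept apart from \<open>Clause\<close> because its rule takes the whole set of conjuncts
  as its premise, which is affordable only where the index set meets \<open>C\<close>.\<close>

definition AndClause :: "'a \<Rightarrow> 'a \<Rightarrow> 'w \<Rightarrow> bool" where
  "AndClause s Y = (\<forall>\<^sub>k f. IsAnd s f \<and>\<^sub>k (\<forall>\<^sub>k i x. Maps f i x \<longrightarrow>\<^sub>k x \<epsilon> Y) \<longrightarrow>\<^sub>k s \<epsilon> Y)"

definition SequentClause :: "'a \<Rightarrow> 'a \<Rightarrow> 'w \<Rightarrow> bool" where
  "SequentClause t Y = (\<forall>\<^sub>k r s. Pair t r s \<and>\<^sub>k r \<epsilon> Y \<longrightarrow>\<^sub>k s \<epsilon> Y)"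

lemma Clause_iff: "Clause s Y w \<longleftrightarrow>
    (\<forall>v f i x. w \<sqsubseteq> v \<longrightarrow> E v f \<longrightarrow> E v i \<longrightarrow> IsOr s f v \<longrightarrow> Maps f i x v \<longrightarrow> (x \<epsilon> Y) v \<longrightarrow> (s \<epsilon> Y) v) \<and>
    (\<forall>v f. w \<sqsubseteq> v \<longrightarrow> E v f \<longrightarrow> IsOr s f v \<longrightarrow> (s \<epsilon> Y) v \<longrightarrow> (\<exists>i x. E v i \<and> Maps f i x v \<and> (x \<epsilon> Y) v)) \<and>
    (\<forall>v f i x. w \<sqsubseteq> v \<longrightarrow> E v f \<longrightarrow> E v i \<longrightarrow> E v x \<longrightarrow> IsAnd s f v \<longrightarrow> Maps f i x v \<longrightarrow> (s \<epsilon> Y) v \<longrightarrow> (x \<epsilon> Y) v)"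
  (is "_ \<longleftrightarrow> ?I \<and> ?E \<and> ?A")
proof -
  have "(\<forall>\<^sub>k f i x. IsOr s f \<and>\<^sub>k Maps f i x \<and>\<^sub>k x \<epsilon> Y \<longrightarrow>\<^sub>k s \<epsilon> Y) w \<longleftrightarrow> ?I"
    unfolding kall3_kimp k_simps using mm_E by blast
  moreover have "(\<forall>\<^sub>k f. IsOr s f \<and>\<^sub>k s \<epsilon> Y \<longrightarrow>\<^sub>k (\<exists>\<^sub>k i x. Maps f i x \<and>\<^sub>k x \<epsilon> Y)) w \<longleftrightarrow> ?E"
    unfolding kall_kimp k_simps using mm_E by meson
  moreover have "(\<forall>\<^sub>k f i x. IsAnd s f \<and>\<^sub>k Maps f i x \<and>\<^sub>k s \<epsilon> Y \<longrightarrow>\<^sub>k x \<epsilon> Y) w \<longleftrightarrow> ?A"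
    unfolding kall3_kimp k_simps by blast
  ultimately show ?thesis unfolding Clause_def k_simps by presburger
qed

lemma AndClause_iff: "AndClause s Y w \<longleftrightarrow> (\<forall>v f. w \<sqsubseteq> v \<longrightarrow> E v f \<longrightarrow> IsAnd s f v \<longrightarrow>
    (\<forall>u i x. v \<sqsubseteq> u \<longrightarrow> E u i \<longrightarrow> E u x \<longrightarrow> Maps f i x u \<longrightarrow> (x \<epsilon> Y) u) \<longrightarrow> (s \<epsilon> Y) v)"
  unfolding AndClause_def kall_kimp[where w = w] k_simps kall2_kimp by blast

lemma SequentClause_iff: "SequentClause t Y w \<longleftrightarrow>
    (\<forall>v r s. w \<sqsubseteq> v \<longrightarrow> E v s \<longrightarrow> Pair t r s v \<longrightarrow> (r \<epsilon> Y) v \<longrightarrow> (s \<epsilon> Y) v)"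
  unfolding SequentClause_def kall2_kimp k_simps using mm_E by blast

lemma dfn_clauses:
  assumes "dterm w t" "dterm w u"
  shows "dfn w (\<lambda>e. Clause (t e) (u e))" "dfn w (\<lambda>e. AndClause (t e) (u e))"
    "dfn w (\<lambda>e. SequentClause (t e) (u e))"
  unfolding Clause_def AndClause_def SequentClause_def
  by (intro dfn_intros dfn_IsOr dfn_IsAnd dfn_Maps dfn_Pair dterm_shift assms)+

end

context game_condition
begin

text \<open>The shape of \<open>s\<close> is known at \<open>w\<close>, while the clause speaks of
  later worlds and of every \<open>g\<close> presenting \<open>s\<close> there. Disjointness of the
  tags and injectivity of pairs reduce this to the one family \<open>f\<close>.\<close>

lemma enforced_Clause:
  assumes X: "Formulas C' P X w" "E w X" "(s \<epsilon> X) w" and E: "E w P" "E w T"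
  shows "Enforced D X P T (Clause s) w"
proof -
  have s: "E w s" using X mm_E by blast
  have sX: "(s \<epsilon> X) v" if "w \<sqsubseteq> v" for v using X(3) mm_up that by blast
  from X(1) le_refl X(3) show ?thesis
  proof (cases rule: Formulas_cases)
    case (1 p)
    have letter: "Letter s p v" "E v p" if "w \<sqsubseteq> v" for v using 1 that Letter_up mm_E mm_up by blast+
    have "Clause s Y v" if "w \<sqsubseteq> v" for Y v
      unfolding Clause_iff
      using Letter_not_IsOr[OF letter(1) _ letter(2)] Letter_not_IsAnd[OF letter(1) _ letter(2)] that le_trans by blast
    then show ?thesis using enforced_mono[OF enforced_true] by blast
  next
    case (2 f I)
    have f: "Fun f I w" using 2 unfolding Family_iff by blast
    obtain R where R: "E w R" "\<And>v x. w \<sqsubseteq> v \<Longrightarrow> (x \<epsilon> R) v \<longleftrightarrow> E v x \<and> (\<exists>i. E v i \<and> Maps f i x v)"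
      by (rule range_exists[OF f 2(1,2)]) (rule that)
    have up: "E v f" "IsOr s f v" if "w \<sqsubseteq> v" for v using that 2 E_up IsOr_up by blast+
    have RX: "Sub R X w" using R 2(4) unfolding Sub_iff Family_iff by blast
    have same: "Maps g i x v \<longleftrightarrow> Maps f i x v" if g: "w \<sqsubseteq> v" "E v g" "IsOr s g v" "E v i" "E v x" for v g i x
    proof -
      have "(g \<approx> f) v" using IsOr_inj[OF g(3) up(2) g(2) up(1)] g(1) by blast
      then show ?thesis using Maps_cong[OF _ _ qq_refl[OF g(4)] qq_refl[OF g(5)]] qq_sym by blast
    qed
    have truth: "(s \<epsilon> V) v \<longleftrightarrow> (\<exists>x. (x \<epsilon> R) v \<and> (x \<epsilon> V) v)" if v: "w \<sqsubseteq> v" "Truth M X V v" for v M V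
      using Truth_Or[OF v(2) le_refl sX[OF v(1)] up[OF v(1)]] R(2)[OF v(1)] mm_E by blast
    \<comment> \<open>The rules with premise \<open>{x}\<close> and conclusion \<open>{s}\<close>,
      for \<open>x\<close> a disjunct; after them, the single rule with premise \<open>{s}\<close>
      and conclusion \<open>R\<close>.\<close>
    have "Enforced D X P T (\<lambda>Y v. \<forall>u x. v \<sqsubseteq> u \<longrightarrow> (x \<epsilon> R) u \<longrightarrow> (x \<epsilon> Y \<longrightarrow>\<^sub>k s \<epsilon> Y) u) w"
    proof (rule enforced_all[OF _ X(2) E R(1)])
      show "dfn w (\<lambda>e. t e \<epsilon> u e \<longrightarrow>\<^sub>k s \<epsilon> u e)" if "dterm w t" "dterm w u" for t u
        by (intro dfn_intros that s)
      show "\<forall>v x. w \<sqsubseteq> v \<longrightarrow> (x \<epsilon> R) v \<longrightarrow> Enforced D X P T (\<lambda>Y. x \<epsilon> Y \<longrightarrow>\<^sub>k s \<epsilon> Y) v"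
      proof (intro HOL.allI HOL.impI)
        fix v x assume v: "w \<sqsubseteq> v" "(x \<epsilon> R) v"
        have "Enforced D X P T (\<lambda>Y u. (x \<epsilon> Y) u \<longrightarrow> (s \<epsilon> Y) u) v"
        proof (rule enforced_rule_elem)
          show "(x \<epsilon> X) v" using RX v unfolding Sub_iff by blast
          show "(s \<epsilon> X) v" using sX v by blast
          show "\<forall>u M V. v \<sqsubseteq> u \<longrightarrow> E u M \<longrightarrow> E u V \<longrightarrow> Truth M X V u \<longrightarrow> Model P T M u \<longrightarrow> (x \<epsilon> V) u \<longrightarrow> (s \<epsilon> V) u"
            using truth le_trans[OF v(1)] mm_up[OF v(2)] by blast
        qed
        then show "Enforced D X P T (\<lambda>Y. x \<epsilon> Y \<longrightarrow>\<^sub>k s \<epsilon> Y) v"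
          by (rule enforced_mono) (unfold kimp_iff, blast)
      qed
    qed
    moreover have "Enforced D X P T (\<lambda>Y v. (s \<epsilon> Y) v \<longrightarrow> (\<exists>x. (x \<epsilon> R) v \<and> (x \<epsilon> Y) v)) w"
      by (rule enforced_rule_from[OF R(1) X(3) RX]) (use truth in blast)
    ultimately have "Enforced D X P T (\<lambda>Y v. (\<forall>u x. v \<sqsubseteq> u \<longrightarrow> (x \<epsilon> R) u \<longrightarrow> (x \<epsilon> Y \<longrightarrow>\<^sub>k s \<epsilon> Y) u) \<and>
        ((s \<epsilon> Y) v \<longrightarrow> (\<exists>x. (x \<epsilon> R) v \<and> (x \<epsilon> Y) v))) w"
      by (rule enforced_conj)
    then show ?thesis
    proof (rule enforced_mono, intro HOL.allI HOL.impI)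
      fix v Y assume v: "w \<sqsubseteq> v" and Y: "\<forall>u. v \<sqsubseteq> u \<longrightarrow>
        (\<forall>u' x. u \<sqsubseteq> u' \<longrightarrow> (x \<epsilon> R) u' \<longrightarrow> (x \<epsilon> Y \<longrightarrow>\<^sub>k s \<epsilon> Y) u') \<and>
        ((s \<epsilon> Y) u \<longrightarrow> (\<exists>x. (x \<epsilon> R) u \<and> (x \<epsilon> Y) u))"
      have intro: "(s \<epsilon> Y) u" if "v \<sqsubseteq> u" "(x \<epsilon> R) u" "(x \<epsilon> Y) u" for u x
        using Y that kimpD by blast
      show "Clause s Y v" unfolding Clause_iff
      proof (intro HOL.conjI HOL.allI HOL.impI)
        fix u g i x assume u: "v \<sqsubseteq> u" "E u g" "E u i" "IsOr s g u" "Maps g i x u" "(x \<epsilon> Y) u"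
        have wu: "w \<sqsubseteq> u" "E u x" using v u le_trans mm_E by blast+
        then have "(x \<epsilon> R) u" using same[OF wu(1) u(2,4,3) wu(2)] u R(2) by blast
        then show "(s \<epsilon> Y) u" using intro u by blast
      next
        fix u g assume u: "v \<sqsubseteq> u" "E u g" "IsOr s g u" "(s \<epsilon> Y) u"
        have wu: "w \<sqsubseteq> u" using v u le_trans by blast
        obtain x where "(x \<epsilon> R) u" "(x \<epsilon> Y) u" using Y u by blast
        then show "\<exists>i x. E u i \<and> Maps g i x u \<and> (x \<epsilon> Y) u" using same[OF wu u(2,3)] R(2)[OF wu] by blast
      next
        fix u g i x assume u: "v \<sqsubseteq> u" "E u g" "IsAnd s g u"
        have wu: "w \<sqsubseteq> u" using v u le_trans by blast
        show "(x \<epsilon> Y) u" using IsOr_not_IsAnd[OF up(2)[OF wu] u(3) up(1)[OF wu] u(2)] ..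
      qed
    qed
  next
    case (3 f I)
    have f: "Fun f I w" using 3 unfolding Family_iff by blast
    obtain R where R: "E w R" "\<And>v x. w \<sqsubseteq> v \<Longrightarrow> (x \<epsilon> R) v \<longleftrightarrow> E v x \<and> (\<exists>i. E v i \<and> Maps f i x v)"
      by (rule range_exists[OF f 3(1,2)]) (rule that)
    have up: "E v f" "IsAnd s f v" if "w \<sqsubseteq> v" for v using that 3 E_up IsAnd_up by blast+
    have RX: "Sub R X w" using R 3(4) unfolding Sub_iff Family_iff by blast
    have same: "Maps g i x v \<longleftrightarrow> Maps f i x v" if g: "w \<sqsubseteq> v" "E v g" "IsAnd s g v" "E v i" "E v x" for v g i x
    proof -
      have "(g \<approx> f) v" using IsAnd_inj[OF g(3) up(2) g(2) up(1)] g(1) by blast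
      then show ?thesis using Maps_cong[OF _ _ qq_refl[OF g(4)] qq_refl[OF g(5)]] qq_sym by blast
    qed
    have truth: "(x \<epsilon> V) v" if v: "w \<sqsubseteq> v" "Truth M X V v" "(s \<epsilon> V) v" "(x \<epsilon> R) v" for v M V x
      using Truth_And[OF v(2) le_refl sX[OF v(1)] up[OF v(1)]] R(2)[OF v(1)] v le_refl[of v] by blast
    \<comment> \<open>The rules with premise \<open>{s}\<close> and conclusion \<open>{x}\<close>,
      for \<open>x\<close> a conjunct.\<close>
    have "Enforced D X P T (\<lambda>Y v. \<forall>u x. v \<sqsubseteq> u \<longrightarrow> (x \<epsilon> R) u \<longrightarrow> (s \<epsilon> Y \<longrightarrow>\<^sub>k x \<epsilon> Y) u) w"
    proof (rule enforced_all[OF _ X(2) E R(1)])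
      show "dfn w (\<lambda>e. s \<epsilon> u e \<longrightarrow>\<^sub>k t e \<epsilon> u e)" if "dterm w t" "dterm w u" for t u
        by (intro dfn_intros that s)
      show "\<forall>v x. w \<sqsubseteq> v \<longrightarrow> (x \<epsilon> R) v \<longrightarrow> Enforced D X P T (\<lambda>Y. s \<epsilon> Y \<longrightarrow>\<^sub>k x \<epsilon> Y) v"
      proof (intro HOL.allI HOL.impI)
        fix v x assume v: "w \<sqsubseteq> v" "(x \<epsilon> R) v"
        have "Enforced D X P T (\<lambda>Y u. (s \<epsilon> Y) u \<longrightarrow> (x \<epsilon> Y) u) v"
        proof (rule enforced_rule_elem)
          show "(x \<epsilon> X) v" using RX v unfolding Sub_iff by blast
          show "(s \<epsilon> X) v" using sX v by blast
          show "\<forall>u M V. v \<sqsubseteq> u \<longrightarrow> E u M \<longrightarrow> E u V \<longrightarrow> Truth M X V u \<longrightarrow> Model P T M u \<longrightarrow> (s \<epsilon> V) u \<longrightarrow> (x \<epsilon> V) u"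
            using truth le_trans[OF v(1)] mm_up[OF v(2)] by blast
        qed
        then show "Enforced D X P T (\<lambda>Y. s \<epsilon> Y \<longrightarrow>\<^sub>k x \<epsilon> Y) v"
          by (rule enforced_mono) (unfold kimp_iff, blast)
      qed
    qed
    then show ?thesis
    proof (rule enforced_mono, intro HOL.allI HOL.impI)
      fix v Y assume v: "w \<sqsubseteq> v" and Y: "\<forall>u. v \<sqsubseteq> u \<longrightarrow>
        (\<forall>u' x. u \<sqsubseteq> u' \<longrightarrow> (x \<epsilon> R) u' \<longrightarrow> (s \<epsilon> Y \<longrightarrow>\<^sub>k x \<epsilon> Y) u')"
      have elim: "(x \<epsilon> Y) u" if "v \<sqsubseteq> u" "(x \<epsilon> R) u" "(s \<epsilon> Y) u" for u x
        using Y that kimpD le_refl by blast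
      show "Clause s Y v" unfolding Clause_iff
      proof (intro HOL.conjI HOL.allI HOL.impI)
        fix u g i x assume u: "v \<sqsubseteq> u" "E u g" "E u i" "E u x" "IsAnd s g u" "Maps g i x u" "(s \<epsilon> Y) u"
        have wu: "w \<sqsubseteq> u" using v u le_trans by blast
        then have "(x \<epsilon> R) u" using same[OF wu u(2,5,3,4)] u R(2) by blast
        then show "(x \<epsilon> Y) u" using elim u by blast
      next
        fix u g i x assume u: "v \<sqsubseteq> u" "E u g" "IsOr s g u"
        have wu: "w \<sqsubseteq> u" using v u le_trans by blast
        show "(s \<epsilon> Y) u" using IsOr_not_IsAnd[OF u(3) up(2)[OF wu] u(2) up(1)[OF wu]] ..
      next
        fix u g assume u: "v \<sqsubseteq> u" "E u g" "IsOr s g u"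
        have wu: "w \<sqsubseteq> u" using v u le_trans by blast
        show "\<exists>i x. E u i \<and> Maps g i x u \<and> (x \<epsilon> Y) u" using IsOr_not_IsAnd[OF u(3) up(2)[OF wu] u(2) up(1)[OF wu]] ..
      qed
    qed
  qed
qed

text \<open>The rule has premise \<open>R\<close>, the set of all conjuncts, and conclusion
  \<open>{s}\<close>; the premise meets \<open>D\<close> because the index set meets
  \<open>C\<close>. For letters and disjunctions the clause is vacuous.\<close>

lemma enforced_AndClause:
  assumes H: "Formulas C P H w" "(s \<epsilon> H) w" "Sub H X w" and E: "E w P" "E w T"
  shows "Enforced D X P T (AndClause s) w"
proof -
  have sX: "(s \<epsilon> X) v" if "w \<sqsubseteq> v" for v using H(2,3) mm_up that unfolding Sub_iff by blast
  from H(1) le_refl H(2) show ?thesis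
  proof (cases rule: Formulas_cases)
    case (1 p)
    have letter: "Letter s p v" "E v p" if "w \<sqsubseteq> v" for v using 1 that Letter_up mm_E mm_up by blast+
    have "AndClause s Y v" if "w \<sqsubseteq> v" for Y v
      unfolding AndClause_iff using Letter_not_IsAnd[OF letter(1) _ letter(2)] that le_trans by blast
    then show ?thesis using enforced_mono[OF enforced_true] by blast
  next
    case (2 f I)
    have up: "E v f" "IsOr s f v" if "w \<sqsubseteq> v" for v using that 2 E_up IsOr_up by blast+
    have "AndClause s Y v" if "w \<sqsubseteq> v" for Y v
      unfolding AndClause_iff using IsOr_not_IsAnd[OF up(2) _ up(1)] that le_trans by blast
    then show ?thesis using enforced_mono[OF enforced_true] by blast
  next
    case (3 f I)
    have f: "Fun f I w" using 3 unfolding Family_iff by blast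
    obtain R where R: "E w R" "\<And>v x. w \<sqsubseteq> v \<Longrightarrow> (x \<epsilon> R) v \<longleftrightarrow> E v x \<and> (\<exists>i. E v i \<and> Maps f i x v)"
      by (rule range_exists[OF f 3(1,2)]) (rule that)
    have up: "E v f" "IsAnd s f v" if "w \<sqsubseteq> v" for v using that 3 E_up IsAnd_up by blast+
    have RX: "Sub R X w" using R 3(4) H(3) unfolding Sub_iff Family_iff by blast
    have RV: "Sub R V v \<longleftrightarrow> (\<forall>u i x. v \<sqsubseteq> u \<longrightarrow> E u i \<longrightarrow> E u x \<longrightarrow> Maps f i x u \<longrightarrow> (x \<epsilon> V) u)" if "w \<sqsubseteq> v" for v V
      using R(2) le_trans[OF that] unfolding Sub_iff by blast
    have "Enforced D X P T (\<lambda>Y v. Sub R Y v \<longrightarrow> (s \<epsilon> Y) v) w"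
    proof (rule enforced_rule_to[OF R(1) sX[OF le_refl] RX])
      show "D R w" by (rule D_range[OF 3(5,2,1) f R])
      show "\<forall>v M V. w \<sqsubseteq> v \<longrightarrow> E v M \<longrightarrow> E v V \<longrightarrow> Truth M X V v \<longrightarrow> Model P T M v \<longrightarrow> Sub R V v \<longrightarrow> (s \<epsilon> V) v"
        using Truth_And[OF _ le_refl sX up] RV by blast
    qed
    then show ?thesis
    proof (rule enforced_mono, intro HOL.allI HOL.impI)
      fix v Y assume v: "w \<sqsubseteq> v" and Y: "\<forall>u. v \<sqsubseteq> u \<longrightarrow> Sub R Y u \<longrightarrow> (s \<epsilon> Y) u"
      show "AndClause s Y v" unfolding AndClause_iff
      proof (intro HOL.allI HOL.impI)
        fix u g assume u: "v \<sqsubseteq> u" "E u g" "IsAnd s g u"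
          and g: "\<forall>u' i x. u \<sqsubseteq> u' \<longrightarrow> E u' i \<longrightarrow> E u' x \<longrightarrow> Maps g i x u' \<longrightarrow> (x \<epsilon> Y) u'"
        have wu: "w \<sqsubseteq> u" using v u le_trans by blast
        have fg: "(f \<approx> g) u" using IsAnd_inj[OF up(2)[OF wu] u(3) up(1)[OF wu] u(2)] .
        have "Maps g i x u'" if "u \<sqsubseteq> u'" "E u' i" "E u' x" "Maps f i x u'" for u' i x
          using Maps_cong[OF that(4) qq_up[OF fg that(1)] qq_refl[OF that(2)] qq_refl[OF that(3)]] .
        then have "Sub R Y u" using RV[OF wu] g by blast
        then show "(s \<epsilon> Y) u" using Y u by blast
      qed
    qed
  qed
qed

text \<open>Being a model provides truth of the conclusion in some truth set, not necessarily in the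
  given one on \<open>X\<close>. Uniqueness of truth carries it over.\<close>

lemma enforced_SequentClause:
  assumes X: "Formulas C' P X w" "E w X" and E: "E w T" and t: "(t \<epsilon> T) w" "Pair t r s w" "(r \<epsilon> X) w" "(s \<epsilon> X) w"
  shows "Enforced D X P T (SequentClause t) w"
proof -
  have rs: "E w r" "E w s" using t mm_E by blast+
  have up: "Pair t r s v" "E v r" "E v s" "(t \<epsilon> T) v" "(s \<epsilon> X) v" if "w \<sqsubseteq> v" for v
    using that t rs Pair_up E_up mm_up by blast+
  have "Enforced D X P T (\<lambda>Y v. (r \<epsilon> Y) v \<longrightarrow> (s \<epsilon> Y) v) w"
  proof (rule enforced_rule_elem[OF t(3,4)], intro HOL.allI HOL.impI)
    fix v M V assume v: "w \<sqsubseteq> v" "E v M" "E v V" "Truth M X V v" "Model P T M v" "(r \<epsilon> V) v"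
    have "E v X" using X(2) v(1) E_up by blast
    then have "Satis M r v" using v unfolding Satis_def k_simps by blast
    then have "Satis M s v" using v(5) up[OF v(1)] le_refl[of v] unfolding Model_iff by blast
    then obtain S V' where S: "E v S" "E v V'" "Truth M S V' v" "(s \<epsilon> V') v" unfolding Satis_def k_simps by blast
    then have "(s \<epsilon> S) v" using le_refl[of v] unfolding Truth_iff Sub_iff by blast
    then show "(s \<epsilon> V) v"
      using truth_unique[OF Formulas_up[OF v(1) X(1)] \<open>E v X\<close> v(4) \<open>E v X\<close> v(3) S(3,1,2) le_refl up(5)[OF v(1)] up(5)[OF v(1)]]
        S(4) up(5)[OF v(1)] by blast
  qed
  then show ?thesis
  proof (rule enforced_mono, intro HOL.allI HOL.impI)
    fix v Y assume v: "w \<sqsubseteq> v" and Y: "\<forall>u. v \<sqsubseteq> u \<longrightarrow> (r \<epsilon> Y) u \<longrightarrow> (s \<epsilon> Y) u"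
    show "SequentClause t Y v" unfolding SequentClause_iff
    proof (intro HOL.allI HOL.impI)
      fix u r' s' assume u: "v \<sqsubseteq> u" "E u s'" "Pair t r' s' u" "(r' \<epsilon> Y) u"
      have wu: "w \<sqsubseteq> u" using v u le_trans by blast
      have eq: "(r' \<approx> r) u" "(s \<approx> s') u"
        using Pair_inj[OF u(3) up(1)[OF wu]] up(2,3)[OF wu] u mm_E qq_sym by blast+
      then have "(r \<epsilon> Y) u" using mm_cong[OF u(4) _ qq_refl] u mm_E by blast
      then have "(s \<epsilon> Y) u" using Y u(1) by blast
      then show "(s' \<epsilon> Y) u" using mm_cong[OF _ eq(2) qq_refl] mm_E by blast
    qed
  qed
qed

end

section \<open>Models and closed sets\<close>

context kripke
begin

lemma Shape_mono:
  assumes "Shape C P S s w" "Sub S S' w" "\<And>I. C I w \<Longrightarrow> C' I w"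
  shows "Shape C' P S' s w"
proof -
  have "Family f I S' w" if "Family f I S w" for f I
    using that assms(2) unfolding Family_iff Sub_iff by blast
  then show ?thesis using assms(1,3) unfolding Shape_def k_simps by blast
qed

definition LettersOf :: "'a \<Rightarrow> 'a \<Rightarrow> 'a \<Rightarrow> 'w \<Rightarrow> bool" where
  "LettersOf P Y M = (\<forall>\<^sub>k p. p \<epsilon> M \<longleftrightarrow>\<^sub>k p \<epsilon> P \<and>\<^sub>k (\<exists>\<^sub>k s. s \<epsilon> Y \<and>\<^sub>k Letter s p))"

lemma LettersOf_iff: "LettersOf P Y M w \<longleftrightarrow> (\<forall>v p. w \<sqsubseteq> v \<longrightarrow>
    ((p \<epsilon> M) v \<longleftrightarrow> (p \<epsilon> P) v \<and> (\<exists>s. (s \<epsilon> Y) v \<and> Letter s p v)))"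
  unfolding LettersOf_def kall_kiff k_simps using mm_E by meson

lemma dfn_LettersOf: "dterm w r \<Longrightarrow> dterm w t \<Longrightarrow> dterm w u \<Longrightarrow> dfn w (\<lambda>e. LettersOf (r e) (t e) (u e))"
  unfolding LettersOf_def by (intro dfn_intros dfn_Letter dterm_shift)

end

context czf
begin

lemma Letter_exists:
  assumes "E w p" obtains s where "E w s" "Letter s p w"
proof -
  obtain z where z: "E w z" "Emp z w" using empty_exists by blast
  obtain s where "E w s" "Pair s z p w" using pair_exists[OF z(1) assms] by blast
  then show thesis using that z unfolding Letter_def k_simps by blast
qed

lemma Letter_unique:
  assumes "Letter s p w" "Letter s' p w" "E w s" "E w s'" "E w p"
  shows "(s \<approx> s') w"
proof -
  obtain t t' where t: "E w t" "Emp t w" "Pair s t p w" "E w t'" "Emp t' w" "Pair s' t' p w"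
    using assms(1,2) unfolding Letter_def k_simps by blast
  have "(t \<approx> t') w"
    by (rule extensionality[OF t(1,4)]) (use t(2,5) in \<open>unfold Emp_iff, blast\<close>)
  then have "Pair s t' p w" using Pair_cong[OF t(3)] qq_refl assms by blast
  then show ?thesis using Pair_unique t assms by blast
qed

text \<open>
  That some \<open>s \<in> Y\<close> is the letter \<open>p\<close> is not a bounded formula, so separation is only used to form
  \<open>{z \<in> {p}. s \<in> Y}\<close> for each \<open>p\<close>, and these sets are then collected.
\<close>

lemma LettersOf_exists:
  assumes "E w P" "E w Y"
  obtains M where "E w M" "LettersOf P Y M w"
proof -
  let ?Q = "\<lambda>p b. \<forall>\<^sub>k z. z \<epsilon> b \<longleftrightarrow>\<^sub>k z \<approx> p \<and>\<^sub>k (\<exists>\<^sub>k s. s \<epsilon> Y \<and>\<^sub>k Letter s p)"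
  have Q: "?Q p b v \<longleftrightarrow> (\<forall>u z. v \<sqsubseteq> u \<longrightarrow> ((z \<epsilon> b) u \<longleftrightarrow> (z \<approx> p) u \<and> (\<exists>s. (s \<epsilon> Y) u \<and> Letter s p u)))" for p b v
    unfolding kall_kiff k_simps using mm_E qq_E by meson
  have dfn: "dfn w (\<lambda>e. ?Q (e 0) (e (Suc 0)))"
    by (intro dfn_intros dfn_Letter assms)
  have total: "\<exists>b. E v b \<and> ?Q p b v" if v: "w \<sqsubseteq> v" "(p \<epsilon> P) v" for v p
  proof -
    have p: "E v p" using v mm_E by blast
    obtain s where s: "E v s" "Letter s p v" using Letter_exists[OF p] by blast
    obtain d where d: "E v d" "\<And>u x. v \<sqsubseteq> u \<Longrightarrow> (x \<epsilon> d) u \<longleftrightarrow> (x \<approx> p) u"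
      by (rule singleton_exists[OF p]) (rule that)
    obtain b where b: "E v b" "\<And>u x. v \<sqsubseteq> u \<Longrightarrow> (x \<epsilon> b) u \<longleftrightarrow> (x \<epsilon> d) u \<and> (s \<epsilon> Y) u"
      by (rule separation_mem[OF d(1) s(1) E_up[OF assms(2) v(1)]]) (rule that)
    have "(s \<epsilon> Y) u \<longleftrightarrow> (\<exists>s. (s \<epsilon> Y) u \<and> Letter s p u)" if u: "v \<sqsubseteq> u" for u
    proof
      assume "(s \<epsilon> Y) u"
      then show "\<exists>s. (s \<epsilon> Y) u \<and> Letter s p u" using Letter_up[OF u s(2)] by blast
    next
      assume "\<exists>s. (s \<epsilon> Y) u \<and> Letter s p u"
      then obtain s' where s': "(s' \<epsilon> Y) u" "Letter s' p u" by blast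
      have "(s' \<approx> s) u"
        using Letter_unique[OF s'(2) Letter_up[OF u s(2)] _ E_up[OF s(1) u] E_up[OF p u]] mm_E[OF s'(1)] by blast
      then show "(s \<epsilon> Y) u" using mm_cong[OF s'(1) _ qq_refl] mm_E[OF s'(1)] by blast
    qed
    then have "?Q p b v" unfolding Q using b(2) d(2) by blast
    then show ?thesis using b(1) by blast
  qed
  then obtain c where c: "E w c" "\<forall>v p. w \<sqsubseteq> v \<longrightarrow> (p \<epsilon> P) v \<longrightarrow> (\<exists>b. (b \<epsilon> c) v \<and> ?Q p b v)"
    "\<forall>v b. w \<sqsubseteq> v \<longrightarrow> (b \<epsilon> c) v \<longrightarrow> (\<exists>p. (p \<epsilon> P) v \<and> ?Q p b v)"
    using collection[of w ?Q P, OF dfn assms(1)] by blast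
  obtain M where M: "E w M" "\<And>v x. w \<sqsubseteq> v \<Longrightarrow> (x \<epsilon> M) v \<longleftrightarrow> (\<exists>y. (y \<epsilon> c) v \<and> (x \<epsilon> y) v)"
    by (rule union[OF c(1)]) (rule that)
  have "LettersOf P Y M w" unfolding LettersOf_iff
  proof (intro HOL.allI HOL.impI)
    fix v p assume v: "w \<sqsubseteq> v"
    show "(p \<epsilon> M) v \<longleftrightarrow> (p \<epsilon> P) v \<and> (\<exists>s. (s \<epsilon> Y) v \<and> Letter s p v)"
    proof
      assume "(p \<epsilon> M) v"
      then obtain b where b: "(b \<epsilon> c) v" "(p \<epsilon> b) v" using M v by blast
      then obtain q where q: "(q \<epsilon> P) v" "?Q q b v" using c(3) v by blast
      then have pq: "(p \<approx> q) v" "\<exists>s. (s \<epsilon> Y) v \<and> Letter s q v" using b(2) le_refl[of v] unfolding Q by blast+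
      then obtain s where s: "(s \<epsilon> Y) v" "Letter s q v" by blast
      have "(p \<epsilon> P) v" using mm_cong[OF q(1) qq_sym[OF pq(1)] qq_refl] mm_E[OF q(1)] by blast
      moreover have "Letter s p v" using Letter_cong[OF s(2) qq_refl qq_sym[OF pq(1)]] mm_E[OF s(1)] by blast
      ultimately show "(p \<epsilon> P) v \<and> (\<exists>s. (s \<epsilon> Y) v \<and> Letter s p v)" using s(1) by blast
    next
      assume *: "(p \<epsilon> P) v \<and> (\<exists>s. (s \<epsilon> Y) v \<and> Letter s p v)"
      then obtain b where b: "(b \<epsilon> c) v" "?Q p b v" using c(2) v by blast
      have "(p \<approx> p) v" using * mm_E qq_refl by blast
      then have "(p \<epsilon> b) v" using b(2) * le_refl[of v] unfolding Q by blast
      then show "(p \<epsilon> M) v" using M v b by blast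
    qed
  qed
  then show thesis using that M(1) by blast
qed

section \<open>Sets of formulas closed under subformulas\<close>

lemma formulas_of_theory:
  assumes C: "\<And>t. dterm w t \<Longrightarrow> dfn w (\<lambda>e. C (t e))"
    and C_up: "\<And>I u v. C I u \<Longrightarrow> u \<sqsubseteq> v \<Longrightarrow> C I v"
    and Q: "dfn w (\<lambda>e. Q (e 0) (e (Suc 0)))"
    and E: "E w T" "E w P"
    and total: "\<forall>v t. w \<sqsubseteq> v \<longrightarrow> (t \<epsilon> T) v \<longrightarrow> (\<exists>r. E v r \<and> Q t r v \<and> GameFm C P r v)"
  shows "\<exists>H. E w H \<and> Formulas C P H w \<and> (\<forall>v t. w \<sqsubseteq> v \<longrightarrow> (t \<epsilon> T) v \<longrightarrow> (\<exists>r. (r \<epsilon> H) v \<and> Q t r v))"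
proof -
  \<comment> \<open>A game formula comes with a set \<open>S\<close> witnessing that it is one.
    These sets are collected; their union is again such a set because having a permitted shape is
    monotone in \<open>S\<close>.\<close>
  let ?Q = "\<lambda>t S. Formulas C P S \<and>\<^sub>k (\<exists>\<^sub>k r. r \<epsilon> S \<and>\<^sub>k Q t r)"
  have dfn: "dfn w (\<lambda>e. ?Q (e 0) (e (Suc 0)))"
    by (intro dfn_intros dfn_Formulas dfn_subst[of w Q, OF Q] C E)
  have "\<forall>v t. w \<sqsubseteq> v \<longrightarrow> (t \<epsilon> T) v \<longrightarrow> (\<exists>S. E v S \<and> ?Q t S v)"
    using total unfolding GameFm_def k_simps by blast
  then obtain b where b: "E w b" "\<forall>v t. w \<sqsubseteq> v \<longrightarrow> (t \<epsilon> T) v \<longrightarrow> (\<exists>S. (S \<epsilon> b) v \<and> ?Q t S v)"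
    "\<forall>v S. w \<sqsubseteq> v \<longrightarrow> (S \<epsilon> b) v \<longrightarrow> (\<exists>t. (t \<epsilon> T) v \<and> ?Q t S v)"
    using collection[of w ?Q T, OF dfn E(1)] by blast
  obtain H where H: "E w H" "\<And>v x. w \<sqsubseteq> v \<Longrightarrow> (x \<epsilon> H) v \<longleftrightarrow> (\<exists>y. (y \<epsilon> b) v \<and> (x \<epsilon> y) v)"
    by (rule union[OF b(1)]) (rule that)
  have "Formulas C P H w" unfolding Formulas_iff
  proof (intro HOL.allI HOL.impI)
    fix v s assume v: "w \<sqsubseteq> v" "(s \<epsilon> H) v"
    then obtain S where S: "(S \<epsilon> b) v" "(s \<epsilon> S) v" using H by blast
    then have "Formulas C P S v" using b(3) v unfolding k_simps by blast
    then have "Shape C P S s v" using S(2) le_refl[of v] unfolding Formulas_iff by blast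
    moreover have "Sub S H v" using S(1) H(2) le_trans[OF v(1)] mm_up unfolding Sub_iff by blast
    ultimately show "Shape C P H s v" by (rule Shape_mono)
  qed
  moreover have "\<forall>v t. w \<sqsubseteq> v \<longrightarrow> (t \<epsilon> T) v \<longrightarrow> (\<exists>r. (r \<epsilon> H) v \<and> Q t r v)"
    using b(2) H(2) unfolding k_simps by blast
  ultimately show ?thesis using H(1) by blast
qed

text \<open>Also letters that do not occur in the theory must be available in \<open>X\<close>: a
  member of a model is visible to truth sets only through its letter.\<close>

lemma letters_exist:
  assumes "E w P"
  obtains L where "E w L" "Formulas AnySet P L w"
    "\<And>v p s. w \<sqsubseteq> v \<Longrightarrow> (p \<epsilon> P) v \<Longrightarrow> E v s \<Longrightarrow> Letter s p v \<Longrightarrow> (s \<epsilon> L) v"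
proof -
  have dfn: "dfn w (\<lambda>e. Letter (e (Suc 0)) (e 0))" by (intro dfn_Letter dterm_var)
  have "\<forall>v p. w \<sqsubseteq> v \<longrightarrow> (p \<epsilon> P) v \<longrightarrow> (\<exists>s. E v s \<and> Letter s p v)"
  proof (intro HOL.allI HOL.impI)
    fix v p assume "w \<sqsubseteq> v" "(p \<epsilon> P) v"
    then have "E v p" using mm_E by blast
    from Letter_exists[OF this] show "\<exists>s. E v s \<and> Letter s p v" by blast
  qed
  then obtain L where L: "E w L" "\<forall>v p. w \<sqsubseteq> v \<longrightarrow> (p \<epsilon> P) v \<longrightarrow> (\<exists>s. (s \<epsilon> L) v \<and> Letter s p v)"
    "\<forall>v s. w \<sqsubseteq> v \<longrightarrow> (s \<epsilon> L) v \<longrightarrow> (\<exists>p. (p \<epsilon> P) v \<and> Letter s p v)"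
    using collection[of w "\<lambda>p s. Letter s p" P, OF dfn assms] by blast
  have "Formulas AnySet P L w"
    unfolding Formulas_iff
  proof (intro HOL.allI HOL.impI)
    fix v s assume "w \<sqsubseteq> v" "(s \<epsilon> L) v"
    then obtain p where p: "(p \<epsilon> P) v" "Letter s p v" using L(3) by blast
    then have "E v p" using mm_E by blast
    then show "Shape AnySet P L s v"
      unfolding Shape_def k_simps using p by (intro HOL.disjI1 HOL.exI[of _ p] HOL.conjI)
  qed
  moreover have "(s \<epsilon> L) v" if v: "w \<sqsubseteq> v" "(p \<epsilon> P) v" "E v s" "Letter s p v" for v p s
  proof -
    obtain s' where s': "(s' \<epsilon> L) v" "Letter s' p v" using L(2) v by blast
    have "(s' \<approx> s) v" using Letter_unique[OF s'(2) v(4) _ v(3)] mm_E s'(1) v(2) by blast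
    then show ?thesis using mm_cong[OF s'(1) _ qq_refl] mm_E[OF s'(1)] by blast
  qed
  ultimately show thesis using that[OF L(1)] by blast
qed

end

section \<open>The letters of a closed set form a model\<close>

context game_condition
begin

lemma C_up: "C I u \<Longrightarrow> u \<sqsubseteq> v \<Longrightarrow> C I v"
  using dfn_up[of u "\<lambda>e. C (e 0)" "\<lambda>_. I", OF dfn_C[OF dterm_var]] .

lemma letters_of_closed_model:
  assumes E: "E w P" "E w T" "E w H" "E w X" "E w Y" "E w M"
    and H: "Formulas C P H w" and X: "Formulas AnySet P X w" "Sub H X w"
    and T: "\<forall>v t r s. w \<sqsubseteq> v \<longrightarrow> (t \<epsilon> T) v \<longrightarrow> E v r \<longrightarrow> E v s \<longrightarrow> Pair t r s v \<longrightarrow> (r \<epsilon> H) v \<and> (s \<epsilon> X) v"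
    and Y: "\<forall>v s. w \<sqsubseteq> v \<longrightarrow> (s \<epsilon> X) v \<longrightarrow> Clause s Y v"
      "\<forall>v s. w \<sqsubseteq> v \<longrightarrow> (s \<epsilon> H) v \<longrightarrow> AndClause s Y v"
      "\<forall>v t. w \<sqsubseteq> v \<longrightarrow> (t \<epsilon> T) v \<longrightarrow> SequentClause t Y v"
    and M: "LettersOf P Y M w"
  shows "Model P T M w"
proof -
  \<comment> \<open>Stated for an arbitrary fragment \<open>S\<close>, since satisfaction of a
    hypothesis does not tell which truth set is behind it. The restriction to \<open>H\<close> is
    due to conjunctions, which can be introduced only there.\<close>
  have intro: "(s \<epsilon> Y) v"
    if h: "w \<sqsubseteq> u" "Truth M S V u" "E u V" "u \<sqsubseteq> v" "(s \<epsilon> H) v" "(s \<epsilon> V) v" for u v S V s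
  proof -
    let ?Q = "\<lambda>s. s \<epsilon> H \<and>\<^sub>k s \<epsilon> V \<longrightarrow>\<^sub>k s \<epsilon> Y"
    have Eu: "E u H" "E u Y" using E h(1) E_up by blast+
    have "?Q s v"
    proof (rule Child_induction[of u ?Q])
      show "dfn u (\<lambda>e. ?Q (t e))" if "dterm u t" for t
        by (intro dfn_intros that Eu h(3))
    next
      fix v s assume v: "u \<sqsubseteq> v" "E v s"
        and IH: "\<forall>u' x. v \<sqsubseteq> u' \<longrightarrow> E u' x \<longrightarrow> Child s x u' \<longrightarrow> ?Q x u'"
      show "?Q s v" unfolding kimp_iff k_simps
      proof (intro HOL.allI HOL.impI, elim HOL.conjE)
        fix v' assume v': "v \<sqsubseteq> v'" "(s \<epsilon> H) v'" "(s \<epsilon> V) v'"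
        have uv': "u \<sqsubseteq> v'" "w \<sqsubseteq> v'" using h(1) v(1) v'(1) le_trans by blast+
        have sS: "(s \<epsilon> S) v'" using h(2) v'(3) uv'(1) unfolding Truth_iff Sub_iff by blast
        have sX: "(s \<epsilon> X) v'" using X(2) v'(2) uv' unfolding Sub_iff by blast
        have IH': "(x \<epsilon> Y) u'" if "v' \<sqsubseteq> u'" "E u' x" "Child s x u'" "(x \<epsilon> H) u'" "(x \<epsilon> V) u'" for u' x
          using IH le_trans[OF v'(1) that(1)] that le_refl[of u'] unfolding kimp_iff k_simps by blast
        from H uv'(2) v'(2) show "(s \<epsilon> Y) v'"
        proof (cases rule: Formulas_cases)
          case (1 p)
          have p: "E v' p" using 1 mm_E by blast
          have "(p \<epsilon> M) v'" using Truth_Letter[OF h(2) uv'(1) sS p 1(2)] v'(3) by blast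
          then obtain s' where s': "(s' \<epsilon> Y) v'" "Letter s' p v'" using M uv' unfolding LettersOf_iff by blast
          \<comment> \<open>That \<open>p\<close> is in \<open>M\<close> only says that some
            individual coding this letter lies in \<open>Y\<close>; any two such individuals are
            equal.\<close>
          have "(s' \<approx> s) v'" using Letter_unique[OF s'(2) 1(2) _ _ p] mm_E s'(1) sS by blast
          then show ?thesis using mm_cong[OF s'(1) _ qq_refl] mm_E[OF s'(1)] by blast
        next
          case (2 f I)
          obtain i x where x: "E v' i" "Maps f i x v'" "(x \<epsilon> V) v'"
            using Truth_Or[OF h(2) uv'(1) sS 2(1,3)] v'(3) by blast
          then have "E v' x" "(x \<epsilon> H) v'" using 2(4) mm_E le_refl[of v'] unfolding Family_iff by blast+
          then have "(x \<epsilon> Y) v'" using IH'[OF le_refl] x 2 unfolding Child_iff by blast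
          then show ?thesis using Y(1) uv'(2) sX 2 x le_refl[of v'] unfolding Clause_iff by blast
        next
          case (3 f I)
          have "(x \<epsilon> Y) u'" if x: "v' \<sqsubseteq> u'" "E u' i" "E u' x" "Maps f i x u'" for u' i x
          proof -
            have "(x \<epsilon> V) u'" using Truth_And[OF h(2) uv'(1) sS 3(1,3)] v'(3) x by blast
            moreover have "(x \<epsilon> H) u'" using 3(4) x unfolding Family_iff by blast
            moreover have "Child s x u'" using x E_up[OF 3(1)] IsAnd_up[OF _ 3(3)] unfolding Child_iff by blast
            ultimately show ?thesis using IH' x by blast
          qed
          then show ?thesis using Y(2) uv'(2) v'(2) 3 le_refl[of v'] unfolding AndClause_iff by blast
        qed
      qed
    qed (use h mm_E in blast)+
    then show ?thesis using h le_refl unfolding kimp_iff k_simps by blast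
  qed
  \<comment> \<open>Here the truth set is one on all of \<open>X\<close>: satisfaction of a
    conclusion leaves its choice free, and the eliminations are available throughout
    \<open>X\<close>.\<close>
  have elim: "(s \<epsilon> V) v"
    if h: "w \<sqsubseteq> u" "Truth M X V u" "E u V" "u \<sqsubseteq> v" "(s \<epsilon> X) v" "(s \<epsilon> Y) v" for u v V s
  proof -
    let ?Q = "\<lambda>s. s \<epsilon> X \<and>\<^sub>k s \<epsilon> Y \<longrightarrow>\<^sub>k s \<epsilon> V"
    have Eu: "E u X" "E u Y" using E h(1) E_up by blast+
    have "?Q s v"
    proof (rule Child_induction[of u ?Q])
      show "dfn u (\<lambda>e. ?Q (t e))" if "dterm u t" for t
        by (intro dfn_intros that Eu h(3))
    next
      fix v s assume v: "u \<sqsubseteq> v" "E v s"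
        and IH: "\<forall>u' x. v \<sqsubseteq> u' \<longrightarrow> E u' x \<longrightarrow> Child s x u' \<longrightarrow> ?Q x u'"
      show "?Q s v" unfolding kimp_iff k_simps
      proof (intro HOL.allI HOL.impI, elim HOL.conjE)
        fix v' assume v': "v \<sqsubseteq> v'" "(s \<epsilon> X) v'" "(s \<epsilon> Y) v'"
        have uv': "u \<sqsubseteq> v'" "w \<sqsubseteq> v'" using h(1) v(1) v'(1) le_trans by blast+
        have cl: "Clause s Y v'" using Y(1) uv' v' by blast
        have IH': "(x \<epsilon> V) u'" if "v' \<sqsubseteq> u'" "E u' x" "Child s x u'" "(x \<epsilon> X) u'" "(x \<epsilon> Y) u'" for u' x
          using IH le_trans[OF v'(1) that(1)] that le_refl[of u'] unfolding kimp_iff k_simps by blast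
        from X(1) uv'(2) v'(2) show "(s \<epsilon> V) v'"
        proof (cases rule: Formulas_cases)
          case (1 p)
          have p: "E v' p" using 1 mm_E by blast
          have "(p \<epsilon> M) v'" using M uv' 1 v'(3) unfolding LettersOf_iff by blast
          then show ?thesis using Truth_Letter[OF h(2) uv'(1) v'(2) p 1(2)] by blast
        next
          case (2 f I)
          obtain i x where x: "E v' i" "Maps f i x v'" "(x \<epsilon> Y) v'"
            using cl 2 v'(3) le_refl[of v'] unfolding Clause_iff by blast
          then have "E v' x" "(x \<epsilon> X) v'" using 2(4) mm_E le_refl[of v'] unfolding Family_iff by blast+
          then have "(x \<epsilon> V) v'" using IH'[OF le_refl] x 2 unfolding Child_iff by blast
          then show ?thesis using Truth_Or[OF h(2) uv'(1) v'(2) 2(1,3)] x by blast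
        next
          case (3 f I)
          have "(x \<epsilon> V) u'" if x: "v' \<sqsubseteq> u'" "E u' i" "E u' x" "Maps f i x u'" for u' i x
          proof -
            have f: "E u' f" "IsAnd s f u'" using E_up[OF 3(1) x(1)] IsAnd_up[OF x(1) 3(3)] .
            have "(x \<epsilon> Y) u'" using cl x f mm_up[OF v'(3) x(1)] unfolding Clause_iff by blast
            moreover have "(x \<epsilon> X) u'" using 3(4) x unfolding Family_iff by blast
            moreover have "Child s x u'" using x f unfolding Child_iff by blast
            ultimately show ?thesis using IH' x by blast
          qed
          then show ?thesis using Truth_And[OF h(2) uv'(1) v'(2) 3(1,3)] by blast
        qed
      qed
    qed (use h mm_E in blast)+
    then show ?thesis using h le_refl unfolding kimp_iff k_simps by blast
  qed
  show ?thesis unfolding Model_iff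
  proof (intro HOL.conjI HOL.allI HOL.impI)
    show "Sub M P w" using M unfolding LettersOf_iff Sub_iff by blast
  next
    fix v t r s assume v: "w \<sqsubseteq> v" "(t \<epsilon> T) v" "E v r" "E v s" "Pair t r s v" "Satis M r v"
    have rs: "(r \<epsilon> H) v" "(s \<epsilon> X) v" using T v by blast+
    obtain S V where "E v V" "Truth M S V v" "(r \<epsilon> V) v" using v(6) unfolding Satis_def k_simps by blast
    then have "(r \<epsilon> Y) v" using intro[OF v(1) _ _ le_refl rs(1)] by blast
    then have sY: "(s \<epsilon> Y) v" using Y(3) v le_refl[of v] unfolding SequentClause_iff by blast
    obtain V' where "E v V'" "Truth M X V' v"
      using truth_exists[OF Formulas_up[OF v(1) X(1)] E_up[OF E(4) v(1)] E_up[OF E(6) v(1)]] by blast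
    then show "Satis M s v"
      using elim[OF v(1) _ _ le_refl rs(2) sY] E_up[OF E(4) v(1)] unfolding Satis_def k_simps by blast
  qed
qed

end

section \<open>The class of models is set-generated\<close>

context kripke
begin

lemma AnySet_true: "AnySet a w"
  by (simp add: AnySet_def kimp_iff)

lemma GameTh_iff: "GameTh C P T w \<longleftrightarrow> (\<forall>v t. w \<sqsubseteq> v \<longrightarrow> (t \<epsilon> T) v \<longrightarrow>
    (\<exists>r s. E v r \<and> E v s \<and> Pair t r s v \<and> GameFm C P r v \<and> GameFm AnySet P s v))"
  unfolding GameTh_def kall_kimp k_simps using mm_E by blast

lemma Rules_iff: "Rules D X R w \<longleftrightarrow> (\<forall>v r. w \<sqsubseteq> v \<longrightarrow> (r \<epsilon> R) v \<longrightarrow>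
    (\<exists>a b. E v a \<and> E v b \<and> Pair r a b v \<and> Sub a X v \<and> Sub b X v \<and> D a v))"
  unfolding Rules_def kall_kimp k_simps using mm_E by blast

end

context game_condition
begin

lemma theory_formulas:
  assumes th: "GameTh C P T w" and E: "E w P" "E w T"
  obtains H X where "E w H" "Formulas C P H w" "E w X" "Formulas AnySet P X w" "Sub H X w"
    "\<forall>v t r s. w \<sqsubseteq> v \<longrightarrow> (t \<epsilon> T) v \<longrightarrow> E v r \<longrightarrow> E v s \<longrightarrow> Pair t r s v \<longrightarrow> (r \<epsilon> H) v \<and> (s \<epsilon> X) v"
    "\<forall>v p s. w \<sqsubseteq> v \<longrightarrow> (p \<epsilon> P) v \<longrightarrow> E v s \<longrightarrow> Letter s p v \<longrightarrow> (s \<epsilon> X) v"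
proof -
  have "\<exists>H. E w H \<and> Formulas C P H w \<and>
    (\<forall>v t. w \<sqsubseteq> v \<longrightarrow> (t \<epsilon> T) v \<longrightarrow> (\<exists>r. (r \<epsilon> H) v \<and> (\<exists>\<^sub>k s. Pair t r s) v))"
  proof (rule formulas_of_theory)
    show "dfn w (\<lambda>e. C (t e))" if "dterm w t" for t using that by (rule dfn_C)
    show "C I v" if "C I u" "u \<sqsubseteq> v" for I u v using that by (rule C_up)
    show "dfn w (\<lambda>e. \<exists>\<^sub>k s. Pair (e 0) (e (Suc 0)) s)" by (intro dfn_intros dfn_Pair)
    show "\<forall>v t. w \<sqsubseteq> v \<longrightarrow> (t \<epsilon> T) v \<longrightarrow> (\<exists>r. E v r \<and> (\<exists>\<^sub>k s. Pair t r s) v \<and> GameFm C P r v)"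
      using th unfolding GameTh_iff k_simps by blast
  qed (fact E)+
  then obtain H where H: "E w H" "Formulas C P H w"
    "\<forall>v t. w \<sqsubseteq> v \<longrightarrow> (t \<epsilon> T) v \<longrightarrow> (\<exists>r. (r \<epsilon> H) v \<and> (\<exists>\<^sub>k s. Pair t r s) v)"
    by blast
  have "\<exists>K. E w K \<and> Formulas AnySet P K w \<and>
    (\<forall>v t. w \<sqsubseteq> v \<longrightarrow> (t \<epsilon> T) v \<longrightarrow> (\<exists>s. (s \<epsilon> K) v \<and> (\<exists>\<^sub>k r. Pair t r s) v))"
  proof (rule formulas_of_theory)
    show "dfn w (\<lambda>e. AnySet (t e))" if "dterm w t" for t using that by (rule dfn_cond)
    show "AnySet I v" for I v by (rule AnySet_true)
    show "dfn w (\<lambda>e. \<exists>\<^sub>k r. Pair (e 0) r (e (Suc 0)))" by (intro dfn_intros dfn_Pair)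
    show "\<forall>v t. w \<sqsubseteq> v \<longrightarrow> (t \<epsilon> T) v \<longrightarrow> (\<exists>s. E v s \<and> (\<exists>\<^sub>k r. Pair t r s) v \<and> GameFm AnySet P s v)"
      using th unfolding GameTh_iff k_simps by blast
  qed (fact E)+
  then obtain K where K: "E w K" "Formulas AnySet P K w"
    "\<forall>v t. w \<sqsubseteq> v \<longrightarrow> (t \<epsilon> T) v \<longrightarrow> (\<exists>s. (s \<epsilon> K) v \<and> (\<exists>\<^sub>k r. Pair t r s) v)"
    by blast
  obtain L where L: "E w L" "Formulas AnySet P L w"
    "\<And>v p s. w \<sqsubseteq> v \<Longrightarrow> (p \<epsilon> P) v \<Longrightarrow> E v s \<Longrightarrow> Letter s p v \<Longrightarrow> (s \<epsilon> L) v"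
    using letters_exist[OF E(1)] by blast
  obtain X' where X': "E w X'" "\<And>v x. w \<sqsubseteq> v \<Longrightarrow> (x \<epsilon> X') v \<longleftrightarrow> (x \<epsilon> H) v \<or> (x \<epsilon> K) v"
    by (rule union2[OF H(1) K(1)]) (rule that)
  obtain X where X: "E w X" "\<And>v x. w \<sqsubseteq> v \<Longrightarrow> (x \<epsilon> X) v \<longleftrightarrow> (x \<epsilon> X') v \<or> (x \<epsilon> L) v"
    by (rule union2[OF X'(1) L(1)]) (rule that)
  have X_iff: "(x \<epsilon> X) v \<longleftrightarrow> (x \<epsilon> H) v \<or> (x \<epsilon> K) v \<or> (x \<epsilon> L) v" if "w \<sqsubseteq> v" for v x
    using X(2) X'(2) that by blast
  have sub: "Sub H X v" "Sub K X v" "Sub L X v" if "w \<sqsubseteq> v" for v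
    using X_iff le_trans[OF that] unfolding Sub_iff by blast+
  have "Formulas AnySet P X w" unfolding Formulas_iff
  proof (intro HOL.allI HOL.impI)
    fix v s assume v: "w \<sqsubseteq> v" "(s \<epsilon> X) v"
    then consider "(s \<epsilon> H) v" | "(s \<epsilon> K) v" | "(s \<epsilon> L) v" using X_iff by blast
    then show "Shape AnySet P X s v"
    proof cases
      case 1
      then have "Shape C P H s v" using H(2) v unfolding Formulas_iff by blast
      then show ?thesis using sub(1)[OF v(1)] AnySet_true by (rule Shape_mono)
    next
      case 2
      then have "Shape AnySet P K s v" using K(2) v unfolding Formulas_iff by blast
      then show ?thesis using sub(2)[OF v(1)] AnySet_true by (rule Shape_mono)
    next
      case 3
      then have "Shape AnySet P L s v" using L(2) v unfolding Formulas_iff by blast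
      then show ?thesis using sub(3)[OF v(1)] AnySet_true by (rule Shape_mono)
    qed
  qed
  moreover have "(r \<epsilon> H) v \<and> (s \<epsilon> X) v"
    if t: "w \<sqsubseteq> v" "(t \<epsilon> T) v" "E v r" "E v s" "Pair t r s v" for v t r s
  proof
    \<comment> \<open>Collection speaks of some decomposition of \<open>t\<close>; by injectivity of
      pairs it is the given one.\<close>
    obtain r' s' where r': "(r' \<epsilon> H) v" "E v s'" "Pair t r' s' v" using H(3) t unfolding k_simps by blast
    then have "(r' \<approx> r) v" using Pair_inj(1)[OF r'(3) t(5)] t mm_E by blast
    then show "(r \<epsilon> H) v" using mm_cong[OF r'(1) _ qq_refl] mm_E[OF r'(1)] by blast
  next
    obtain r' s' where s': "(s' \<epsilon> K) v" "E v r'" "Pair t r' s' v" using K(3) t unfolding k_simps by blast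
    then have "(s' \<approx> s) v" using Pair_inj(2)[OF s'(3) t(5)] t mm_E by blast
    then have "(s \<epsilon> K) v" using mm_cong[OF s'(1) _ qq_refl] mm_E[OF s'(1)] by blast
    then show "(s \<epsilon> X) v" using X_iff t(1) by blast
  qed
  moreover have "\<forall>v p s. w \<sqsubseteq> v \<longrightarrow> (p \<epsilon> P) v \<longrightarrow> E v s \<longrightarrow> Letter s p v \<longrightarrow> (s \<epsilon> X) v"
    using L(3) X_iff by blast
  ultimately show thesis using that[OF H(1,2) X(1) _ sub(1)[OF le_refl]] by blast
qed

theorem models_set_generated:
  assumes NID: "KNID D w" and th: "GameTh C P T w" and E: "E w P" "E w T"
  shows "SetGen (Model P T) w"
proof -
  obtain H X where H: "E w H" "Formulas C P H w" and X: "E w X" "Formulas AnySet P X w" "Sub H X w"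
    and T: "\<forall>v t r s. w \<sqsubseteq> v \<longrightarrow> (t \<epsilon> T) v \<longrightarrow> E v r \<longrightarrow> E v s \<longrightarrow> Pair t r s v \<longrightarrow> (r \<epsilon> H) v \<and> (s \<epsilon> X) v"
    and L: "\<forall>v p s. w \<sqsubseteq> v \<longrightarrow> (p \<epsilon> P) v \<longrightarrow> E v s \<longrightarrow> Letter s p v \<longrightarrow> (s \<epsilon> X) v"
    by (rule theory_formulas[OF th E]) (rule that)
  have XE: "E v X" "E v P" "E v T" "Formulas AnySet P X v" if "w \<sqsubseteq> v" for v
    using that X E E_up Formulas_up by blast+
  have "Enforced D X P T (\<lambda>Y v. \<forall>u s. v \<sqsubseteq> u \<longrightarrow> (s \<epsilon> X) u \<longrightarrow> Clause s Y u) w"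
  proof (rule enforced_all[OF _ X(1) E X(1)])
    show "dfn w (\<lambda>e. Clause (t e) (u e))" if "dterm w t" "dterm w u" for t u
      using that by (rule dfn_clauses)
    have "Enforced D X P T (Clause s) v" if v: "w \<sqsubseteq> v" "(s \<epsilon> X) v" for v s
      by (rule enforced_Clause[OF XE(4)[OF v(1)] XE(1)[OF v(1)] v(2) XE(2,3)[OF v(1)]])
    then show "\<forall>v s. w \<sqsubseteq> v \<longrightarrow> (s \<epsilon> X) v \<longrightarrow> Enforced D X P T (Clause s) v" by blast
  qed
  moreover have "Enforced D X P T (\<lambda>Y v. \<forall>u s. v \<sqsubseteq> u \<longrightarrow> (s \<epsilon> H) u \<longrightarrow> AndClause s Y u) w"
  proof (rule enforced_all[OF _ X(1) E H(1)])
    show "dfn w (\<lambda>e. AndClause (t e) (u e))" if "dterm w t" "dterm w u" for t u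
      using that by (rule dfn_clauses)
    have "Enforced D X P T (AndClause s) v" if v: "w \<sqsubseteq> v" "(s \<epsilon> H) v" for v s
      by (rule enforced_AndClause[OF Formulas_up[OF v(1) H(2)] v(2) Sub_up[OF v(1) X(3)] XE(2,3)[OF v(1)]])
    then show "\<forall>v s. w \<sqsubseteq> v \<longrightarrow> (s \<epsilon> H) v \<longrightarrow> Enforced D X P T (AndClause s) v" by blast
  qed
  moreover have "Enforced D X P T (\<lambda>Y v. \<forall>u t. v \<sqsubseteq> u \<longrightarrow> (t \<epsilon> T) u \<longrightarrow> SequentClause t Y u) w"
  proof (rule enforced_all[OF _ X(1) E E(2)])
    show "dfn w (\<lambda>e. SequentClause (t e) (u e))" if "dterm w t" "dterm w u" for t u
      using that by (rule dfn_clauses)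
    have "Enforced D X P T (SequentClause t) v" if v: "w \<sqsubseteq> v" "(t \<epsilon> T) v" for v t
    proof -
    obtain r s where rs: "E v r" "E v s" "Pair t r s v" using th v unfolding GameTh_iff by blast
    then have "(r \<epsilon> X) v" "(s \<epsilon> X) v" using T v X(3) unfolding Sub_iff by blast+
    then show ?thesis
      using enforced_SequentClause[OF XE(4,1)[OF v(1)] XE(3)[OF v(1)] v(2) rs(3)] by blast
    qed
    then show "\<forall>v t. w \<sqsubseteq> v \<longrightarrow> (t \<epsilon> T) v \<longrightarrow> Enforced D X P T (SequentClause t) v" by blast
  qed
  ultimately have "Enforced D X P T (\<lambda>Y v. (\<forall>u s. v \<sqsubseteq> u \<longrightarrow> (s \<epsilon> X) u \<longrightarrow> Clause s Y u) \<and>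
      (\<forall>u s. v \<sqsubseteq> u \<longrightarrow> (s \<epsilon> H) u \<longrightarrow> AndClause s Y u) \<and>
      (\<forall>u t. v \<sqsubseteq> u \<longrightarrow> (t \<epsilon> T) u \<longrightarrow> SequentClause t Y u)) w"
    by (intro enforced_conj)
  then obtain R where R: "E w R" "\<forall>v r. w \<sqsubseteq> v \<longrightarrow> (r \<epsilon> R) v \<longrightarrow> Valid D X P T r v"
    and clauses: "\<forall>v Y. w \<sqsubseteq> v \<longrightarrow> E v Y \<longrightarrow> Sub Y X v \<longrightarrow> Closed R Y v \<longrightarrow>
      (\<forall>u s. v \<sqsubseteq> u \<longrightarrow> (s \<epsilon> X) u \<longrightarrow> Clause s Y u) \<and>
      (\<forall>u s. v \<sqsubseteq> u \<longrightarrow> (s \<epsilon> H) u \<longrightarrow> AndClause s Y u) \<and>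
      (\<forall>u t. v \<sqsubseteq> u \<longrightarrow> (t \<epsilon> T) u \<longrightarrow> SequentClause t Y u)"
    unfolding Enforced_def RuleSet_iff k_simps by (elim HOL.exE HOL.conjE) (rule that)
  have closed_up: "\<forall>Y u v. (Sub Y X \<and>\<^sub>k Closed R Y) u \<longrightarrow> u \<sqsubseteq> v \<longrightarrow> (Sub Y X \<and>\<^sub>k Closed R Y) v"
    using Sub_up Closed_up unfolding k_simps by blast
  have Rules: "Rules D X R w"
    unfolding Rules_iff
  proof (intro HOL.allI HOL.impI)
    fix v r assume "w \<sqsubseteq> v" "(r \<epsilon> R) v"
    then have "Valid D X P T r v" using R(2) by blast
    then show "\<exists>a b. E v a \<and> E v b \<and> Pair r a b v \<and> Sub a X v \<and> Sub b X v \<and> D a v"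
      unfolding Valid_def k_simps by blast
  qed
  have "SetGen (\<lambda>Y. Sub Y X \<and>\<^sub>k Closed R Y) w"
    using kimpD[OF kallD[OF kallD[OF NID[unfolded KNID_def] X(1)] R(1)] Rules] .
  then obtain G where G: "E w G" "\<forall>v b. w \<sqsubseteq> v \<longrightarrow> (b \<epsilon> G) v \<longrightarrow> (Sub b X \<and>\<^sub>k Closed R b) v"
    "\<forall>v a x. w \<sqsubseteq> v \<longrightarrow> (Sub a X \<and>\<^sub>k Closed R a) v \<longrightarrow> (x \<epsilon> a) v \<longrightarrow>
      (\<exists>b. (b \<epsilon> G) v \<and> (x \<epsilon> b) v \<and> Sub b a v)"
    unfolding SetGen_iff[of "\<lambda>Y. Sub Y X \<and>\<^sub>k Closed R Y", OF closed_up]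
    by (elim HOL.exE HOL.conjE) (rule that)
  have "\<forall>v b. w \<sqsubseteq> v \<longrightarrow> (b \<epsilon> G) v \<longrightarrow> (\<exists>M. E v M \<and> LettersOf P b M v)"
  proof (intro HOL.allI HOL.impI)
    fix v b assume "w \<sqsubseteq> v" "(b \<epsilon> G) v"
    then have "E v P" "E v b" using XE mm_E by blast+
    from LettersOf_exists[OF this] show "\<exists>M. E v M \<and> LettersOf P b M v" by blast
  qed
  moreover have "dfn w (\<lambda>e. LettersOf P (e 0) (e (Suc 0)))" by (intro dfn_LettersOf dfn_intros E)
  ultimately obtain G' where G': "E w G'"
    "\<forall>v b. w \<sqsubseteq> v \<longrightarrow> (b \<epsilon> G) v \<longrightarrow> (\<exists>M. (M \<epsilon> G') v \<and> LettersOf P b M v)"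
    "\<forall>v M. w \<sqsubseteq> v \<longrightarrow> (M \<epsilon> G') v \<longrightarrow> (\<exists>b. (b \<epsilon> G) v \<and> LettersOf P b M v)"
    using collection[of w "LettersOf P" G, OF _ G(1)] by blast
  have models: "Model P T M v" if v: "w \<sqsubseteq> v" "(M \<epsilon> G') v" for v M
  proof -
    obtain b where b: "(b \<epsilon> G) v" "LettersOf P b M v" using G'(3) v by blast
    then have bE: "E v b" "Sub b X v" "Closed R b v" using G(2) v(1) mm_E unfolding k_simps by blast+
    note cl = clauses[rule_format, OF v(1) bE]
    show ?thesis
    proof (rule letters_of_closed_model[OF XE(2,3)[OF v(1)] E_up[OF H(1) v(1)] XE(1)[OF v(1)] bE(1) _
          Formulas_up[OF v(1) H(2)] XE(4)[OF v(1)] Sub_up[OF v(1) X(3)] _ _ _ _ b(2)])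
      show "E v M" using v mm_E by blast
      show "\<forall>u t r s. v \<sqsubseteq> u \<longrightarrow> (t \<epsilon> T) u \<longrightarrow> E u r \<longrightarrow> E u s \<longrightarrow> Pair t r s u \<longrightarrow> (r \<epsilon> H) u \<and> (s \<epsilon> X) u"
        using T le_trans[OF v(1)] by blast
    qed (use cl in blast)+
  qed
  \<comment> \<open>The model \<open>a\<close> is turned into its truth set \<open>V\<close>, and a
    generator \<open>b\<close> with the letter of \<open>x\<close> in \<open>b \<subseteq> V\<close>
    is turned back into its letters \<open>M\<close>. A letter in \<open>V\<close> belongs to
    \<open>a\<close>, hence \<open>x \<in> M \<subseteq> a\<close>.\<close>
  have generated: "\<exists>M. (M \<epsilon> G') v \<and> (x \<epsilon> M) v \<and> Sub M a v"
    if v: "w \<sqsubseteq> v" "Model P T a v" "(x \<epsilon> a) v" for v a x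
  proof -
    have a: "E v a" "E v x" "(x \<epsilon> P) v" using v le_refl[of v] mm_E unfolding Model_iff Sub_iff by blast+
    obtain V where V: "E v V" "Truth a X V v" using truth_exists[OF XE(4,1)[OF v(1)] a(1)] by blast
    \<comment> \<open>Soundness is known for one decomposition of \<open>r\<close> into premise and
      conclusion and has to be transferred to the given one, which is equal to it.\<close>
    have "Closed R V v" unfolding Closed_iff
    proof (intro HOL.allI HOL.impI)
      fix u r c d assume u: "v \<sqsubseteq> u" "(r \<epsilon> R) u" "E u c" "E u d" "Pair r c d u" "Sub c V u"
      have wu: "w \<sqsubseteq> u" using v u le_trans by blast
      then have "Valid D X P T r u" using R(2) u(2) by blast
      then obtain c' d' where c': "E u c'" "E u d'" "Pair r c' d' u" "Sound X P T c' d' u"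
        unfolding Valid_def k_simps by blast
      have eq: "(c \<approx> c') u" "(d' \<approx> d) u" using Pair_inj[OF u(5) c'(3)] u c' qq_sym by blast+
      have uV: "E u a" "E u V" "Truth a X V u" "Model P T a u" using a V v(2) u(1) E_up Truth_up Model_up by blast+
      then have "Sub c' V u" using Sub_cong[OF u(6) eq(1) qq_refl] by blast
      then obtain y where y: "(y \<epsilon> d') u" "(y \<epsilon> V) u"
        using c'(4) uV le_refl[of u] unfolding Sound_iff by blast
      then have "(y \<epsilon> d) u" using mm_cong[OF y(1) qq_refl eq(2)] mm_E by blast
      then show "\<exists>x. (x \<epsilon> d) u \<and> (x \<epsilon> V) u" using y by blast
    qed
    moreover have "Sub V X v" using V(2) unfolding Truth_iff by blast
    ultimately have closed: "(Sub V X \<and>\<^sub>k Closed R V) v" unfolding k_simps by blast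
    obtain s where s: "E v s" "Letter s x v" using Letter_exists[OF a(2)] by blast
    have "(s \<epsilon> X) v" using L v(1) a(3) s by blast
    then have "(s \<epsilon> V) v" using Truth_Letter[OF V(2) le_refl _ a(2) s(2)] v(3) by blast
    then obtain b where b: "(b \<epsilon> G) v" "(s \<epsilon> b) v" "Sub b V v" using G(3) v(1) closed by blast
    obtain M where M: "(M \<epsilon> G') v" "LettersOf P b M v" using G'(2) v(1) b(1) by blast
    have "(x \<epsilon> M) v" using M(2) a(3) b(2) s(2) le_refl[of v] unfolding LettersOf_iff by blast
    moreover have "Sub M a v" unfolding Sub_iff
    proof (intro HOL.allI HOL.impI)
      fix u p assume u: "v \<sqsubseteq> u" "(p \<epsilon> M) u"
      then obtain s' where s': "(s' \<epsilon> b) u" "Letter s' p u" using M(2) unfolding LettersOf_iff by blast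
      have "(s' \<epsilon> V) u" using b(3) u(1) s'(1) unfolding Sub_iff by blast
      moreover from this have "(s' \<epsilon> X) u" using V(2) u(1) unfolding Truth_iff Sub_iff by blast
      ultimately show "(p \<epsilon> a) u" using Truth_Letter[OF V(2) u(1) _ _ s'(2)] mm_E[OF u(2)] by blast
    qed
    ultimately show ?thesis using M(1) by blast
  qed
  have "\<forall>a u v. Model P T a u \<longrightarrow> u \<sqsubseteq> v \<longrightarrow> Model P T a v"
    using Model_up by blast
  from SetGen_iff[of "Model P T", OF this] show ?thesis
    using G'(1) models generated by blast
qed

lemma NID_implies_set_generated:
  "(KNID D \<longrightarrow>\<^sub>k (\<forall>\<^sub>k P T. GameTh C P T \<longrightarrow>\<^sub>k SetGen (Model P T))) w"
  unfolding kimp_iff[of "KNID D"] kall2_kimp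
proof (intro HOL.allI HOL.impI)
  fix u v P T assume "KNID D u" "u \<sqsubseteq> v" "GameTh C P T v" "E v P" "E v T"
  moreover from this have "KNID D v" unfolding KNID_def by (blast intro: kall_up)
  ultimately show "SetGen (Model P T) v" by (blast intro: models_set_generated)
qed

end

section \<open>The three conditions, and the return to derivability\<close>

context czf
begin

lemma full_condition: "game_condition le E mm qq AnySet AnySet"
  by unfold_locales (simp_all add: dfn_cond AnySet_true)

lemma finitary_condition: "game_condition le E mm qq Fin Fin"
  by unfold_locales (simp_all add: dfn_cond Upair_Fin Fun_range_Fin)

text \<open>Hypotheses contain no conjunctions at all, so the demand on sets of conjuncts is vacuous
  and all premises are singletons.\<close>

lemma elementary_condition: "game_condition le E mm qq NoSet Sing"
proof unfold_locales
  show "E w x \<Longrightarrow> E w a \<Longrightarrow> Upair a x x w \<Longrightarrow> Sing a w" for w x a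
    unfolding Sing_def k_simps by blast
  show "dfn w (\<lambda>e. NoSet (t e))" "dfn w (\<lambda>e. Sing (t e))" if "dterm w t" for w t
    using that by (rule dfn_cond)+
qed (simp add: NoSet_def)

end

text \<open>Completeness asks for truth at every world of every Kripke model of CZF;
  \<open>D\<close> and \<open>D'\<close> are the meanings of the object-level conditions
  \<open>C\<close> and \<open>C'\<close> in such a model.\<close>

lemma CZF_proves:
  assumes C: "fv ((NID C \<^bold>\<longrightarrow> (\<^bold>\<forall>P T. game_theory C' P T \<^bold>\<longrightarrow> set_generated (is_model P T))) 0) = {}"
    and ev: "\<And>le (E :: nat \<times> fm set \<Rightarrow> nat \<Rightarrow> bool) mm qq. czf le E mm qq \<Longrightarrow> \<exists>D D'. game_condition le E mm qq D' D \<and>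
      (\<forall>m a \<rho> \<sigma>. a < m \<longrightarrow> kripke.ev le E mm qq (C a) m \<rho> \<sigma> = D (\<rho> a)) \<and>
      (\<forall>m a \<rho> \<sigma>. a < m \<longrightarrow> kripke.ev le E mm qq (C' a) m \<rho> \<sigma> = D' (\<rho> a))"
  shows "CZF \<turnstile> NID C \<^bold>\<longrightarrow> (\<^bold>\<forall>P T. game_theory C' P T \<^bold>\<longrightarrow> set_generated (is_model P T))"
  unfolding proves_def
proof (rule kripke_completeness[OF CZF_ren C])
  fix le mm qq and E :: "nat \<times> fm set \<Rightarrow> nat \<Rightarrow> bool" and w e
  assume K: "kripke le E mm qq"
    and ax: "\<And>B w e. B \<in> CZF \<Longrightarrow> (\<And>i. E w (e i)) \<Longrightarrow> kripke.sem le E mm qq B e w"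
  interpret czf le E mm qq
    by (intro czf.intro czf_axioms.intro K) (rule ax)
  obtain D D' where "game_condition le E mm qq D' D"
    and evC: "\<And>m a \<rho> \<sigma>. a < m \<Longrightarrow> ev (C a) m \<rho> \<sigma> = D (\<rho> a)"
    and evC': "\<And>m a \<rho> \<sigma>. a < m \<Longrightarrow> ev (C' a) m \<rho> \<sigma> = D' (\<rho> a)"
    using ev[OF czf_axioms] by blast
  then interpret game_condition le E mm qq D' D by simp
  \<comment> \<open>At depth 0 no level is in use, so the assignment to levels can be
    \<open>undefined\<close>.\<close>
  show "sem ((NID C \<^bold>\<longrightarrow> (\<^bold>\<forall>P T. game_theory C' P T \<^bold>\<longrightarrow> set_generated (is_model P T))) 0) e w"
    unfolding ev_zero[of _ e undefined]
    by (subst ev_main[where D = D and D' = D']) (simp_all add: evC evC' NID_implies_set_generated)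
qed

lemmas closed_defs = form_defs NID_def rules_on_def closed_under_def set_generated_def game_theory_def
  game_formula_def is_model_def satisfies_def truth_set_def family_in_def is_letter_def is_Or_def is_And_def
  function_on_def maps_to_def is_pair_def is_upair_def is_finite_def is_singleton_def any_set_def no_set_def
  is_omega_def is_succ_def is_empty_def subset_def

theorem theorem4p2:
  shows "(CZF \<turnstile> full_NID \<^bold>\<longrightarrow>
            (\<^bold>\<forall>P T. any_game_theory P T \<^bold>\<longrightarrow> set_generated (is_model P T)))
       \<and> (CZF \<turnstile> finitary_NID \<^bold>\<longrightarrow>
            (\<^bold>\<forall>P T. finitary_game_theory P T \<^bold>\<longrightarrow> set_generated (is_model P T)))
       \<and> (CZF \<turnstile> elementary_NID \<^bold>\<longrightarrow>
            (\<^bold>\<forall>P T. elementary_game_theory P T \<^bold>\<longrightarrow> set_generated (is_model P T)))"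
  unfolding full_NID_def finitary_NID_def elementary_NID_def
    any_game_theory_def finitary_game_theory_def elementary_game_theory_def
proof (intro HOL.conjI CZF_proves)
  fix le mm qq and E :: "nat \<times> fm set \<Rightarrow> nat \<Rightarrow> bool"
  assume "czf le E mm qq"
  then interpret czf le E mm qq .
  show "\<exists>D D'. game_condition le E mm qq D' D \<and>
      (\<forall>m a \<rho> \<sigma>. a < m \<longrightarrow> ev (any_set a) m \<rho> \<sigma> = D (\<rho> a)) \<and>
      (\<forall>m a \<rho> \<sigma>. a < m \<longrightarrow> ev (any_set a) m \<rho> \<sigma> = D' (\<rho> a))"
    using full_condition by (intro HOL.exI[of _ AnySet]) simp
  show "\<exists>D D'. game_condition le E mm qq D' D \<and>
      (\<forall>m a \<rho> \<sigma>. a < m \<longrightarrow> ev (is_finite a) m \<rho> \<sigma> = D (\<rho> a)) \<and>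
      (\<forall>m a \<rho> \<sigma>. a < m \<longrightarrow> ev (is_finite a) m \<rho> \<sigma> = D' (\<rho> a))"
    using finitary_condition by (intro HOL.exI[of _ Fin]) simp
  show "\<exists>D D'. game_condition le E mm qq D' D \<and>
      (\<forall>m a \<rho> \<sigma>. a < m \<longrightarrow> ev (is_singleton a) m \<rho> \<sigma> = D (\<rho> a)) \<and>
      (\<forall>m a \<rho> \<sigma>. a < m \<longrightarrow> ev (no_set a) m \<rho> \<sigma> = D' (\<rho> a))"
    using elementary_condition by (intro HOL.exI[of _ Sing] HOL.exI[of _ NoSet]) simp
\<comment> \<open>The goals left over say that the three sentences have no free variables.\<close>
qed (auto simp: closed_defs)

end
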